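(* Let $\mathcal{C}$ be a $2$-Calabi-Yau triangulated category with a cluster tilting object, and let $(\mathcal{X},\mathcal{Y})$ be a cotorsion pair in $\mathcal{C}$ with core $I$. Then: 1. Any cluster tilting object $T$ containing $I$ as a direct summand can be written uniquely as $T=T_{\mathcal{X}}\oplus I\oplus T_{\mathcal{Y}}$ such that $T_{\mathcal{X}}\oplus I$ is $\mathcal{X}$-cluster tilting and $T_{\mathcal{Y}}\oplus I$ is $\mathcal{Y}$-cluster tilting. 2. Any $\mathcal{X}$-cluster tilting object (respectively any $\mathcal{Y}$-cluster tilting object) contains $I$ as a direct summand, and so can be written as $M_{\mathcal{X}}\oplus I$ (respectively $M_{\mathcal{Y}}\oplus I$). Furthermore, for any $\mathcal{X}$-cluster tilting object $M_{\mathcal{X}}\oplus I$ and any $\mathcal{Y}$-cluster tilting object $M_{\mathcal{Y}}\oplus I$, the object $M_{\mathcal{X}}\oplus I\oplus M_{\mathcal{Y}}$ is a cluster tilting object in $\mathcal{C}$. 3. There is a bijection between the set of cluster tilting objects of $\mathcal{C}$ containing $I$ as a direct summand and the product of the set of $\mathcal{X}$-cluster tilting objects with the set of $\mathcal{Y}$-cluster tilting objects. The bijection sends $T=T_{\mathcal{X}}\oplus I\oplus T_{\mathcal{Y}}$ (the decomposition in 1) to $(T_{\mathcal{X}}\oplus I,\ T_{\mathcal{Y}}\oplus I)$.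
   Context: Fix a field $k$. All triangulated categories are $k$-linear, Hom-finite and Krull-Schmidt, with shift functor $[1]$; $\mathrm{Ext}^n(X,Y)=\mathrm{Hom}(X,Y[n])$. A subcategory means a full subcategory closed under isomorphisms, finite direct sums and direct summands; $\mathrm{add}\,T$ is the subcategory generated by $T$. For subcategories, $\mathcal{X}*\mathcal{Y}$ is the class of objects $Z$ admitting a triangle $X\to Z\to Y\to X[1]$ with $X\in\mathcal{X}$, $Y\in\mathcal{Y}$. $\mathcal{C}$ is $2$-Calabi-Yau if $[2]$ is a Serre functor: $\mathrm{Hom}(X,Y)\cong \mathrm{Hom}_k(\mathrm{Hom}(Y,X[2]),k)$ functorially. A cotorsion pair is a pair $(\mathcal{X},\mathcal{Y})$ of subcategories with $\mathrm{Ext}^1(\mathcal{X},\mathcal{Y})=0$ and $\mathcal{C}=\mathcal{X}*\mathcal{Y}[1]$; its core is $\mathcal{X}\cap\mathcal{Y}$. In the present situation the core has only finitely many indecomposables up to isomorphism, and it is identified with the basic object $I$ that is the direct sum of representatives of their isoclasses. An object $T$ is cluster tilting if $(\mathrm{add}\,T,\mathrm{add}\,T)$ is a cotorsion pair. Let $\mathcal{X}$ be a contravariantly finite or covariantly finite extension-closed subcategory of $\mathcal{C}$. A subcategory $\mathcal{D}\subseteq\mathcal{X}$ is $\mathcal{X}$-cluster tilting if $\mathcal{D}$ is functorially finite in $\mathcal{X}$ and for every object $M\in\mathcal{X}$: $M\in\mathcal{D}$ iff $\mathrm{Ext}^1(\mathcal{D},M)=0$ iff $\mathrm{Ext}^1(M,\mathcal{D})=0$.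 An object $D\in\mathcal{X}$ is $\mathcal{X}$-cluster tilting if $\mathrm{add}\,D$ is. (For a cotorsion pair $(\mathcal{X},\mathcal{Y})$, both $\mathcal{X}$ and $\mathcal{Y}$ are of this type.) All cluster tilting objects (including $\mathcal{X}$- and $\mathcal{Y}$-cluster tilting objects) are basic, i.e. have pairwise non-isomorphic indecomposable summands, and are considered up to isomorphism. *)

theory Defs
  imports Complex_Main "HOL-Library.FuncSet"
begin

section \<open>Linear categories over a field\<close>

text \<open>
  All Hom-spaces are subspaces of one ambient vector space on the type of morphisms. Nothing is
  lost: the Hom-spaces of any (small) linear category can be embedded into their direct sum, and
  composition is then unambiguous because distinct Hom-spaces meet only in zero. Conversely, no
  disjointness is required below, so a morphism does not determine its domain and codomain, and
  these are always given explicitly.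
\<close>

record ('o, 'm, 'k) lin_cat =
  Obj :: "'o set"
  Hom :: "'o \<Rightarrow> 'o \<Rightarrow> 'm set" (\<open>Hom\<index>\<close>)
  Idn :: "'o \<Rightarrow> 'm" (\<open>Idn\<index>\<close>)
  comp :: "'m \<Rightarrow> 'm \<Rightarrow> 'm" (infixl \<open>\<cdot>\<index>\<close> 75)
  scal :: "'k \<Rightarrow> 'm \<Rightarrow> 'm"

locale linear_category =
  fixes C :: "('o, 'm::ab_group_add, 'k::field, 'z) lin_cat_scheme" (structure)
  assumes vector_space_scal: "vector_space (scal C)"
    and Hom_subspace: "\<lbrakk>X \<in> Obj C; Y \<in> Obj C\<rbrakk> \<Longrightarrow> module.subspace (scal C) (Hom X Y)"
    and Idn_in_Hom: "X \<in> Obj C \<Longrightarrow> Idn X \<in> Hom X X"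
    and comp_in_Hom: "\<lbrakk>X \<in> Obj C; Y \<in> Obj C; Z \<in> Obj C; f \<in> Hom X Y; g \<in> Hom Y Z\<rbrakk>
      \<Longrightarrow> g \<cdot> f \<in> Hom X Z"
    and comp_Idn: "\<lbrakk>X \<in> Obj C; Y \<in> Obj C; f \<in> Hom X Y\<rbrakk> \<Longrightarrow> f \<cdot> Idn X = f"
    and Idn_comp: "\<lbrakk>X \<in> Obj C; Y \<in> Obj C; f \<in> Hom X Y\<rbrakk> \<Longrightarrow> Idn Y \<cdot> f = f"
    and comp_assoc: "\<lbrakk>W \<in> Obj C; X \<in> Obj C; Y \<in> Obj C; Z \<in> Obj C;
      f \<in> Hom W X; g \<in> Hom X Y; h \<in> Hom Y Z\<rbrakk> \<Longrightarrow> (h \<cdot> g) \<cdot> f = h \<cdot> (g \<cdot> f)"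
    and comp_add_right: "\<lbrakk>X \<in> Obj C; Y \<in> Obj C; Z \<in> Obj C;
      f \<in> Hom X Y; f' \<in> Hom X Y; g \<in> Hom Y Z\<rbrakk> \<Longrightarrow> g \<cdot> (f + f') = g \<cdot> f + g \<cdot> f'"
    and comp_add_left: "\<lbrakk>X \<in> Obj C; Y \<in> Obj C; Z \<in> Obj C;
      f \<in> Hom X Y; g \<in> Hom Y Z; g' \<in> Hom Y Z\<rbrakk> \<Longrightarrow> (g + g') \<cdot> f = g \<cdot> f + g' \<cdot> f"
    and comp_scal_right: "\<lbrakk>X \<in> Obj C; Y \<in> Obj C; Z \<in> Obj C;
      f \<in> Hom X Y; g \<in> Hom Y Z\<rbrakk> \<Longrightarrow> g \<cdot> scal C \<alpha> f = scal C \<alpha> (g \<cdot> f)"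
    and comp_scal_left: "\<lbrakk>X \<in> Obj C; Y \<in> Obj C; Z \<in> Obj C;
      f \<in> Hom X Y; g \<in> Hom Y Z\<rbrakk> \<Longrightarrow> scal C \<alpha> g \<cdot> f = scal C \<alpha> (g \<cdot> f)"

definition iso_mor :: "('o, 'm, 'k, 'z) lin_cat_scheme \<Rightarrow> 'o \<Rightarrow> 'o \<Rightarrow> 'm \<Rightarrow> bool" where
  "iso_mor C X Y f \<longleftrightarrow> f \<in> Hom\<^bsub>C\<^esub> X Y \<and>
     (\<exists>g \<in> Hom\<^bsub>C\<^esub> Y X. g \<cdot>\<^bsub>C\<^esub> f = Idn\<^bsub>C\<^esub> X \<and> f \<cdot>\<^bsub>C\<^esub> g = Idn\<^bsub>C\<^esub> Y)"

definition iso_obj :: "('o, 'm, 'k, 'z) lin_cat_scheme \<Rightarrow> 'o \<Rightarrow> 'o \<Rightarrow> bool" (infix \<open>\<simeq>\<index>\<close> 50) where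
  "X \<simeq>\<^bsub>C\<^esub> Y \<longleftrightarrow> X \<in> Obj C \<and> Y \<in> Obj C \<and> (\<exists>f. iso_mor C X Y f)"

definition iso_class :: "('o, 'm, 'k, 'z) lin_cat_scheme \<Rightarrow> 'o \<Rightarrow> 'o set" where
  "iso_class C X = {Y. X \<simeq>\<^bsub>C\<^esub> Y}"

definition zero_obj :: "('o, 'm::ab_group_add, 'k, 'z) lin_cat_scheme \<Rightarrow> 'o \<Rightarrow> bool" where
  "zero_obj C Z \<longleftrightarrow> Z \<in> Obj C \<and> (\<forall>X \<in> Obj C. Hom\<^bsub>C\<^esub> X Z = {0} \<and> Hom\<^bsub>C\<^esub> Z X = {0})"

text \<open>\<open>Z\<close> is a biproduct of the listed objects; for the empty list, \<open>Z\<close> is a zero object.\<close>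

definition direct_sum :: "('o, 'm::ab_group_add, 'k, 'z) lin_cat_scheme \<Rightarrow> 'o list \<Rightarrow> 'o \<Rightarrow> bool" where
  "direct_sum C Xs Z \<longleftrightarrow> set Xs \<subseteq> Obj C \<and> Z \<in> Obj C \<and>
     (\<exists>\<iota> \<pi>. (\<forall>i < length Xs. \<iota> i \<in> Hom\<^bsub>C\<^esub> (Xs ! i) Z \<and> \<pi> i \<in> Hom\<^bsub>C\<^esub> Z (Xs ! i)) \<and>
       (\<forall>i < length Xs. \<forall>j < length Xs.
          \<pi> j \<cdot>\<^bsub>C\<^esub> \<iota> i = (if i = j then Idn\<^bsub>C\<^esub> (Xs ! i) else 0)) \<and>
       (\<Sum>i < length Xs. \<iota> i \<cdot>\<^bsub>C\<^esub> \<pi> i) = Idn\<^bsub>C\<^esub> Z)"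

text \<open>A chosen biproduct of two objects, determined up to isomorphism.\<close>

definition dsum :: "('o, 'm::ab_group_add, 'k, 'z) lin_cat_scheme \<Rightarrow> 'o \<Rightarrow> 'o \<Rightarrow> 'o"
    (infixl \<open>\<oplus>\<index>\<close> 65) where
  "X \<oplus>\<^bsub>C\<^esub> Y = (SOME Z. direct_sum C [X, Y] Z)"

definition summand :: "('o, 'm::ab_group_add, 'k, 'z) lin_cat_scheme \<Rightarrow> 'o \<Rightarrow> 'o \<Rightarrow> bool" where
  "summand C X Z \<longleftrightarrow> (\<exists>Y. direct_sum C [X, Y] Z)"

locale additive_linear_category = linear_category +
  assumes direct_sums_exist: "set Xs \<subseteq> Obj C \<Longrightarrow> \<exists>Z. direct_sum C Xs Z"

definition hom_finite :: "('o, 'm::ab_group_add, 'k::field, 'z) lin_cat_scheme \<Rightarrow> bool" where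
  "hom_finite C \<longleftrightarrow> (\<forall>X \<in> Obj C. \<forall>Y \<in> Obj C.
     \<exists>B. finite B \<and> module.span (scal C) B = Hom\<^bsub>C\<^esub> X Y)"

text \<open>The endomorphism ring of \<open>X\<close> is local: it is nonzero and its non-units are closed under addition.\<close>

definition local_End :: "('o, 'm::ab_group_add, 'k, 'z) lin_cat_scheme \<Rightarrow> 'o \<Rightarrow> bool" where
  "local_End C X \<longleftrightarrow> X \<in> Obj C \<and> Idn\<^bsub>C\<^esub> X \<noteq> 0 \<and>
     (\<forall>f \<in> Hom\<^bsub>C\<^esub> X X. \<forall>g \<in> Hom\<^bsub>C\<^esub> X X.
        \<not> iso_mor C X X f \<longrightarrow> \<not> iso_mor C X X g \<longrightarrow> \<not> iso_mor C X X (f + g))"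

definition krull_schmidt :: "('o, 'm::ab_group_add, 'k, 'z) lin_cat_scheme \<Rightarrow> bool" where
  "krull_schmidt C \<longleftrightarrow> (\<forall>Z \<in> Obj C. \<exists>Xs. direct_sum C Xs Z \<and> (\<forall>X \<in> set Xs. local_End C X))"

definition indecomposable :: "('o, 'm::ab_group_add, 'k, 'z) lin_cat_scheme \<Rightarrow> 'o \<Rightarrow> bool" where
  "indecomposable C X \<longleftrightarrow> X \<in> Obj C \<and> \<not> zero_obj C X \<and>
     (\<forall>A B. direct_sum C [A, B] X \<longrightarrow> zero_obj C A \<or> zero_obj C B)"

definition noniso_indecomposables :: "('o, 'm::ab_group_add, 'k, 'z) lin_cat_scheme \<Rightarrow> 'o list \<Rightarrow> bool" where
  "noniso_indecomposables C Xs \<longleftrightarrow> (\<forall>X \<in> set Xs. indecomposable C X) \<and>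
     (\<forall>i < length Xs. \<forall>j < length Xs. i \<noteq> j \<longrightarrow> \<not> Xs ! i \<simeq>\<^bsub>C\<^esub> Xs ! j)"

definition basic :: "('o, 'm::ab_group_add, 'k, 'z) lin_cat_scheme \<Rightarrow> 'o \<Rightarrow> bool" where
  "basic C Z \<longleftrightarrow> (\<exists>Xs. direct_sum C Xs Z \<and> noniso_indecomposables C Xs)"


section \<open>Subcategories and approximations\<close>

text \<open>
  A full subcategory is given by its set of objects. Taking \<open>Xs\<close> to be a one-element list, the
  first closure condition includes closure under isomorphism; the empty list gives the zero objects.
\<close>

definition subcategory :: "('o, 'm::ab_group_add, 'k, 'z) lin_cat_scheme \<Rightarrow> 'o set \<Rightarrow> bool" where
  "subcategory C S \<longleftrightarrow> S \<subseteq> Obj C \<and>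
     (\<forall>Xs Z. direct_sum C Xs Z \<longrightarrow> set Xs \<subseteq> S \<longrightarrow> Z \<in> S) \<and>
     (\<forall>X Z. summand C X Z \<longrightarrow> Z \<in> S \<longrightarrow> X \<in> S)"

definition add :: "('o, 'm::ab_group_add, 'k, 'z) lin_cat_scheme \<Rightarrow> 'o \<Rightarrow> 'o set" where
  "add C T = \<Inter>{S. subcategory C S \<and> T \<in> S}"

definition contravariantly_finite_in ::
    "('o, 'm, 'k, 'z) lin_cat_scheme \<Rightarrow> 'o set \<Rightarrow> 'o set \<Rightarrow> bool" where
  "contravariantly_finite_in C \<X> \<D> \<longleftrightarrow>
     (\<forall>M \<in> \<X>. \<exists>D \<in> \<D>. \<exists>f \<in> Hom\<^bsub>C\<^esub> D M.
        \<forall>D' \<in> \<D>. \<forall>g \<in> Hom\<^bsub>C\<^esub> D' M. \<exists>h \<in> Hom\<^bsub>C\<^esub> D' D. g = f \<cdot>\<^bsub>C\<^esub> h)"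

definition covariantly_finite_in ::
    "('o, 'm, 'k, 'z) lin_cat_scheme \<Rightarrow> 'o set \<Rightarrow> 'o set \<Rightarrow> bool" where
  "covariantly_finite_in C \<X> \<D> \<longleftrightarrow>
     (\<forall>M \<in> \<X>. \<exists>D \<in> \<D>. \<exists>f \<in> Hom\<^bsub>C\<^esub> M D.
        \<forall>D' \<in> \<D>. \<forall>g \<in> Hom\<^bsub>C\<^esub> M D'. \<exists>h \<in> Hom\<^bsub>C\<^esub> D D'. g = h \<cdot>\<^bsub>C\<^esub> f)"

definition functorially_finite_in ::
    "('o, 'm, 'k, 'z) lin_cat_scheme \<Rightarrow> 'o set \<Rightarrow> 'o set \<Rightarrow> bool" where
  "functorially_finite_in C \<X> \<D> \<longleftrightarrow>
     contravariantly_finite_in C \<X> \<D> \<and> covariantly_finite_in C \<X> \<D>"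


section \<open>Triangulated categories\<close>

text \<open>
  \<open>tri C X Y Z u v w\<close> says that \<open>X \<rightarrow> Y \<rightarrow> Z \<rightarrow> X[1]\<close>, with morphisms \<open>u\<close>, \<open>v\<close>, \<open>w\<close>, is a
  distinguished triangle.
\<close>

record ('o, 'm, 'k) tri_cat = "('o, 'm, 'k) lin_cat" +
  sh :: "'o \<Rightarrow> 'o" (\<open>sh\<index>\<close>)
  shm :: "'m \<Rightarrow> 'm" (\<open>shm\<index>\<close>)
  tri :: "'o \<Rightarrow> 'o \<Rightarrow> 'o \<Rightarrow> 'm \<Rightarrow> 'm \<Rightarrow> 'm \<Rightarrow> bool" (\<open>tri\<index>\<close>)

text \<open>
  The shift is only required to be a linear auto-equivalence, not a strict automorphism.
\<close>

locale triangulated_category = additive_linear_category C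
  for C :: "('o, 'm::ab_group_add, 'k::field, 'z) tri_cat_scheme" (structure) +
  assumes sh_Obj: "X \<in> Obj C \<Longrightarrow> sh X \<in> Obj C"
    and shm_Idn: "X \<in> Obj C \<Longrightarrow> shm (Idn X) = Idn (sh X)"
    and shm_comp: "\<lbrakk>X \<in> Obj C; Y \<in> Obj C; Z \<in> Obj C; f \<in> Hom X Y; g \<in> Hom Y Z\<rbrakk>
      \<Longrightarrow> shm (g \<cdot> f) = shm g \<cdot> shm f"
    and shm_add: "\<lbrakk>X \<in> Obj C; Y \<in> Obj C; f \<in> Hom X Y; g \<in> Hom X Y\<rbrakk>
      \<Longrightarrow> shm (f + g) = shm f + shm g"
    and shm_scal: "\<lbrakk>X \<in> Obj C; Y \<in> Obj C; f \<in> Hom X Y\<rbrakk>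
      \<Longrightarrow> shm (scal C \<alpha> f) = scal C \<alpha> (shm f)"
    and shm_bij: "\<lbrakk>X \<in> Obj C; Y \<in> Obj C\<rbrakk> \<Longrightarrow> bij_betw shm (Hom X Y) (Hom (sh X) (sh Y))"
    and sh_ess_surj: "Y \<in> Obj C \<Longrightarrow> \<exists>X \<in> Obj C. Y \<simeq> sh X"
    and tri_Obj: "tri X Y Z u v w \<Longrightarrow> X \<in> Obj C \<and> Y \<in> Obj C \<and> Z \<in> Obj C"
    and tri_Hom: "tri X Y Z u v w \<Longrightarrow> u \<in> Hom X Y \<and> v \<in> Hom Y Z \<and> w \<in> Hom Z (sh X)"
    and tri_iso: "\<lbrakk>tri X Y Z u v w; X' \<in> Obj C; Y' \<in> Obj C; Z' \<in> Obj C;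
      u' \<in> Hom X' Y'; v' \<in> Hom Y' Z'; w' \<in> Hom Z' (sh X');
      iso_mor C X X' a; iso_mor C Y Y' b; iso_mor C Z Z' c;
      u' \<cdot> a = b \<cdot> u; v' \<cdot> b = c \<cdot> v; w' \<cdot> c = shm a \<cdot> w\<rbrakk> \<Longrightarrow> tri X' Y' Z' u' v' w'"
    and tri_Idn: "\<lbrakk>X \<in> Obj C; zero_obj C Z\<rbrakk> \<Longrightarrow> tri X X Z (Idn X) 0 0"
    and tri_cone: "\<lbrakk>X \<in> Obj C; Y \<in> Obj C; u \<in> Hom X Y\<rbrakk> \<Longrightarrow> \<exists>Z v w. tri X Y Z u v w"
    and tri_rotate: "\<lbrakk>X \<in> Obj C; Y \<in> Obj C; Z \<in> Obj C;
      u \<in> Hom X Y; v \<in> Hom Y Z; w \<in> Hom Z (sh X)\<rbrakk>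
      \<Longrightarrow> tri X Y Z u v w \<longleftrightarrow> tri Y Z (sh X) v w (- shm u)"
    and tri_morphism: "\<lbrakk>tri X Y Z u v w; tri X' Y' Z' u' v' w';
      a \<in> Hom X X'; b \<in> Hom Y Y'; u' \<cdot> a = b \<cdot> u\<rbrakk>
      \<Longrightarrow> \<exists>c \<in> Hom Z Z'. v' \<cdot> b = c \<cdot> v \<and> w' \<cdot> c = shm a \<cdot> w"
    and tri_octahedron: "\<lbrakk>tri X Y U f a b; tri Y Z W g c d; tri X Z V (g \<cdot> f) p q\<rbrakk>
      \<Longrightarrow> \<exists>r s. tri U V W r s (shm a \<cdot> d) \<and>
            r \<cdot> a = p \<cdot> g \<and> q \<cdot> r = b \<and> s \<cdot> p = c \<and> d \<cdot> s = shm f \<cdot> q"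

text \<open>The dual space of a subspace \<open>V\<close>, with functionals set to \<open>undefined\<close> outside \<open>V\<close>.\<close>

definition dual_on :: "('k::field \<Rightarrow> 'm::ab_group_add \<Rightarrow> 'm) \<Rightarrow> 'm set \<Rightarrow> ('m \<Rightarrow> 'k) set" where
  "dual_on s V = {\<xi> \<in> extensional V.
     (\<forall>f \<in> V. \<forall>g \<in> V. \<xi> (f + g) = \<xi> f + \<xi> g) \<and> (\<forall>a. \<forall>f \<in> V. \<xi> (s a f) = a * \<xi> f)}"

text \<open>
  \<open>\<phi> X Y\<close> is a linear isomorphism from \<open>Hom(X, Y)\<close> to the dual of \<open>Hom(Y, X[2])\<close>; the last two
  conditions are naturality in \<open>X\<close> and in \<open>Y\<close>.
\<close>

definition two_calabi_yau :: "('o, 'm::ab_group_add, 'k::field, 'z) tri_cat_scheme \<Rightarrow> bool" where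
  "two_calabi_yau C \<longleftrightarrow> (\<exists>\<phi>.
     (\<forall>X \<in> Obj C. \<forall>Y \<in> Obj C.
        bij_betw (\<phi> X Y) (Hom\<^bsub>C\<^esub> X Y) (dual_on (scal C) (Hom\<^bsub>C\<^esub> Y (sh\<^bsub>C\<^esub> (sh\<^bsub>C\<^esub> X)))) \<and>
        (\<forall>f \<in> Hom\<^bsub>C\<^esub> X Y. \<forall>g \<in> Hom\<^bsub>C\<^esub> X Y. \<forall>h \<in> Hom\<^bsub>C\<^esub> Y (sh\<^bsub>C\<^esub> (sh\<^bsub>C\<^esub> X)).
           \<phi> X Y (f + g) h = \<phi> X Y f h + \<phi> X Y g h) \<and>
        (\<forall>a. \<forall>f \<in> Hom\<^bsub>C\<^esub> X Y. \<forall>h \<in> Hom\<^bsub>C\<^esub> Y (sh\<^bsub>C\<^esub> (sh\<^bsub>C\<^esub> X)).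
           \<phi> X Y (scal C a f) h = a * \<phi> X Y f h)) \<and>
     (\<forall>X \<in> Obj C. \<forall>X' \<in> Obj C. \<forall>Y \<in> Obj C. \<forall>e \<in> Hom\<^bsub>C\<^esub> X' X.
        \<forall>f \<in> Hom\<^bsub>C\<^esub> X Y. \<forall>h \<in> Hom\<^bsub>C\<^esub> Y (sh\<^bsub>C\<^esub> (sh\<^bsub>C\<^esub> X')).
           \<phi> X' Y (f \<cdot>\<^bsub>C\<^esub> e) h = \<phi> X Y f (shm\<^bsub>C\<^esub> (shm\<^bsub>C\<^esub> e) \<cdot>\<^bsub>C\<^esub> h)) \<and>
     (\<forall>X \<in> Obj C. \<forall>Y \<in> Obj C. \<forall>Y' \<in> Obj C. \<forall>e \<in> Hom\<^bsub>C\<^esub> Y Y'.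
        \<forall>f \<in> Hom\<^bsub>C\<^esub> X Y. \<forall>h \<in> Hom\<^bsub>C\<^esub> Y' (sh\<^bsub>C\<^esub> (sh\<^bsub>C\<^esub> X)).
           \<phi> X Y' (e \<cdot>\<^bsub>C\<^esub> f) h = \<phi> X Y f (h \<cdot>\<^bsub>C\<^esub> e)))"


section \<open>Cotorsion pairs and cluster tilting\<close>

definition Ext1_zero :: "('o, 'm::ab_group_add, 'k, 'z) tri_cat_scheme \<Rightarrow> 'o set \<Rightarrow> 'o set \<Rightarrow> bool" where
  "Ext1_zero C \<X> \<Y> \<longleftrightarrow> (\<forall>X \<in> \<X>. \<forall>Y \<in> \<Y>. Hom\<^bsub>C\<^esub> X (sh\<^bsub>C\<^esub> Y) = {0})"

definition shift_subcat :: "('o, 'm, 'k, 'z) tri_cat_scheme \<Rightarrow> 'o set \<Rightarrow> 'o set" where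
  "shift_subcat C \<Y> = {Z. \<exists>Y \<in> \<Y>. Z \<simeq>\<^bsub>C\<^esub> sh\<^bsub>C\<^esub> Y}"

definition star :: "('o, 'm, 'k, 'z) tri_cat_scheme \<Rightarrow> 'o set \<Rightarrow> 'o set \<Rightarrow> 'o set" where
  "star C \<X> \<Y> = {Z. \<exists>X \<in> \<X>. \<exists>Y \<in> \<Y>. \<exists>u v w. tri\<^bsub>C\<^esub> X Z Y u v w}"

definition cotorsion_pair :: "('o, 'm::ab_group_add, 'k, 'z) tri_cat_scheme \<Rightarrow> 'o set \<Rightarrow> 'o set \<Rightarrow> bool" where
  "cotorsion_pair C \<X> \<Y> \<longleftrightarrow> subcategory C \<X> \<and> subcategory C \<Y> \<and>
     Ext1_zero C \<X> \<Y> \<and> Obj C = star C \<X> (shift_subcat C \<Y>)"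

text \<open>
  \<open>I\<close> is the direct sum of representatives of the isomorphism classes of indecomposable objects
  in the core \<open>\<X> \<inter> \<Y>\<close>.
\<close>

definition core_object ::
    "('o, 'm::ab_group_add, 'k, 'z) tri_cat_scheme \<Rightarrow> 'o set \<Rightarrow> 'o set \<Rightarrow> 'o \<Rightarrow> bool" where
  "core_object C \<X> \<Y> I \<longleftrightarrow> (\<exists>Is. direct_sum C Is I \<and> noniso_indecomposables C Is \<and>
     set Is \<subseteq> \<X> \<inter> \<Y> \<and>
     (\<forall>J \<in> \<X> \<inter> \<Y>. indecomposable C J \<longrightarrow> (\<exists>J' \<in> set Is. J \<simeq>\<^bsub>C\<^esub> J')))"

definition cluster_tilting :: "('o, 'm::ab_group_add, 'k, 'z) tri_cat_scheme \<Rightarrow> 'o \<Rightarrow> bool" where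
  "cluster_tilting C T \<longleftrightarrow> T \<in> Obj C \<and> basic C T \<and> cotorsion_pair C (add C T) (add C T)"

text \<open>
  The relative notion is meant for extension-closed subcategories \<open>\<X>\<close> that are contravariantly
  or covariantly finite, such as the two halves of a cotorsion pair.
\<close>

definition rel_cluster_tilting_subcat ::
    "('o, 'm::ab_group_add, 'k, 'z) tri_cat_scheme \<Rightarrow> 'o set \<Rightarrow> 'o set \<Rightarrow> bool" where
  "rel_cluster_tilting_subcat C \<X> \<D> \<longleftrightarrow> subcategory C \<D> \<and> \<D> \<subseteq> \<X> \<and>
     functorially_finite_in C \<X> \<D> \<and>
     (\<forall>M \<in> \<X>. (M \<in> \<D> \<longleftrightarrow> Ext1_zero C \<D> {M}) \<and> (M \<in> \<D> \<longleftrightarrow> Ext1_zero C {M} \<D>))"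

definition rel_cluster_tilting ::
    "('o, 'm::ab_group_add, 'k, 'z) tri_cat_scheme \<Rightarrow> 'o set \<Rightarrow> 'o \<Rightarrow> bool" where
  "rel_cluster_tilting C \<X> D \<longleftrightarrow>
     D \<in> \<X> \<and> basic C D \<and> rel_cluster_tilting_subcat C \<X> (add C D)"

text \<open>
  The decomposition \<open>T = T\<^sub>X \<oplus> I \<oplus> T\<^sub>Y\<close> of an object, objects being taken up to isomorphism.
\<close>

definition cluster_decomposition ::
    "('o, 'm::ab_group_add, 'k, 'z) tri_cat_scheme \<Rightarrow> 'o set \<Rightarrow> 'o set \<Rightarrow> 'o \<Rightarrow> 'o \<Rightarrow> 'o \<Rightarrow> 'o \<Rightarrow> bool" where
  "cluster_decomposition C \<X> \<Y> I T TX TY \<longleftrightarrow> TX \<in> Obj C \<and> TY \<in> Obj C \<and>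
     T \<simeq>\<^bsub>C\<^esub> TX \<oplus>\<^bsub>C\<^esub> I \<oplus>\<^bsub>C\<^esub> TY \<and>
     rel_cluster_tilting C \<X> (TX \<oplus>\<^bsub>C\<^esub> I) \<and> rel_cluster_tilting C \<Y> (TY \<oplus>\<^bsub>C\<^esub> I)"

end

theory Submission
  imports Defs "HOL-Combinatorics.List_Permutation"
begin

text \<open>
  Work with the vanishing of \<open>Ext\<^sup>1\<close> only; the Calabi-Yau property makes it symmetric. Let \<open>T\<close> be a
  cluster tilting object and \<open>a \<rightarrow> T \<rightarrow> b[1] \<rightarrow> a[1]\<close> a triangle with \<open>a \<in> \<X>\<close> and \<open>b \<in> \<Y>\<close>. Then \<open>a \<oplus> b\<close> is
  rigid, and since \<open>T\<close> lies in \<open>add (a \<oplus> b) * add (a \<oplus> b)[1]\<close>, it is again cluster tilting. The same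
  argument for \<open>(a \<oplus> b)[1]\<close> and a triangle \<open>a' \<rightarrow> a[1] \<rightarrow> i[1] \<rightarrow> a'[1]\<close>, where \<open>i\<close> lies in the core, gives
  a cluster tilting object \<open>R = a' \<oplus> i \<oplus> b\<close>. Every \<open>x \<in> \<X>\<close> sits in a triangle \<open>c \<rightarrow> s \<rightarrow> x \<rightarrow> c[1]\<close> with
  \<open>c\<close> and \<open>s\<close> in \<open>\<X> \<inter> add R\<close>. A morphism from an object of \<open>\<Y>\<close> to \<open>x\<close> lifts to \<open>s\<close>, and
  every morphism from an object of \<open>\<Y>\<close> to \<open>a'\<close> factors through \<open>i\<close>; hence all morphisms from \<open>\<Y>\<close> to \<open>\<X>\<close> factor
  through the core. Consequently an indecomposable \<open>Z\<close> with \<open>Ext\<^sup>1(I, Z) = 0\<close> belongs to \<open>\<X>\<close> or to \<open>\<Y>\<close>,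
  and the statements follow by comparing the sets of indecomposable summands of the basic objects involved.
\<close>

section \<open>Linear categories and biproducts\<close>

text \<open>The natural setting is the quotient by the core of the objects orthogonal to
  \<open>I\<close>, where the pair should split into two halves with no morphisms between them. That
  triangulated quotient is never built: being zero there is expressed as factoring through the core,
  and its shift is represented by the triangle a' -> a[1] -> i[1]. The obstacle is that Ext^1
  between the halves vanishes by definition and duality, while the splitting needs control over Hom
  from \<open>\<Y>\<close> to \<open>\<X>\<close>, one shift away. This is why \<open>a\<close> is
  replaced by \<open>a'\<close>: a map y -> a' followed by a' -> a[1] lands in Ext^1(y, a) = 0, so
  it comes from \<open>i\<close>. Spreading this from \<open>a'\<close> to all of
  \<open>\<X>\<close> needs resolutions by one fixed object, which is what a cluster tilting object
  supplies; its property is carried over to the new object by generation, without counting summands.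
  The splitting then acts on triangles: in a -> Z -> b[1] the connecting map is the shift of a map b
  -> a, so it is zero modulo the core, and \<open>a\<close> becomes a retract of the sum of
  \<open>Z\<close> and a core object.\<close>

lemma sum_lessThan_add:
  fixes f :: "nat \<Rightarrow> 'a::comm_monoid_add"
  shows "(\<Sum>i<m + n. f i) = (\<Sum>i<m. f i) + (\<Sum>i<n. f (m + i))"
  by (induction n) (simp_all add: add.assoc)

context linear_category
begin

text \<open>Hom-sets may overlap, so the axioms carry membership conditions for every object
  involved. Bundling a morphism with its domain and codomain turns each axiom into a rule whose side
  conditions are again \<open>arr\<close> facts.\<close>

definition arr :: "'m \<Rightarrow> 'o \<Rightarrow> 'o \<Rightarrow> bool" where
  "arr f X Y \<longleftrightarrow> X \<in> Obj C \<and> Y \<in> Obj C \<and> f \<in> Hom X Y"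

lemma arrI: "X \<in> Obj C \<Longrightarrow> Y \<in> Obj C \<Longrightarrow> f \<in> Hom X Y \<Longrightarrow> arr f X Y"
  by (simp add: arr_def)

lemma arrD: "arr f X Y \<Longrightarrow> X \<in> Obj C" "arr f X Y \<Longrightarrow> Y \<in> Obj C" "arr f X Y \<Longrightarrow> f \<in> Hom X Y"
  by (simp_all add: arr_def)

lemma arr_Idn: "X \<in> Obj C \<Longrightarrow> arr (Idn X) X X"
  by (simp add: arr_def Idn_in_Hom)

lemma arr_comp: "arr f X Y \<Longrightarrow> arr g Y Z \<Longrightarrow> arr (g \<cdot> f) X Z"
  unfolding arr_def using comp_in_Hom by blast

lemma arr_zero: "X \<in> Obj C \<Longrightarrow> Y \<in> Obj C \<Longrightarrow> arr 0 X Y"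
proof -
  assume "X \<in> Obj C" "Y \<in> Obj C"
  interpret vs: vector_space "scal C" by (rule vector_space_scal)
  show ?thesis using Hom_subspace[of X Y] vs.subspace_0 \<open>X \<in> Obj C\<close> \<open>Y \<in> Obj C\<close> by (simp add: arr_def)
qed

lemma arr_add: "arr f X Y \<Longrightarrow> arr g X Y \<Longrightarrow> arr (f + g) X Y"
proof -
  assume a: "arr f X Y" "arr g X Y"
  interpret vs: vector_space "scal C" by (rule vector_space_scal)
  show ?thesis using Hom_subspace[of X Y] vs.subspace_add a by (simp add: arr_def)
qed

lemma arr_minus: "arr f X Y \<Longrightarrow> arr (- f) X Y"
proof -
  assume a: "arr f X Y"
  interpret vs: vector_space "scal C" by (rule vector_space_scal)
  show ?thesis using Hom_subspace[of X Y] vs.subspace_neg a by (simp add: arr_def)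
qed

lemma arr_diff: "arr f X Y \<Longrightarrow> arr g X Y \<Longrightarrow> arr (f - g) X Y"
  using arr_add[of f X Y "- g"] arr_minus by simp

lemma arr_scal: "arr f X Y \<Longrightarrow> arr (scal C \<alpha> f) X Y"
proof -
  assume a: "arr f X Y"
  interpret vs: vector_space "scal C" by (rule vector_space_scal)
  show ?thesis using Hom_subspace[of X Y] vs.subspace_scale a by (simp add: arr_def)
qed

lemma arr_sum:
  assumes "X \<in> Obj C" "Y \<in> Obj C" "\<And>i. i \<in> A \<Longrightarrow> arr (f i) X Y"
  shows "arr (\<Sum>i\<in>A. f i) X Y"
  using assms(3) by (induction A rule: infinite_finite_induct) (auto intro: arr_zero arr_add assms)

lemma assoc: "arr f W X \<Longrightarrow> arr g X Y \<Longrightarrow> arr h Y Z \<Longrightarrow> (h \<cdot> g) \<cdot> f = h \<cdot> (g \<cdot> f)"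
  unfolding arr_def using comp_assoc by blast

lemma comp_id: "arr f X Y \<Longrightarrow> f \<cdot> Idn X = f" "arr f X Y \<Longrightarrow> Idn Y \<cdot> f = f"
  unfolding arr_def using comp_Idn Idn_comp by blast+

lemma comp_addR: "arr f X Y \<Longrightarrow> arr f' X Y \<Longrightarrow> arr g Y Z \<Longrightarrow> g \<cdot> (f + f') = g \<cdot> f + g \<cdot> f'"
  unfolding arr_def using comp_add_right by blast

lemma comp_addL: "arr f X Y \<Longrightarrow> arr g Y Z \<Longrightarrow> arr g' Y Z \<Longrightarrow> (g + g') \<cdot> f = g \<cdot> f + g' \<cdot> f"
  unfolding arr_def using comp_add_left by blast

lemma comp_zeroR:
  assumes "arr g Y Z" shows "g \<cdot> 0 = 0"
proof -
  have "arr 0 Y Y" using arr_zero arrD(1)[OF assms] by blast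
  then have "g \<cdot> (0 + 0) = g \<cdot> 0 + g \<cdot> 0" using comp_addR assms by blast
  then show ?thesis by simp
qed

lemma comp_zeroL:
  assumes "arr f X Y" shows "0 \<cdot> f = 0"
proof -
  have "arr 0 Y Y" using arr_zero arrD(2)[OF assms] by blast
  then have "(0 + 0) \<cdot> f = 0 \<cdot> f + 0 \<cdot> f" using comp_addL assms by blast
  then show ?thesis by simp
qed

lemma comp_minusR: "arr f X Y \<Longrightarrow> arr g Y Z \<Longrightarrow> g \<cdot> (- f) = - (g \<cdot> f)"
  using comp_addR[of f X Y "- f" g Z] comp_zeroR arr_minus by (simp add: eq_neg_iff_add_eq_0 add.commute)

lemma comp_minusL: "arr f X Y \<Longrightarrow> arr g Y Z \<Longrightarrow> (- g) \<cdot> f = - (g \<cdot> f)"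
  using comp_addL[of f X Y g Z "- g"] comp_zeroL arr_minus by (simp add: eq_neg_iff_add_eq_0 add.commute)

lemma comp_diffR: "arr f X Y \<Longrightarrow> arr f' X Y \<Longrightarrow> arr g Y Z \<Longrightarrow> g \<cdot> (f - f') = g \<cdot> f - g \<cdot> f'"
  using comp_addR[of f X Y "- f'" g Z] comp_minusR arr_minus by simp

lemma comp_diffL: "arr f X Y \<Longrightarrow> arr g Y Z \<Longrightarrow> arr g' Y Z \<Longrightarrow> (g - g') \<cdot> f = g \<cdot> f - g' \<cdot> f"
  using comp_addL[of f X Y g Z "- g'"] comp_minusL arr_minus by simp

lemma comp_sumR:
  assumes "arr g Y Z" "X \<in> Obj C" "\<And>i. i \<in> A \<Longrightarrow> arr (f i) X Y"
  shows "g \<cdot> (\<Sum>i\<in>A. f i) = (\<Sum>i\<in>A. g \<cdot> f i)"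
  using assms(3)
proof (induction A rule: infinite_finite_induct)
  case (insert x A)
  then show ?case using comp_addR[of "f x" X Y "sum f A" g Z] arr_sum[of X Y A f] assms arrD by simp
qed (use assms comp_zeroR in auto)

lemma comp_sumL:
  assumes "arr f X Y" "Z \<in> Obj C" "\<And>i. i \<in> A \<Longrightarrow> arr (g i) Y Z"
  shows "(\<Sum>i\<in>A. g i) \<cdot> f = (\<Sum>i\<in>A. g i \<cdot> f)"
  using assms(3)
proof (induction A rule: infinite_finite_induct)
  case (insert x A)
  then show ?case using comp_addL[of f X Y "g x" Z "sum g A"] arr_sum[of Y Z A g] assms arrD by simp
qed (use assms comp_zeroL in auto)

lemma Hom_trivialI: "X \<in> Obj C \<Longrightarrow> Y \<in> Obj C \<Longrightarrow> (\<And>f. arr f X Y \<Longrightarrow> f = 0) \<Longrightarrow> Hom X Y = {0}"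
  using arr_zero by (auto simp: arr_def)

lemma zero_arr: "Hom X Y = {0} \<Longrightarrow> arr f X Y \<Longrightarrow> f = 0"
  by (auto simp: arr_def)

text \<open>\<open>Z\<close> is a retract of the formal direct sum of the objects \<open>X i\<close>.\<close>

definition covered :: "nat \<Rightarrow> (nat \<Rightarrow> 'o) \<Rightarrow> (nat \<Rightarrow> 'm) \<Rightarrow> (nat \<Rightarrow> 'm) \<Rightarrow> 'o \<Rightarrow> bool" where
  "covered n X s r Z \<longleftrightarrow> Z \<in> Obj C \<and> (\<forall>i<n. arr (s i) (X i) Z \<and> arr (r i) Z (X i)) \<and>
     (\<Sum>i<n. s i \<cdot> r i) = Idn Z"

text \<open>Insert \<open>Idn Z = (\<Sum>i<n. s i \<cdot> r i)\<close> between \<open>f\<close> and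
  \<open>g\<close> and expand. Most arguments about sums and summands below come down to this
  expansion.\<close>

lemma covered_comp:
  assumes c: "covered n X s r Z" and f: "arr f V Z" and g: "arr g Z W"
  shows "g \<cdot> f = (\<Sum>i<n. (g \<cdot> s i) \<cdot> (r i \<cdot> f))"
proof -
  have a: "arr (s i) (X i) Z" "arr (r i) Z (X i)" if "i < n" for i
    using c that by (auto simp: covered_def)
  have sr: "arr (s i \<cdot> r i) Z Z" if "i < n" for i using arr_comp a that by blast
  have "g \<cdot> f = (g \<cdot> Idn Z) \<cdot> f" using comp_id(1)[OF g] by simp
  also have "\<dots> = (g \<cdot> (\<Sum>i<n. s i \<cdot> r i)) \<cdot> f" using c by (simp add: covered_def)
  also have "\<dots> = (\<Sum>i<n. g \<cdot> (s i \<cdot> r i)) \<cdot> f"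
    using comp_sumR[OF g arrD(2)[OF f], of "{..<n}" "\<lambda>i. s i \<cdot> r i"] sr by simp
  also have "\<dots> = (\<Sum>i<n. (g \<cdot> (s i \<cdot> r i)) \<cdot> f)"
    using comp_sumL[OF f arrD(2)[OF g], of "{..<n}" "\<lambda>i. g \<cdot> (s i \<cdot> r i)"] arr_comp[OF sr g] by simp
  also have "\<dots> = (\<Sum>i<n. (g \<cdot> s i) \<cdot> (r i \<cdot> f))"
  proof (rule sum.cong)
    fix i assume "i \<in> {..<n}"
    then have i: "arr (s i) (X i) Z" "arr (r i) Z (X i)" using a by auto
    show "(g \<cdot> (s i \<cdot> r i)) \<cdot> f = (g \<cdot> s i) \<cdot> (r i \<cdot> f)"
      using assoc[OF i(2) i(1) g] assoc[OF f i(2) arr_comp[OF i(1) g]] by simp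
  qed simp
  finally show ?thesis .
qed

lemma covered_zeroR:
  assumes c: "covered n X s r Z" and f: "arr f V Z" and "\<And>i. i < n \<Longrightarrow> r i \<cdot> f = 0"
  shows "f = 0"
proof -
  have a: "arr (s i) (X i) Z" "arr (r i) Z (X i)" if "i < n" for i
    using c that by (auto simp: covered_def)
  have Z: "Z \<in> Obj C" using f arrD by blast
  have "(Idn Z \<cdot> s i) \<cdot> (r i \<cdot> f) = 0" if "i < n" for i
    using assms(3) comp_zeroR[OF arr_comp[OF a(1) arr_Idn[OF Z]]] that by simp
  then show ?thesis
    using covered_comp[OF c f arr_Idn[OF Z]] comp_id(2)[OF f] by simp
qed

lemma covered_zeroL:
  assumes c: "covered n X s r Z" and g: "arr g Z W" and "\<And>i. i < n \<Longrightarrow> g \<cdot> s i = 0"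
  shows "g = 0"
proof -
  have a: "arr (s i) (X i) Z" "arr (r i) Z (X i)" if "i < n" for i
    using c that by (auto simp: covered_def)
  have Z: "Z \<in> Obj C" using g arrD by blast
  have "(g \<cdot> s i) \<cdot> (r i \<cdot> Idn Z) = 0" if "i < n" for i
    using assms(3) comp_zeroL[OF arr_comp[OF arr_Idn[OF Z] a(2)]] that by simp
  then show ?thesis
    using covered_comp[OF c arr_Idn[OF Z] g] comp_id(1)[OF g] by simp
qed

section \<open>Biproducts with chosen structure maps\<close>

definition biproduct :: "'o list \<Rightarrow> 'o \<Rightarrow> (nat \<Rightarrow> 'm) \<Rightarrow> (nat \<Rightarrow> 'm) \<Rightarrow> bool" where
  "biproduct Xs Z s r \<longleftrightarrow> covered (length Xs) ((!) Xs) s r Z \<and>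
     (\<forall>i < length Xs. \<forall>j < length Xs. r j \<cdot> s i = (if i = j then Idn (Xs ! i) else 0))"

lemma biproductD:
  assumes "biproduct Xs Z s r"
  shows "Z \<in> Obj C" "set Xs \<subseteq> Obj C" "covered (length Xs) ((!) Xs) s r Z"
    "\<And>i. i < length Xs \<Longrightarrow> arr (s i) (Xs ! i) Z" "\<And>i. i < length Xs \<Longrightarrow> arr (r i) Z (Xs ! i)"
    "\<And>i j. i < length Xs \<Longrightarrow> j < length Xs \<Longrightarrow> r j \<cdot> s i = (if i = j then Idn (Xs ! i) else 0)"
    "(\<Sum>i < length Xs. s i \<cdot> r i) = Idn Z"
  using assms arrD(1) by (auto simp: biproduct_def covered_def set_conv_nth)

lemma biproductI:
  assumes "Z \<in> Obj C"
    "\<And>i. i < length Xs \<Longrightarrow> arr (s i) (Xs ! i) Z" "\<And>i. i < length Xs \<Longrightarrow> arr (r i) Z (Xs ! i)"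
    "\<And>i j. i < length Xs \<Longrightarrow> j < length Xs \<Longrightarrow> r j \<cdot> s i = (if i = j then Idn (Xs ! i) else 0)"
    "(\<Sum>i < length Xs. s i \<cdot> r i) = Idn Z"
  shows "biproduct Xs Z s r"
  using assms by (simp add: biproduct_def covered_def)

lemma direct_sum_iff: "direct_sum C Xs Z \<longleftrightarrow> (\<exists>s r. biproduct Xs Z s r)"
proof
  assume d: "direct_sum C Xs Z"
  then obtain s r where *: "set Xs \<subseteq> Obj C" "Z \<in> Obj C"
    "\<forall>i < length Xs. s i \<in> Hom (Xs ! i) Z \<and> r i \<in> Hom Z (Xs ! i)"
    "\<forall>i < length Xs. \<forall>j < length Xs. r j \<cdot> s i = (if i = j then Idn (Xs ! i) else 0)"
    "(\<Sum>i < length Xs. s i \<cdot> r i) = Idn Z"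
    unfolding direct_sum_def by blast
  have o: "Xs ! i \<in> Obj C" if "i < length Xs" for i using *(1) that by auto
  have "biproduct Xs Z s r"
    by (rule biproductI) (use * o in \<open>auto simp: arr_def\<close>)
  then show "\<exists>s r. biproduct Xs Z s r" by blast
next
  assume "\<exists>s r. biproduct Xs Z s r"
  then obtain s r where "biproduct Xs Z s r" by blast
  from biproductD[OF this] show "direct_sum C Xs Z"
    unfolding direct_sum_def using arrD(3) by blast
qed

lemma direct_sumE:
  assumes "direct_sum C Xs Z" obtains s r where "biproduct Xs Z s r"
  using assms direct_sum_iff by blast

lemma direct_sum_Obj: "direct_sum C Xs Z \<Longrightarrow> set Xs \<subseteq> Obj C" "direct_sum C Xs Z \<Longrightarrow> Z \<in> Obj C"
  by (auto simp: direct_sum_def)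

definition biproduct2 :: "'o \<Rightarrow> 'o \<Rightarrow> 'o \<Rightarrow> 'm \<Rightarrow> 'm \<Rightarrow> 'm \<Rightarrow> 'm \<Rightarrow> bool" where
  "biproduct2 X Y Z i j p q \<longleftrightarrow> arr i X Z \<and> arr j Y Z \<and> arr p Z X \<and> arr q Z Y \<and>
    p \<cdot> i = Idn X \<and> q \<cdot> j = Idn Y \<and> q \<cdot> i = 0 \<and> p \<cdot> j = 0 \<and> i \<cdot> p + j \<cdot> q = Idn Z"

lemma biproduct2D:
  assumes "biproduct2 X Y Z i j p q"
  shows "arr i X Z" "arr j Y Z" "arr p Z X" "arr q Z Y"
    "p \<cdot> i = Idn X" "q \<cdot> j = Idn Y" "q \<cdot> i = 0" "p \<cdot> j = 0" "i \<cdot> p + j \<cdot> q = Idn Z"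
  using assms by (simp_all add: biproduct2_def)

lemma direct_sum2_iff: "direct_sum C [X, Y] Z \<longleftrightarrow> (\<exists>i j p q. biproduct2 X Y Z i j p q)"
proof
  assume "direct_sum C [X, Y] Z"
  then obtain s r where "biproduct [X, Y] Z s r" by (rule direct_sumE)
  note * = biproductD[OF this]
  have "biproduct2 X Y Z (s 0) (s 1) (r 0) (r 1)"
    using *(4)[of 0] *(4)[of 1] *(5)[of 0] *(5)[of 1] *(6)[of 0 0] *(6)[of 1 1] *(6)[of 0 1] *(6)[of 1 0] *(7)
    by (simp add: biproduct2_def lessThan_Suc numeral_2_eq_2 add.commute)
  then show "\<exists>i j p q. biproduct2 X Y Z i j p q" by blast
next
  assume "\<exists>i j p q. biproduct2 X Y Z i j p q"
  then obtain i j p q where "biproduct2 X Y Z i j p q" by blast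
  note * = biproduct2D[OF this]
  have "biproduct [X, Y] Z (\<lambda>k. if k = 0 then i else j) (\<lambda>k. if k = 0 then p else q)"
  proof (rule biproductI)
    show "Z \<in> Obj C" using *(1) arrD by blast
  qed (use * in \<open>auto simp: less_Suc_eq lessThan_Suc add.commute\<close>)
  then show "direct_sum C [X, Y] Z" using direct_sum_iff by blast
qed

lemma direct_sum2E:
  assumes "direct_sum C [X, Y] Z" obtains i j p q where "biproduct2 X Y Z i j p q"
  using assms direct_sum2_iff by blast

section \<open>Isomorphisms and the uniqueness of biproducts\<close>

lemma iso_morD: "iso_mor C X Y f \<Longrightarrow> X \<in> Obj C \<Longrightarrow> Y \<in> Obj C \<Longrightarrow>
    \<exists>g. arr f X Y \<and> arr g Y X \<and> g \<cdot> f = Idn X \<and> f \<cdot> g = Idn Y"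
  by (auto simp: iso_mor_def arr_def)

lemma iso_morI: "arr f X Y \<Longrightarrow> arr g Y X \<Longrightarrow> g \<cdot> f = Idn X \<Longrightarrow> f \<cdot> g = Idn Y \<Longrightarrow> iso_mor C X Y f"
  by (auto simp: iso_mor_def arr_def)

definition inverse_pair :: "'m \<Rightarrow> 'm \<Rightarrow> 'o \<Rightarrow> 'o \<Rightarrow> bool" where
  "inverse_pair f g X Y \<longleftrightarrow> arr f X Y \<and> arr g Y X \<and> g \<cdot> f = Idn X \<and> f \<cdot> g = Idn Y"

lemma inverse_pairD:
  assumes "inverse_pair f g X Y"
  shows "arr f X Y" "arr g Y X" "g \<cdot> f = Idn X" "f \<cdot> g = Idn Y"
  using assms by (simp_all add: inverse_pair_def)

lemma iso_objE:
  assumes "X \<simeq> Y" obtains f g where "inverse_pair f g X Y"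
  using assms iso_morD unfolding iso_obj_def inverse_pair_def by blast

lemma iso_objI: "arr f X Y \<Longrightarrow> arr g Y X \<Longrightarrow> g \<cdot> f = Idn X \<Longrightarrow> f \<cdot> g = Idn Y \<Longrightarrow> X \<simeq> Y"
  unfolding iso_obj_def using iso_morI arrD by blast

lemma iso_obj_refl: "X \<in> Obj C \<Longrightarrow> X \<simeq> X"
  using iso_objI[OF arr_Idn arr_Idn] comp_id(1)[OF arr_Idn] by blast

lemma iso_obj_sym:
  assumes "X \<simeq> Y" shows "Y \<simeq> X"
proof -
  from assms obtain f g where "inverse_pair f g X Y" by (rule iso_objE)
  note * = inverse_pairD[OF this]
  show ?thesis using iso_objI[OF *(2,1,4,3)] .
qed

text \<open>Biproduct calculations keep producing composites in which a projection meets an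
  injection in the middle. The typed reassociation is done once, here for matching indices and in
  \<open>comp4_zero\<close> for different ones.\<close>

lemma comp4_cancel:
  assumes "arr f X Y" "arr g Y Z" "arr h Z Y" "arr k Y W" "h \<cdot> g = Idn Y"
  shows "(k \<cdot> h) \<cdot> (g \<cdot> f) = k \<cdot> f"
proof -
  have "(k \<cdot> h) \<cdot> (g \<cdot> f) = k \<cdot> (h \<cdot> (g \<cdot> f))" using assoc[OF arr_comp[OF assms(1,2)] assms(3,4)] .
  also have "h \<cdot> (g \<cdot> f) = f" using assoc[OF assms(1,2,3)] assms(5) comp_id(2)[OF assms(1)] by simp
  finally show ?thesis .
qed

lemma comp4_zero:
  assumes "arr f X Y" "arr g Y Z" "arr h Z V" "arr k V W" "h \<cdot> g = 0"
  shows "(k \<cdot> h) \<cdot> (g \<cdot> f) = 0"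
proof -
  have "(k \<cdot> h) \<cdot> (g \<cdot> f) = k \<cdot> (h \<cdot> (g \<cdot> f))" using assoc[OF arr_comp[OF assms(1,2)] assms(3,4)] .
  also have "h \<cdot> (g \<cdot> f) = 0" using assoc[OF assms(1,2,3)] assms(5) comp_zeroL[OF assms(1)] by simp
  finally show ?thesis using comp_zeroR[OF assms(4)] by simp
qed

lemma iso_obj_trans:
  assumes "X \<simeq> Y" "Y \<simeq> Z"
  shows "X \<simeq> Z"
proof -
  from assms(1) obtain f g where "inverse_pair f g X Y" by (rule iso_objE)
  note 1 = inverse_pairD[OF this]
  from assms(2) obtain h k where "inverse_pair h k Y Z" by (rule iso_objE)
  note 2 = inverse_pairD[OF this]
  show ?thesis
    by (rule iso_objI[OF arr_comp[OF 1(1) 2(1)] arr_comp[OF 2(2) 1(2)]])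
      (use comp4_cancel[OF 1(1) 2(1,2) 1(2) 2(3)] comp4_cancel[OF 2(2) 1(2,1) 2(1) 1(4)] 1(3) 2(4) in simp_all)
qed

lemma iso_class_eq_iff:
  assumes "X \<in> Obj C"
  shows "iso_class C X = iso_class C Y \<longleftrightarrow> X \<simeq> Y"
proof
  assume eq: "iso_class C X = iso_class C Y"
  have "X \<in> iso_class C X" using iso_obj_refl[OF assms] by (simp add: iso_class_def)
  then have "X \<in> iso_class C Y" using eq by simp
  then show "X \<simeq> Y" by (simp add: iso_class_def iso_obj_sym)
next
  assume "X \<simeq> Y"
  then show "iso_class C X = iso_class C Y"
    unfolding iso_class_def using iso_obj_sym iso_obj_trans by blast
qed

lemma biproduct_comparison:
  assumes b1: "biproduct Xs Z s r" and b2: "biproduct Xs Z' s' r'"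
  defines "f \<equiv> (\<Sum>i<length Xs. s' i \<cdot> r i)"
  shows "arr f Z Z'" "\<And>i. i < length Xs \<Longrightarrow> f \<cdot> s i = s' i"
proof -
  note 1 = biproductD[OF b1] and 2 = biproductD[OF b2]
  show "arr f Z Z'" unfolding f_def
    by (rule arr_sum[OF 1(1) 2(1)]) (rule arr_comp[OF 1(5) 2(4)]; simp)
  fix i assume i: "i < length Xs"
  have sr: "arr (s' j \<cdot> r j) Z Z'" if "j < length Xs" for j using arr_comp[OF 1(5) 2(4)] that by blast
  have "f \<cdot> s i = (\<Sum>j<length Xs. (s' j \<cdot> r j) \<cdot> s i)"
    unfolding f_def by (rule comp_sumL[OF 1(4)[OF i] 2(1)]) (use sr in simp)
  also have "\<dots> = (\<Sum>j<length Xs. if j = i then s' i else 0)"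
  proof (rule sum.cong)
    fix j assume "j \<in> {..<length Xs}"
    then have j: "j < length Xs" by simp
    show "(s' j \<cdot> r j) \<cdot> s i = (if j = i then s' i else 0)"
      using assoc[OF 1(4)[OF i] 1(5)[OF j] 2(4)[OF j]] 1(6)[OF i j] comp_id(1)[OF 2(4)[OF i]]
        comp_zeroR[OF 2(4)[OF j]] by auto
  qed simp
  also have "\<dots> = s' i" using i by simp
  finally show "f \<cdot> s i = s' i" .
qed

lemma covered_eqL:
  assumes c: "covered n X s r Z" and a: "arr f Z W" "arr g Z W"
    and eq: "\<And>i. i < n \<Longrightarrow> f \<cdot> s i = g \<cdot> s i"
  shows "f = g"
proof -
  have "f - g = 0"
  proof (rule covered_zeroL[OF c arr_diff[OF a]])
    fix i assume i: "i < n"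
    then have "arr (s i) (X i) Z" using c by (simp add: covered_def)
    then show "(f - g) \<cdot> s i = 0" using comp_diffL a eq[OF i] by simp
  qed
  then show ?thesis by simp
qed

text \<open>The comparison maps in the two directions carry injections to injections, so both
  composites agree with the identity on every injection, and \<open>covered_eqL\<close>
  applies.\<close>

lemma direct_sum_iso:
  assumes "direct_sum C Xs Z" "direct_sum C Xs Z'"
  shows "Z \<simeq> Z'"
proof -
  let ?n = "length Xs"
  from assms(1) obtain s r where b1: "biproduct Xs Z s r" by (rule direct_sumE)
  note 1 = biproductD[OF b1]
  from assms(2) obtain s' r' where b2: "biproduct Xs Z' s' r'" by (rule direct_sumE)
  note 2 = biproductD[OF b2]
  define f where "f = (\<Sum>i<?n. s' i \<cdot> r i)"
  define g where "g = (\<Sum>i<?n. s i \<cdot> r' i)"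
  note f = biproduct_comparison[OF b1 b2, folded f_def]
  note g = biproduct_comparison[OF b2 b1, folded g_def]
  have "g \<cdot> f = Idn Z"
  proof (rule covered_eqL[OF 1(3) arr_comp[OF f(1) g(1)] arr_Idn[OF 1(1)]])
    fix i assume i: "i < ?n"
    show "g \<cdot> f \<cdot> s i = Idn Z \<cdot> s i"
      using assoc[OF 1(4)[OF i] f(1) g(1)] f(2)[OF i] g(2)[OF i] comp_id(2)[OF 1(4)[OF i]] by simp
  qed
  moreover have "f \<cdot> g = Idn Z'"
  proof (rule covered_eqL[OF 2(3) arr_comp[OF g(1) f(1)] arr_Idn[OF 2(1)]])
    fix i assume i: "i < ?n"
    show "f \<cdot> g \<cdot> s' i = Idn Z' \<cdot> s' i"
      using assoc[OF 2(4)[OF i] g(1) f(1)] f(2)[OF i] g(2)[OF i] comp_id(2)[OF 2(4)[OF i]] by simp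
  qed
  ultimately show ?thesis using iso_objI[OF f(1) g(1)] by simp
qed

lemma direct_sum_transfer:
  assumes "direct_sum C Xs Z" "Z \<simeq> Z'"
  shows "direct_sum C Xs Z'"
proof -
  from assms(1) obtain s r where "biproduct Xs Z s r" by (rule direct_sumE)
  note 1 = biproductD[OF this]
  from assms(2) obtain f g where "inverse_pair f g Z Z'" by (rule iso_objE)
  note fg = inverse_pairD[OF this]
  have "biproduct Xs Z' (\<lambda>i. f \<cdot> s i) (\<lambda>i. r i \<cdot> g)"
  proof (rule biproductI)
    show "Z' \<in> Obj C" using arrD(2)[OF fg(1)] .
    fix i assume i: "i < length Xs"
    show "arr (f \<cdot> s i) (Xs ! i) Z'" "arr (r i \<cdot> g) Z' (Xs ! i)"
      using arr_comp[OF 1(4)[OF i] fg(1)] arr_comp[OF fg(2) 1(5)[OF i]] by blast+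
    fix j assume j: "j < length Xs"
    show "(r j \<cdot> g) \<cdot> (f \<cdot> s i) = (if i = j then Idn (Xs ! i) else 0)"
      using comp4_cancel[OF 1(4)[OF i] fg(1,2) 1(5)[OF j] fg(3)] 1(6)[OF i j] by simp
  next
    show "(\<Sum>i<length Xs. (f \<cdot> s i) \<cdot> (r i \<cdot> g)) = Idn Z'"
      using covered_comp[OF 1(3) fg(2,1)] fg(4) by simp
  qed
  then show ?thesis using direct_sum_iff by blast
qed

lemma zero_objI: 
  assumes "Z \<in> Obj C" "Idn Z = 0"
  shows "zero_obj C Z"
  unfolding zero_obj_def
proof (intro conjI ballI Hom_trivialI)
  fix X f
  show "arr f X Z \<Longrightarrow> f = 0" using comp_id(2)[of f X Z] comp_zeroL[of f X Z] assms(2) by simp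
  show "arr f Z X \<Longrightarrow> f = 0" using comp_id(1)[of f Z X] comp_zeroR[of f Z X] assms(2) by simp
qed (use assms in auto)

lemma zero_objD: "zero_obj C Z \<Longrightarrow> Idn Z = 0" "zero_obj C Z \<Longrightarrow> Z \<in> Obj C"
  unfolding zero_obj_def using Idn_in_Hom by auto

lemma direct_sum_Nil: "direct_sum C [] Z \<longleftrightarrow> zero_obj C Z"
proof
  assume "direct_sum C [] Z" then show "zero_obj C Z" using zero_objI by (auto simp: direct_sum_def)
next
  assume "zero_obj C Z" then show "direct_sum C [] Z" using zero_objD by (auto simp: direct_sum_def)
qed

lemma direct_sum_mset:
  assumes "direct_sum C Xs Z" "mset Ys = mset Xs"
  shows "direct_sum C Ys Z"
proof -
  obtain h where h: "bij_betw h {..<length Ys} {..<length Xs}" "\<forall>i<length Ys. Ys ! i = Xs ! h i"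
    using permutation_Ex_bij[OF assms(2)] by blast
  from assms(1) obtain s r where "biproduct Xs Z s r" by (rule direct_sumE)
  note 1 = biproductD[OF this]
  have hl: "h i < length Xs" if "i < length Ys" for i using h(1) that by (auto simp: bij_betw_def)
  have inj: "inj_on h {..<length Ys}" using h(1) by (simp add: bij_betw_def)
  have "biproduct Ys Z (\<lambda>i. s (h i)) (\<lambda>i. r (h i))"
  proof (rule biproductI)
    show "(\<Sum>i < length Ys. s (h i) \<cdot> r (h i)) = Idn Z"
      using sum.reindex_bij_betw[OF h(1), of "\<lambda>i. s i \<cdot> r i"] 1(7) by simp
    fix i j assume i: "i < length Ys" and j: "j < length Ys"
    show "r (h j) \<cdot> s (h i) = (if i = j then Idn (Ys ! i) else 0)"
      using 1(6)[OF hl[OF i] hl[OF j]] inj i j h(2) by (auto simp: inj_on_def)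
  qed (use 1 hl h(2) in auto)
  then show ?thesis using direct_sum_iff by blast
qed

lemma direct_sum_append:
  assumes "direct_sum C Xs A" "direct_sum C Ys B" "direct_sum C [A, B] Z"
  shows "direct_sum C (Xs @ Ys) Z"
proof -
  let ?m = "length Xs" and ?n = "length Ys"
  from assms(1) obtain s r where "biproduct Xs A s r" by (rule direct_sumE)
  note 1 = biproductD[OF this]
  from assms(2) obtain s' r' where "biproduct Ys B s' r'" by (rule direct_sumE)
  note 2 = biproductD[OF this]
  from assms(3) obtain a b p q where "biproduct2 A B Z a b p q" by (rule direct_sum2E)
  note 3 = biproduct2D[OF this]
  \<comment> \<open>Indices below \<open>?m\<close> pass through \<open>A\<close>; the later ones,
    lowered by \<open>?m\<close>, pass through \<open>B\<close>.\<close>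
  let ?s = "\<lambda>i. if i < ?m then a \<cdot> s i else b \<cdot> s' (i - ?m)"
  let ?r = "\<lambda>i. if i < ?m then r i \<cdot> p else r' (i - ?m) \<cdot> q"
  have "biproduct (Xs @ Ys) Z ?s ?r"
  proof (rule biproductI)
    show "Z \<in> Obj C" using assms direct_sum_Obj by blast
    fix i assume i: "i < length (Xs @ Ys)"
    show "arr (?s i) ((Xs @ Ys) ! i) Z" "arr (?r i) Z ((Xs @ Ys) ! i)"
      using i arr_comp[OF 1(4)[of i] 3(1)] arr_comp[OF 3(3) 1(5)[of i]]
        arr_comp[OF 2(4)[of "i - ?m"] 3(2)] arr_comp[OF 3(4) 2(5)[of "i - ?m"]] by (auto simp: nth_append)
    fix j assume j: "j < length (Xs @ Ys)"
    show "?r j \<cdot> ?s i = (if i = j then Idn ((Xs @ Ys) ! i) else 0)"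
    proof (cases "i < ?m"; cases "j < ?m")
      assume c: "i < ?m" "j < ?m"
      then show ?thesis using comp4_cancel[OF 1(4)[OF c(1)] 3(1,3) 1(5)[OF c(2)] 3(5)] 1(6)[OF c] by (auto simp: nth_append)
    next
      assume c: "i < ?m" "\<not> j < ?m"
      then have c2: "j - ?m < ?n" using j by simp
      show ?thesis using comp4_zero[OF 1(4)[OF c(1)] 3(1,4) 2(5)[OF c2] 3(7)] c by auto
    next
      assume c: "\<not> i < ?m" "j < ?m"
      then have c2: "i - ?m < ?n" using i by simp
      show ?thesis using comp4_zero[OF 2(4)[OF c2] 3(2,3) 1(5)[OF c(2)] 3(8)] c by auto
    next
      assume c: "\<not> i < ?m" "\<not> j < ?m"
      then have c2: "i - ?m < ?n" "j - ?m < ?n" using i j by simp_all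
      show ?thesis using comp4_cancel[OF 2(4)[OF c2(1)] 3(2,4) 2(5)[OF c2(2)] 3(6)] 2(6)[OF c2] c by (auto simp: nth_append)
    qed
  next
    show "(\<Sum>i < length (Xs @ Ys). ?s i \<cdot> ?r i) = Idn Z"
      using sum_lessThan_add[of "\<lambda>i. ?s i \<cdot> ?r i" ?m ?n]
        covered_comp[OF 1(3) 3(3,1)] covered_comp[OF 2(3) 3(4,2)] 3(9) by simp
  qed
  then show ?thesis using direct_sum_iff by blast
qed

end

section \<open>Exact triangles and subcategories\<close>

context triangulated_category
begin

section \<open>The shift functor on morphisms\<close>

lemma arr_shm:
  assumes "arr f X Y" shows "arr (shm f) (sh X) (sh Y)"
proof -
  have "shm f \<in> Hom (sh X) (sh Y)"
    using shm_bij[OF arrD(1,2)[OF assms]] arrD(3)[OF assms] by (auto simp: bij_betw_def)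
  then show ?thesis using arrI sh_Obj arrD[OF assms] by blast
qed

lemma shm_lift:
  assumes "arr g (sh X) (sh Y)" "X \<in> Obj C" "Y \<in> Obj C"
  obtains f where "arr f X Y" "g = shm f"
  using shm_bij[OF assms(2,3)] arrD(3)[OF assms(1)] assms(2,3) that
  by (auto simp: bij_betw_def arr_def)

lemma shm_inject:
  assumes "arr f X Y" "arr g X Y" "shm f = shm g" shows "f = g"
  using shm_bij[OF arrD(1,2)[OF assms(1)]] arrD(3)[OF assms(1)] arrD(3)[OF assms(2)] assms(3)
  by (auto simp: bij_betw_def inj_on_def)

lemma shm_plus: "arr f X Y \<Longrightarrow> arr g X Y \<Longrightarrow> shm (f + g) = shm f + shm g"
  using shm_add unfolding arr_def by blast

lemma shm_o: "arr f X Y \<Longrightarrow> arr g Y Z \<Longrightarrow> shm (g \<cdot> f) = shm g \<cdot> shm f"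
  using shm_comp unfolding arr_def by blast

lemma shm_zero: "shm 0 = 0" if "X \<in> Obj C"
  using shm_plus[OF arr_zero[OF that that] arr_zero[OF that that]] by simp

lemma shm_minus: "arr f X Y \<Longrightarrow> shm (- f) = - shm f"
  using shm_plus[of f X Y "- f"] arr_minus[of f X Y] shm_zero[OF arrD(1)] by (simp add: eq_neg_iff_add_eq_0 add.commute)

lemma shm_eq_0: "arr f X Y \<Longrightarrow> shm f = 0 \<Longrightarrow> f = 0"
  using shm_inject[of f X Y 0] arr_zero[of X Y] shm_zero[of X] arrD by simp

lemma Hom_shift_zero:
  assumes "X \<in> Obj C" "Y \<in> Obj C"
  shows "Hom (sh X) (sh Y) = {0} \<longleftrightarrow> Hom X Y = {0}"
proof
  assume z: "Hom (sh X) (sh Y) = {0}"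
  show "Hom X Y = {0}"
    by (rule Hom_trivialI[OF assms]) (use zero_arr[OF z arr_shm] shm_eq_0 in blast)
next
  assume z: "Hom X Y = {0}"
  show "Hom (sh X) (sh Y) = {0}"
  proof (rule Hom_trivialI[OF sh_Obj[OF assms(1)] sh_Obj[OF assms(2)]])
    fix f assume "arr f (sh X) (sh Y)"
    then obtain g where g: "arr g X Y" "f = shm g" using shm_lift assms by blast
    then show "f = 0" using zero_arr[OF z g(1)] shm_zero[OF assms(1)] by simp
  qed
qed

lemma zero_obj_exists: "\<exists>Z. zero_obj C Z"
  using direct_sums_exist[of "[]"] direct_sum_Nil by auto

lemma zero_obj_sh: "zero_obj C Z \<Longrightarrow> zero_obj C (sh Z)"
  using zero_objD[of Z] zero_objI[OF sh_Obj] shm_Idn[of Z] shm_zero[of Z] by simp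

section \<open>Exactness properties of triangles\<close>

lemma tri_arr:
  assumes "tri X Y Z u v w"
  shows "X \<in> Obj C" "Y \<in> Obj C" "Z \<in> Obj C" "arr u X Y" "arr v Y Z" "arr w Z (sh X)"
  using tri_Obj[OF assms] tri_Hom[OF assms] sh_Obj by (auto simp: arr_def)

lemma tri_rot: "tri X Y Z u v w \<Longrightarrow> tri Y Z (sh X) v w (- shm u)"
  using tri_rotate tri_Obj tri_Hom by blast

text \<open>The triangle on \<open>Idn X\<close> has a zero cone. Mapping it to the given triangle
  by \<open>Idn X\<close> and \<open>u\<close> makes \<open>v \<cdot> u\<close> factor through a
  zero object.\<close>

lemma tri_comp_zero:
  assumes t: "tri X Y Z u v w" shows "v \<cdot> u = 0"
proof -
  note a = tri_arr[OF t]
  obtain Z0 where z: "zero_obj C Z0" using zero_obj_exists by blast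
  have "u \<cdot> Idn X = u \<cdot> Idn X" ..
  from tri_morphism[OF tri_Idn[OF a(1) z] t Idn_in_Hom[OF a(1)] arrD(3)[OF a(4)] this]
  obtain c where c: "c \<in> Hom Z0 Z" "v \<cdot> u = c \<cdot> 0" by blast
  have "arr c Z0 Z" using c(1) zero_objD(2)[OF z] a(3) by (simp add: arr_def)
  then show ?thesis using c(2) comp_zeroR by simp
qed

text \<open>The axiom \<open>tri_morphism\<close> only completes the third component of a morphism
  of triangles. Both triangles are therefore rotated, so that the missing map runs from
  \<open>sh W\<close> to \<open>sh X\<close>, and it is then unshifted by fullness.\<close>

lemma tri_lift1:
  assumes t: "tri X Y Z u v w" and f: "arr f W Y" and z: "v \<cdot> f = 0"
  obtains g where "arr g W X" "f = u \<cdot> g"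
proof -
  note a = tri_arr[OF t]
  have W: "W \<in> Obj C" using arrD(1)[OF f] .
  obtain Z0 where z0: "zero_obj C Z0" using zero_obj_exists by blast
  have Z0: "Z0 \<in> Obj C" using zero_objD(2)[OF z0] .
  have "v \<cdot> f = 0 \<cdot> 0" using z comp_zeroL[OF arr_zero[OF Z0 Z0]] by simp
  from tri_morphism[OF tri_rot[OF tri_Idn[OF W z0]] tri_rot[OF t] arrD(3)[OF f] arrD(3)[OF arr_zero[OF Z0 a(3)]] this]
  obtain c where c: "c \<in> Hom (sh W) (sh X)" "(- shm u) \<cdot> c = shm f \<cdot> (- shm (Idn W))" by blast
  have "arr c (sh W) (sh X)" using c(1) sh_Obj W a(1) by (simp add: arr_def)
  then obtain g where g: "arr g W X" "c = shm g" using shm_lift W a(1) by blast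
  have "- shm (u \<cdot> g) = (- shm u) \<cdot> c"
    using comp_minusL[OF arr_shm[OF g(1)] arr_shm[OF a(4)]] shm_o[OF g(1) a(4)] g(2) by simp
  also have "\<dots> = - shm (f \<cdot> Idn W)" unfolding c(2)
    using comp_minusR[OF arr_shm[OF arr_Idn[OF W]] arr_shm[OF f]] shm_o[OF arr_Idn[OF W] f] by simp
  finally have "shm (u \<cdot> g) = shm f" using comp_id(1)[OF f] by simp
  then show thesis using shm_inject[OF arr_comp[OF g(1) a(4)] f] g(1) that by blast
qed

lemma tri_zero_first:
  assumes "W \<in> Obj C" "zero_obj C Z0" shows "tri Z0 W W 0 (Idn W) 0"
proof -
  have Z0: "Z0 \<in> Obj C" using zero_objD(2)[OF assms(2)] .
  have "tri W W (sh Z0) (Idn W) 0 (- shm 0)"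
    using tri_Idn[OF assms(1) zero_obj_sh[OF assms(2)]] shm_zero[OF Z0] by simp
  moreover have "0 \<in> Hom Z0 W" "0 \<in> Hom W (sh Z0)" using arr_zero[THEN arrD(3)] Z0 assms(1) sh_Obj by auto
  ultimately show ?thesis
    using tri_rotate[OF Z0 assms(1) assms(1), of 0 "Idn W" 0] Idn_in_Hom[OF assms(1)] by blast
qed

text \<open>Here the missing map already is a third component, so comparison with the triangle 0 ->
  W -> W suffices.\<close>

lemma tri_ext1:
  assumes t: "tri X Y Z u v w" and f: "arr f Y W" and z: "f \<cdot> u = 0"
  obtains g where "arr g Z W" "f = g \<cdot> v"
proof -
  note a = tri_arr[OF t]
  have W: "W \<in> Obj C" using arrD(2)[OF f] .
  obtain Z0 where z0: "zero_obj C Z0" using zero_obj_exists by blast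
  have Z0: "Z0 \<in> Obj C" using zero_objD(2)[OF z0] .
  have "0 \<cdot> 0 = f \<cdot> u" using z comp_zeroL[OF arr_zero[OF Z0 Z0]] by simp
  from tri_morphism[OF t tri_zero_first[OF W z0] arrD(3)[OF arr_zero[OF a(1) Z0]] arrD(3)[OF f] this]
  obtain c where "c \<in> Hom Z W" "Idn W \<cdot> f = c \<cdot> v" by blast
  then show thesis using that[of c] comp_id(2)[OF f] W a(3) by (simp add: arr_def)
qed

text \<open>The numbering runs along the triangle: the lifts 1, 2, 3 are through \<open>u\<close>,
  \<open>v\<close>, \<open>w\<close>, and the extensions 1, 2, 3 are along \<open>v\<close>,
  \<open>w\<close>, \<open>shm u\<close>. In the third cases the sign created by rotation has to be
  removed.\<close>

lemma tri_lift2: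
  assumes "tri X Y Z u v w" "arr f W Z" "w \<cdot> f = 0"
  obtains g where "arr g W Y" "f = v \<cdot> g"
  using tri_lift1[OF tri_rot[OF assms(1)] assms(2,3)] .

lemma tri_ext2:
  assumes "tri X Y Z u v w" "arr f Z W" "f \<cdot> v = 0"
  obtains g where "arr g (sh X) W" "f = g \<cdot> w"
  using tri_ext1[OF tri_rot[OF assms(1)] assms(2,3)] .

lemma tri_lift3:
  assumes t: "tri X Y Z u v w" and f: "arr f W (sh X)" and "shm u \<cdot> f = 0"
  obtains g where "arr g W Z" "f = w \<cdot> g"
proof (rule tri_lift2[OF tri_rot[OF t] f])
  show "(- shm u) \<cdot> f = 0"
    using comp_minusL[OF f arr_shm[OF tri_arr(4)[OF t]]] assms(3) by simp
qed

lemma tri_ext3: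
  assumes t: "tri X Y Z u v w" and f: "arr f (sh X) W" and "f \<cdot> w = 0"
  obtains g where "arr g (sh Y) W" "f = g \<cdot> shm u"
proof -
  from tri_ext2[OF tri_rot[OF t] f assms(3)]
  obtain g where g: "arr g (sh Y) W" "f = g \<cdot> (- shm u)" by blast
  have "f = (- g) \<cdot> shm u"
    using g comp_minusL[OF arr_shm[OF tri_arr(4)[OF t]] g(1)] comp_minusR[OF arr_shm[OF tri_arr(4)[OF t]] g(1)] by simp
  then show thesis using that arr_minus[OF g(1)] by blast
qed

lemma tri_comp_zero2: "tri X Y Z u v w \<Longrightarrow> w \<cdot> v = 0"
  using tri_comp_zero[OF tri_rot] .

lemma tri_comp_zero3: "tri X Y Z u v w \<Longrightarrow> shm u \<cdot> w = 0"
  using tri_comp_zero2[OF tri_rot, of X Y Z u v w] comp_minusL[OF tri_arr(6) arr_shm[OF tri_arr(4)]] by simp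

lemma tri_shift:
  "tri X Y Z u v w \<Longrightarrow> tri (sh X) (sh Y) (sh Z) (- shm u) (- shm v) (- shm w)"
  by (intro tri_rot)

lemma tri_replace3:
  assumes t: "tri X Y Z u v w" and "Z \<simeq> Z'"
  obtains v' w' where "tri X Y Z' u v' w'"
proof -
  note a = tri_arr[OF t]
  from assms(2) obtain f g where "inverse_pair f g Z Z'" by (rule iso_objE)
  note fg = inverse_pairD[OF this]
  have i: "iso_mor C A A (Idn A)" if "A \<in> Obj C" for A
    using iso_morI[OF arr_Idn arr_Idn] comp_id(1)[OF arr_Idn] that by blast
  have "tri X Y Z' u (f \<cdot> v) (w \<cdot> g)"
  proof (rule tri_iso[OF t a(1,2) arrD(2)[OF fg(1)] _ _ _ i[OF a(1)] i[OF a(2)] iso_morI[OF fg]])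
    show "u \<in> Hom X Y" "f \<cdot> v \<in> Hom Y Z'" "w \<cdot> g \<in> Hom Z' (sh X)"
      using arrD(3) a arr_comp[OF a(5) fg(1)] arr_comp[OF fg(2) a(6)] by blast+
    show "u \<cdot> Idn X = Idn Y \<cdot> u" using comp_id a(4) by simp
    show "f \<cdot> v \<cdot> Idn Y = f \<cdot> v" using comp_id(1)[OF arr_comp[OF a(5) fg(1)]] .
    show "w \<cdot> g \<cdot> f = shm (Idn X) \<cdot> w"
      using assoc[OF fg(1,2) a(6)] fg(3) comp_id[OF a(6)] shm_Idn[OF a(1)] by simp
  qed
  then show thesis by (rule that)
qed

text \<open>The axioms complete a given first map, whereas here the third map is prescribed. The
  cone of \<open>w\<close> is isomorphic to some \<open>sh Y\<close> by essential surjectivity, and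
  undoing two rotations costs the signs in \<open>- u\<close> and \<open>- v\<close>.\<close>

lemma tri_fiber:
  assumes w: "arr w Z (sh X)" and X: "X \<in> Obj C"
  obtains Y u v where "tri X Y Z u v w"
proof -
  note o = arrD[OF w]
  from tri_cone[OF o] obtain Q p q where "tri Z (sh X) Q w p q" by blast
  moreover obtain Y where Y: "Y \<in> Obj C" "Q \<simeq> sh Y"
    using sh_ess_surj tri_arr(3)[OF calculation] by blast
  ultimately obtain p q where t: "tri Z (sh X) (sh Y) w p q" using tri_replace3 by blast
  note a = tri_arr[OF t]
  obtain u where u: "arr u X Y" "p = shm u" using shm_lift[OF a(5) X Y(1)] .
  obtain v where v: "arr v Y Z" "q = shm v" using shm_lift[OF a(6) Y(1) o(1)] .
  have "p = - shm (- u)" "q = - shm (- v)" using shm_minus[OF u(1)] shm_minus[OF v(1)] u v by simp_all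
  then have t': "tri Z (sh X) (sh Y) w (- shm (- u)) (- shm (- v))" using t by simp
  note uv = arrD(3)[OF arr_minus[OF u(1)]] arrD(3)[OF arr_minus[OF v(1)]] arrD(3)[OF w]
  have "- shm (- u) \<in> Hom (sh X) (sh Y)" using arrD(3)[OF arr_minus[OF arr_shm[OF arr_minus[OF u(1)]]]] .
  then have "tri Y Z (sh X) (- v) w (- shm (- u))"
    using tri_rotate[OF Y(1) o(1,2) uv(2,3)] t' by blast
  then have "tri X Y Z (- u) (- v) w"
    using tri_rotate[OF X Y(1) o(1) uv] by blast
  then show thesis by (rule that)
qed

section \<open>Retracts and split idempotents\<close>

definition retract :: "'o \<Rightarrow> 'o \<Rightarrow> bool" where
  "retract X Z \<longleftrightarrow> (\<exists>s r. arr s X Z \<and> arr r Z X \<and> r \<cdot> s = Idn X)"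

lemma retractE:
  assumes "retract X Z" obtains s r where "arr s X Z" "arr r Z X" "r \<cdot> s = Idn X"
  using assms retract_def by blast

lemma retract_Obj: "retract X Z \<Longrightarrow> X \<in> Obj C \<and> Z \<in> Obj C"
  using arrD by (auto simp: retract_def)

lemma retract_trans:
  assumes "retract X Y" "retract Y Z" shows "retract X Z"
proof -
  from assms(1) obtain s r where 1: "arr s X Y" "arr r Y X" "r \<cdot> s = Idn X" by (rule retractE)
  from assms(2) obtain t q where 2: "arr t Y Z" "arr q Z Y" "q \<cdot> t = Idn Y" by (rule retractE)
  show ?thesis unfolding retract_def
    using arr_comp[OF 1(1) 2(1)] arr_comp[OF 2(2) 1(2)] comp4_cancel[OF 1(1) 2(1,2) 1(2) 2(3)] 1(3) by auto
qed

lemma iso_retract: "X \<simeq> Y \<Longrightarrow> retract X Y"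
  by (erule iso_objE) (auto simp: inverse_pair_def retract_def)

text \<open>Idempotents split in a triangulated category: the complement is the cone of the section.\<close>

lemma retract_summand:
  assumes "arr s M r" "arr v r M" "v \<cdot> s = Idn M"
  shows "summand C M r"
proof -
  note sv = arrD[OF assms(1)]
  from tri_cone[OF sv] obtain N q w where t: "tri M r N s q w" by blast
  note a = tri_arr[OF t]
  \<comment> \<open>Since \<open>shm s \<cdot> w = 0\<close> and \<open>s\<close> has a left
    inverse, the connecting map vanishes, and then \<open>q\<close> has a section
    \<open>t0\<close>.\<close>
  have "w = shm (v \<cdot> s) \<cdot> w" using assms(3) shm_Idn[OF a(1)] comp_id(2)[OF a(6)] by simp
  also have "\<dots> = shm v \<cdot> (shm s \<cdot> w)"
    using shm_o[OF assms(1,2)] assoc[OF a(6) arr_shm[OF assms(1)] arr_shm[OF assms(2)]] by simp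
  also have "\<dots> = 0" using tri_comp_zero3[OF t] comp_zeroR[OF arr_shm[OF assms(2)]] by simp
  finally have w0: "w = 0" .
  obtain t0 where t0: "arr t0 N r" "Idn N = q \<cdot> t0"
    using tri_lift2[OF t arr_Idn[OF a(3)]] comp_zeroL[OF arr_Idn[OF a(3)]] w0 by metis
  \<comment> \<open>Subtracting the part of \<open>t0\<close> inside \<open>M\<close> makes the
    section orthogonal to \<open>v\<close>; it remains a section because
    \<open>q \<cdot> s = 0\<close>.\<close>
  define t' where "t' = t0 - s \<cdot> (v \<cdot> t0)"
  have vt: "arr (v \<cdot> t0) N M" using arr_comp[OF t0(1) assms(2)] .
  have svt: "arr (s \<cdot> (v \<cdot> t0)) N r" using arr_comp[OF vt assms(1)] .
  have t'a: "arr t' N r" unfolding t'_def using arr_diff[OF t0(1) svt] .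
  have vt0: "v \<cdot> t' = 0" unfolding t'_def
    using comp_diffR[OF t0(1) svt assms(2)] assoc[OF vt assms(1,2)] assms(3) comp_id(2)[OF vt] by simp
  have qt: "q \<cdot> t' = Idn N" unfolding t'_def
    using comp_diffR[OF t0(1) svt a(5)] assoc[OF vt assms(1) a(5)] tri_comp_zero[OF t] comp_zeroL[OF vt] t0(2) by simp
  \<comment> \<open>The defect \<open>e\<close> of the decomposition is killed by \<open>q\<close>,
    so it is \<open>s \<cdot> h\<close> for some \<open>h\<close>; applying \<open>v\<close> shows
    \<open>h = 0\<close>.\<close>
  define e where "e = Idn r - (s \<cdot> v + t' \<cdot> q)"
  have svr: "arr (s \<cdot> v) r r" and tq: "arr (t' \<cdot> q) r r"
    using arr_comp[OF assms(2,1)] arr_comp[OF a(5) t'a] by auto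
  have ea: "arr e r r" unfolding e_def using arr_diff[OF arr_Idn[OF a(2)] arr_add[OF svr tq]] .
  have "q \<cdot> e = q - (q \<cdot> (s \<cdot> v) + q \<cdot> (t' \<cdot> q))"
    unfolding e_def using comp_diffR[OF arr_Idn[OF a(2)] arr_add[OF svr tq] a(5)]
      comp_addR[OF svr tq a(5)] comp_id(1)[OF a(5)] by simp
  also have "\<dots> = 0" using assoc[OF assms(2,1) a(5)] tri_comp_zero[OF t] comp_zeroL[OF assms(2)]
      assoc[OF a(5) t'a a(5)] qt comp_id(2)[OF a(5)] by simp
  finally obtain h where h: "arr h r M" "e = s \<cdot> h" using tri_lift1[OF t ea] by blast
  have "h = v \<cdot> e" using assoc[OF h(1) assms(1,2)] assms(3) comp_id(2)[OF h(1)] h(2) by simp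
  also have "\<dots> = v - (v \<cdot> (s \<cdot> v) + v \<cdot> (t' \<cdot> q))"
    unfolding e_def using comp_diffR[OF arr_Idn[OF a(2)] arr_add[OF svr tq] assms(2)]
      comp_addR[OF svr tq assms(2)] comp_id(1)[OF assms(2)] by simp
  also have "\<dots> = 0" using assoc[OF assms(2,1,2)] assms(3) comp_id(2)[OF assms(2)]
      assoc[OF a(5) t'a assms(2)] vt0 comp_zeroL[OF a(5)] by simp
  finally have "e = 0" using h(2) comp_zeroR[OF assms(1)] by simp
  then have "s \<cdot> v + t' \<cdot> q = Idn r" by (simp add: e_def)
  then have "biproduct2 M N r s t' v q"
    unfolding biproduct2_def using assms t'a a(5) qt vt0 tri_comp_zero[OF t] by simp
  then show ?thesis unfolding summand_def direct_sum2_iff by blast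
qed

lemma summand_iff_retract: "summand C X Z \<longleftrightarrow> retract X Z"
proof
  assume "summand C X Z"
  then obtain Y i j p q where "biproduct2 X Y Z i j p q" unfolding summand_def direct_sum2_iff by blast
  from biproduct2D[OF this] show "retract X Z" unfolding retract_def by blast
next
  assume "retract X Z" then show "summand C X Z" using retract_summand by (auto elim: retractE)
qed

section \<open>Subcategories and their closure properties\<close>

lemma subcategory_Obj: "subcategory C S \<Longrightarrow> X \<in> S \<Longrightarrow> X \<in> Obj C"
  by (auto simp: subcategory_def)

lemma subcategory_retract: "subcategory C S \<Longrightarrow> retract X Z \<Longrightarrow> Z \<in> S \<Longrightarrow> X \<in> S"
  unfolding subcategory_def summand_iff_retract by blast

lemma subcategory_iso: "subcategory C S \<Longrightarrow> X \<simeq> Z \<Longrightarrow> Z \<in> S \<Longrightarrow> X \<in> S"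
  using subcategory_retract iso_retract by blast

lemma subcategory_direct_sum: "subcategory C S \<Longrightarrow> direct_sum C Xs Z \<Longrightarrow> set Xs \<subseteq> S \<Longrightarrow> Z \<in> S"
  unfolding subcategory_def by blast

lemma subcategory_zero: "subcategory C S \<Longrightarrow> zero_obj C Z \<Longrightarrow> Z \<in> S"
  using subcategory_direct_sum[of S "[]" Z] direct_sum_Nil by simp

text \<open>Coverings treat sums and summands together: a biproduct is covered by its parts, and a
  retract is covered by one object. Each later closure proof is then a single computation with
  coverings; \<open>subcategory_covered\<close> is the converse.\<close>

lemma subcategoryI:
  assumes "S \<subseteq> Obj C" "\<And>n X s r Z. covered n X s r Z \<Longrightarrow> (\<And>i. i < n \<Longrightarrow> X i \<in> S) \<Longrightarrow> Z \<in> S"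
  shows "subcategory C S"
  unfolding subcategory_def
proof (intro conjI allI impI)
  fix Xs Z assume d: "direct_sum C Xs Z" "set Xs \<subseteq> S"
  from d(1) obtain s r where "biproduct Xs Z s r" by (rule direct_sumE)
  from biproductD(3)[OF this] show "Z \<in> S" by (rule assms(2)) (use d(2) in auto)
next
  fix X Z assume d: "summand C X Z" "Z \<in> S"
  then obtain s r where sr: "arr s X Z" "arr r Z X" "r \<cdot> s = Idn X" unfolding summand_iff_retract by (auto elim: retractE)
  then have "covered 1 (\<lambda>_. Z) (\<lambda>_. r) (\<lambda>_. s) X" using arrD by (auto simp: covered_def lessThan_Suc)
  then show "X \<in> S" by (rule assms(2)) (use d(2) in auto)
qed (rule assms(1))

lemma subcategory_Obj_all: "subcategory C (Obj C)"
  by (rule subcategoryI) (auto simp: covered_def)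

lemma subcategory_Int: "subcategory C S \<Longrightarrow> subcategory C S' \<Longrightarrow> subcategory C (S \<inter> S')"
  unfolding subcategory_def by blast

lemma add_subcategory:
  assumes "T \<in> Obj C" shows "subcategory C (add C T)"
proof -
  have "add C T \<subseteq> Obj C" using subcategory_Obj_all assms by (auto simp: add_def)
  moreover have "Z \<in> add C T" if "direct_sum C Xs Z" "set Xs \<subseteq> add C T" for Xs Z
    using that subcategory_direct_sum unfolding add_def by blast
  moreover have "X \<in> add C T" if "summand C X Z" "Z \<in> add C T" for X Z
    using that subcategory_retract unfolding add_def summand_iff_retract by blast
  ultimately show ?thesis unfolding subcategory_def by blast
qed

lemma add_self: "T \<in> add C T" by (auto simp: add_def)

lemma add_least: "subcategory C S \<Longrightarrow> T \<in> S \<Longrightarrow> add C T \<subseteq> S"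
  by (auto simp: add_def)

lemma subcategory_Hom_zero_left:
  assumes "V \<in> Obj C" shows "subcategory C {Z \<in> Obj C. Hom Z V = {0}}"
proof (rule subcategoryI)
  fix n X s r Z assume c: "covered n X s r Z" and X: "\<And>i. i < n \<Longrightarrow> X i \<in> {Z \<in> Obj C. Hom Z V = {0}}"
  have Z: "Z \<in> Obj C" using c by (simp add: covered_def)
  have "Hom Z V = {0}"
  proof (rule Hom_trivialI[OF Z assms])
    fix f assume f: "arr f Z V"
    show "f = 0"
    proof (rule covered_zeroL[OF c f])
      fix i assume i: "i < n"
      then have "arr (s i) (X i) Z" using c by (simp add: covered_def)
      from arr_comp[OF this f] show "f \<cdot> s i = 0" using X[OF i] zero_arr by blast
    qed
  qed
  then show "Z \<in> {Z \<in> Obj C. Hom Z V = {0}}" using Z by simp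
qed auto

lemma subcategory_Hom_zero_right:
  assumes "V \<in> Obj C" shows "subcategory C {Z \<in> Obj C. Hom V Z = {0}}"
proof (rule subcategoryI)
  fix n X s r Z assume c: "covered n X s r Z" and X: "\<And>i. i < n \<Longrightarrow> X i \<in> {Z \<in> Obj C. Hom V Z = {0}}"
  have Z: "Z \<in> Obj C" using c by (simp add: covered_def)
  have "Hom V Z = {0}"
  proof (rule Hom_trivialI[OF assms Z])
    fix f assume f: "arr f V Z"
    show "f = 0"
    proof (rule covered_zeroR[OF c f])
      fix i assume i: "i < n"
      then have "arr (r i) Z (X i)" using c by (simp add: covered_def)
      from arr_comp[OF f this] show "r i \<cdot> f = 0" using X[OF i] zero_arr by blast
    qed
  qed
  then show "Z \<in> {Z \<in> Obj C. Hom V Z = {0}}" using Z by simp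
qed auto

lemma covered_sh:
  assumes c: "covered n X s r Z"
  shows "covered n (\<lambda>i. sh (X i)) (\<lambda>i. shm (s i)) (\<lambda>i. shm (r i)) (sh Z)"
proof -
  have a: "arr (s i) (X i) Z" "arr (r i) Z (X i)" if "i < n" for i using c that by (auto simp: covered_def)
  have Z: "Z \<in> Obj C" using c by (simp add: covered_def)
  have "shm (\<Sum>i<m. s i \<cdot> r i) = (\<Sum>i<m. shm (s i) \<cdot> shm (r i))" if "m \<le> n" for m
    using that
  proof (induction m)
    case (Suc m)
    then have m: "m < n" by simp
    have "arr (\<Sum>i<m. s i \<cdot> r i) Z Z"
      by (rule arr_sum[OF Z Z]) (use arr_comp[OF a(2) a(1)] m in auto)
    then show ?case
      using shm_plus[OF _ arr_comp[OF a(2,1)[OF m]]] shm_o[OF a(2,1)[OF m]] Suc by simp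
  qed (use shm_zero[OF Z] in simp)
  from this[of n] show ?thesis
    using c a arr_shm sh_Obj[OF Z] shm_Idn[OF Z] by (auto simp: covered_def)
qed

lemma subcategory_covered:
  assumes "subcategory C S" "covered n X s r Z" "\<And>i. i < n \<Longrightarrow> X i \<in> S"
  shows "Z \<in> S"
proof -
  let ?Xs = "map X [0..<n]"
  have a: "arr (s i) (X i) Z" "arr (r i) Z (X i)" if "i < n" for i using assms(2) that by (auto simp: covered_def)
  have Z: "Z \<in> Obj C" using assms(2) by (simp add: covered_def)
  have "set ?Xs \<subseteq> Obj C" using assms(1,3) subcategory_Obj by auto
  then obtain D where d: "direct_sum C ?Xs D" using direct_sums_exist by blast
  then obtain t p where "biproduct ?Xs D t p" by (rule direct_sumE)
  note b = biproductD[OF this]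
  have tp: "arr (t i) (X i) D" "arr (p i) D (X i)" if "i < n" for i using b(4,5)[of i] that by simp_all
  \<comment> \<open>The maps \<open>r i\<close> are assembled into \<open>f\<close> and the maps
    \<open>s i\<close> into \<open>g\<close>; then \<open>g \<cdot> f\<close> is the covering sum,
    so \<open>Z\<close> is a retract of \<open>D\<close>.\<close>
  define f where "f = (\<Sum>i<n. t i \<cdot> r i)"
  define g where "g = (\<Sum>i<n. s i \<cdot> p i)"
  have tr: "arr (t i \<cdot> r i) Z D" if "i < n" for i using arr_comp[OF a(2) tp(1)] that by blast
  have sp: "arr (s i \<cdot> p i) D Z" if "i < n" for i using arr_comp[OF tp(2) a(1)] that by blast
  have fa: "arr f Z D" unfolding f_def by (rule arr_sum[OF Z b(1)]) (use tr in simp)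
  have ga: "arr g D Z" unfolding g_def by (rule arr_sum[OF b(1) Z]) (use sp in simp)
  have pf: "p i \<cdot> f = r i" if i: "i < n" for i
  proof -
    have "p i \<cdot> f = (\<Sum>j<n. p i \<cdot> (t j \<cdot> r j))" unfolding f_def
      by (rule comp_sumR[OF tp(2)[OF i] Z]) (use tr in simp)
    also have "\<dots> = (\<Sum>j<n. if j = i then r i else 0)"
    proof (rule sum.cong)
      fix j assume "j \<in> {..<n}" then have j: "j < n" by simp
      show "p i \<cdot> (t j \<cdot> r j) = (if j = i then r i else 0)"
        using assoc[OF a(2)[OF j] tp(1)[OF j] tp(2)[OF i]] b(6)[of j i] i j comp_id(2)[OF a(2)[OF i]]
          comp_zeroL[OF a(2)[OF j]] by auto
    qed simp
    finally show ?thesis using i by simp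
  qed
  have "g \<cdot> f = (\<Sum>i<n. (s i \<cdot> p i) \<cdot> f)" unfolding g_def
    by (rule comp_sumL[OF fa Z]) (use sp in simp)
  also have "\<dots> = (\<Sum>i<n. s i \<cdot> r i)"
    by (rule sum.cong) (use assoc[OF fa tp(2) a(1)] pf in auto)
  finally have "g \<cdot> f = Idn Z" using assms(2) by (simp add: covered_def)
  then have "retract Z D" using fa ga by (auto simp: retract_def)
  moreover have "set ?Xs \<subseteq> S" using assms(3) by auto
  then have "D \<in> S" by (rule subcategory_direct_sum[OF assms(1) d])
  ultimately show ?thesis using subcategory_retract assms(1) by blast
qed

lemma subcategory_sh_vimage:
  assumes S: "subcategory C S" shows "subcategory C {Z \<in> Obj C. sh Z \<in> S}"
proof (rule subcategoryI)
  fix n X s r Z assume c: "covered n X s r Z" and X: "\<And>i. i < n \<Longrightarrow> X i \<in> {Z \<in> Obj C. sh Z \<in> S}"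
  then show "Z \<in> {Z \<in> Obj C. sh Z \<in> S}"
    using subcategory_covered[OF S covered_sh[OF c]] by (simp add: covered_def)
qed auto

end

section \<open>Krull-Schmidt decompositions\<close>

context additive_linear_category
begin

lemma direct_sum_dsum: "X \<in> Obj C \<Longrightarrow> Y \<in> Obj C \<Longrightarrow> direct_sum C [X, Y] (X \<oplus> Y)"
  unfolding dsum_def using direct_sums_exist[of "[X, Y]"] by (auto intro: someI_ex)

lemma dsum_Obj: "X \<in> Obj C \<Longrightarrow> Y \<in> Obj C \<Longrightarrow> X \<oplus> Y \<in> Obj C"
  using direct_sum_dsum direct_sum_Obj by blast

text \<open>Both partial sums and their sum are built afresh, and uniqueness of biproducts moves the
  result to \<open>Z\<close>.\<close>

lemma direct_sum_append_split:
  assumes "direct_sum C (Xs @ Ys) Z"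
  obtains A B where "direct_sum C Xs A" "direct_sum C Ys B" "direct_sum C [A, B] Z"
proof -
  have o: "set Xs \<subseteq> Obj C" "set Ys \<subseteq> Obj C" using direct_sum_Obj(1)[OF assms] by auto
  obtain A where A: "direct_sum C Xs A" using direct_sums_exist[OF o(1)] by blast
  obtain B where B: "direct_sum C Ys B" using direct_sums_exist[OF o(2)] by blast
  have AB: "direct_sum C [A, B] (A \<oplus> B)" using direct_sum_dsum A B direct_sum_Obj by blast
  have "A \<oplus> B \<simeq> Z" using direct_sum_iso[OF direct_sum_append[OF A B AB] assms] .
  then show thesis using that[OF A B] direct_sum_transfer[OF AB] by blast
qed

end

context linear_category
begin

lemma direct_sum_iso_list:
  assumes d: "direct_sum C Xs Z" and l: "length Ys = length Xs"
    and iso: "\<And>i. i < length Xs \<Longrightarrow> Xs ! i \<simeq> Ys ! i"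
  shows "direct_sum C Ys Z"
proof -
  from d obtain s r where "biproduct Xs Z s r" by (rule direct_sumE)
  note 1 = biproductD[OF this]
  have "\<exists>f g. inverse_pair f g (Xs ! i) (Ys ! i)" if "i < length Xs" for i
    using iso_objE[OF iso[OF that]] by blast
  then obtain f g where fg: "\<And>i. i < length Xs \<Longrightarrow> inverse_pair (f i) (g i) (Xs ! i) (Ys ! i)" by metis
  note f = inverse_pairD(1)[OF fg] and g = inverse_pairD(2)[OF fg]
  have "biproduct Ys Z (\<lambda>i. s i \<cdot> g i) (\<lambda>i. f i \<cdot> r i)"
  proof (rule biproductI[OF 1(1)])
    fix i assume "i < length Ys"
    then have i: "i < length Xs" using l by simp
    show "arr (s i \<cdot> g i) (Ys ! i) Z" "arr (f i \<cdot> r i) Z (Ys ! i)"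
      using arr_comp[OF g[OF i] 1(4)[OF i]] arr_comp[OF 1(5)[OF i] f[OF i]] by blast+
    fix j assume "j < length Ys"
    then have j: "j < length Xs" using l by simp
    show "f j \<cdot> r j \<cdot> (s i \<cdot> g i) = (if i = j then Idn (Ys ! i) else 0)"
    proof (cases "i = j")
      case True
      then show ?thesis
        using comp4_cancel[OF g[OF i] 1(4)[OF i] 1(5)[OF i] f[OF i]] 1(6)[OF i i] inverse_pairD(4)[OF fg[OF i]] by simp
    next
      case False
      then show ?thesis
        using comp4_zero[OF g[OF i] 1(4)[OF i] 1(5)[OF j] f[OF j]] 1(6)[OF i j] by simp
    qed
  next
    have "(s i \<cdot> g i) \<cdot> (f i \<cdot> r i) = s i \<cdot> r i" if "i < length Xs" for i
      using comp4_cancel[OF 1(5) f g 1(4)] inverse_pairD(3)[OF fg] that by blast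
    then show "(\<Sum>i<length Ys. s i \<cdot> g i \<cdot> (f i \<cdot> r i)) = Idn Z" using 1(7) l by simp
  qed
  then show ?thesis using direct_sum_iff by blast
qed

section \<open>Units and local endomorphism rings\<close>

lemma iso_mor_iff: "X \<in> Obj C \<Longrightarrow> Y \<in> Obj C \<Longrightarrow> iso_mor C X Y f \<longleftrightarrow> (\<exists>g. inverse_pair f g X Y)"
  by (auto simp: iso_mor_def inverse_pair_def arr_def)

lemma inverse_pair_iso_mor: "inverse_pair f g X Y \<Longrightarrow> iso_mor C X Y f"
  using iso_morI by (auto simp: inverse_pair_def)

lemma iso_mor_Idn: "X \<in> Obj C \<Longrightarrow> iso_mor C X X (Idn X)"
  using iso_morI[OF arr_Idn arr_Idn] comp_id(1)[OF arr_Idn] by blast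

lemma inverse_pair_comp:
  assumes "inverse_pair f g X Y" "inverse_pair h k Y Z"
  shows "inverse_pair (h \<cdot> f) (g \<cdot> k) X Z"
proof -
  note 1 = inverse_pairD[OF assms(1)] and 2 = inverse_pairD[OF assms(2)]
  show ?thesis unfolding inverse_pair_def
    using arr_comp[OF 1(1) 2(1)] arr_comp[OF 2(2) 1(2)]
      comp4_cancel[OF 1(1) 2(1,2) 1(2) 2(3)] comp4_cancel[OF 2(2) 1(2,1) 2(1) 1(4)] 1(3) 2(4) by simp
qed

lemma local_EndD:
  assumes "local_End C J"
  shows "J \<in> Obj C" "Idn J \<noteq> 0"
    "\<And>f g. arr f J J \<Longrightarrow> arr g J J \<Longrightarrow> iso_mor C J J (f + g) \<Longrightarrow> iso_mor C J J f \<or> iso_mor C J J g"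
  using assms by (auto simp: local_End_def arr_def)

lemma not_iso_mor_zero:
  assumes "J \<in> Obj C" "Idn J \<noteq> 0" shows "\<not> iso_mor C J J 0"
proof
  assume "iso_mor C J J 0"
  then obtain g where "inverse_pair 0 g J J" using iso_mor_iff assms(1) by blast
  note * = inverse_pairD[OF this]
  show False using *(4) comp_zeroL[OF *(2)] assms(2) by simp
qed

lemma local_sum_unit:
  assumes J: "local_End C J" and "finite A" "\<And>i. i \<in> A \<Longrightarrow> arr (f i) J J" "iso_mor C J J (\<Sum>i\<in>A. f i)"
  shows "\<exists>i\<in>A. iso_mor C J J (f i)"
  using assms(2-)
proof (induction A rule: finite_induct)
  case empty
  then show ?case using not_iso_mor_zero[OF local_EndD(1,2)[OF J]] by simp
next
  case (insert x A)
  have "arr (\<Sum>i\<in>A. f i) J J" by (rule arr_sum) (use local_EndD(1)[OF J] insert in auto)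
  then show ?case using local_EndD(3)[OF J, of "f x" "\<Sum>i\<in>A. f i"] insert by auto
qed

lemma unit_idempotent:
  assumes "X \<in> Obj C" "iso_mor C X X e" "e \<cdot> e = e" shows "e = Idn X"
proof -
  obtain g where "inverse_pair e g X X" using iso_mor_iff assms by blast
  note g = inverse_pairD[OF this]
  have "e = (g \<cdot> e) \<cdot> e" using g(3) comp_id(2)[OF g(1)] by simp
  also have "\<dots> = Idn X" using assoc[OF g(1,1,2)] assms(3) g(3) by simp
  finally show ?thesis .
qed

text \<open>A composite \<open>J \<rightarrow> X \<rightarrow> J\<close> that is a unit makes both factors invertible, since \<open>X\<close> has no
  idempotents other than 0 and 1.\<close>

lemma local_factor_iso:
  assumes X: "local_End C X" and J: "J \<in> Obj C" "Idn J \<noteq> 0"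
    and s: "arr s J X" and r: "arr r X J" and u: "iso_mor C J J (r \<cdot> s)"
  shows "iso_mor C J X s" "iso_mor C X J r"
proof -
  note Xo = local_EndD(1)[OF X]
  obtain w where w: "inverse_pair (r \<cdot> s) w J J" using iso_mor_iff J(1) u by blast
  note w' = inverse_pairD[OF w]
  \<comment> \<open>Rescaling \<open>r\<close> by the inverse of the unit gives an exact left
    inverse of \<open>s\<close>, so \<open>s \<cdot> q\<close> is an idempotent of
    \<open>X\<close>.\<close>
  define q where "q = w \<cdot> r"
  have q: "arr q X J" "q \<cdot> s = Idn J"
    unfolding q_def using arr_comp[OF r w'(2)] assoc[OF s r w'(2)] w'(3) by simp_all
  define e where "e = s \<cdot> q"
  have e: "arr e X X" unfolding e_def by (rule arr_comp[OF q(1) s])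
  have ee: "e \<cdot> e = e" unfolding e_def using comp4_cancel[OF q(1) s q(1) s q(2)] .
  have es: "e \<cdot> s = s" unfolding e_def using assoc[OF s q(1) s] q(2) comp_id(1)[OF s] by simp
  \<comment> \<open>Locality makes \<open>e\<close> or \<open>Idn X - e\<close> a unit. The latter
    kills \<open>s\<close>, which would force \<open>s = 0\<close> and hence
    \<open>Idn J = 0\<close>.\<close>
  have "iso_mor C X X (e + (Idn X - e))" using iso_mor_Idn[OF Xo] by simp
  then consider "iso_mor C X X e" | "iso_mor C X X (Idn X - e)"
    using local_EndD(3)[OF X e arr_diff[OF arr_Idn[OF Xo] e]] by blast
  then have "iso_mor C X X e"
  proof cases
    case 2
    then obtain g where "inverse_pair (Idn X - e) g X X" using iso_mor_iff Xo by blast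
    note g = inverse_pairD[OF this]
    have "(Idn X - e) \<cdot> s = 0" using comp_diffL[OF s arr_Idn[OF Xo] e] comp_id(2)[OF s] es by simp
    then have "s = 0" using assoc[OF s g(1,2)] g(3) comp_id(2)[OF s] comp_zeroR[OF g(2)] by simp
    then have "Idn J = 0" using q comp_zeroR[OF q(1)] by simp
    then show ?thesis using J(2) by blast
  qed
  then have "e = Idn X" using unit_idempotent[OF Xo _ ee] by blast
  then have sq: "inverse_pair s q J X" unfolding inverse_pair_def using s q e_def by simp
  then have qs: "inverse_pair q s X J" by (simp add: inverse_pair_def)
  show "iso_mor C J X s" by (rule inverse_pair_iso_mor[OF sq])
  have "r = (r \<cdot> s) \<cdot> q" using assoc[OF q(1) s r] \<open>e = Idn X\<close> e_def comp_id(1)[OF r] by simp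
  then have "inverse_pair r (s \<cdot> w) X J" using inverse_pair_comp[OF qs w] by simp
  then show "iso_mor C X J r" by (rule inverse_pair_iso_mor)
qed

lemma iso_mor_comp:
  assumes "iso_mor C X Y f" "iso_mor C Y Z g" "X \<in> Obj C" "Y \<in> Obj C" "Z \<in> Obj C"
  shows "iso_mor C X Z (g \<cdot> f)"
proof -
  obtain f' where f: "inverse_pair f f' X Y" using iso_mor_iff assms by blast
  obtain g' where g: "inverse_pair g g' Y Z" using iso_mor_iff assms by blast
  show ?thesis using inverse_pair_iso_mor[OF inverse_pair_comp[OF f g]] .
qed

text \<open>Conjugation by the isomorphism is additive and both preserves and reflects
  units.\<close>

lemma local_End_iso:
  assumes X: "local_End C X" and i: "X \<simeq> Y" shows "local_End C Y"
proof -
  from i obtain f g where fg: "inverse_pair f g X Y" by (rule iso_objE)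
  then have gf: "inverse_pair g f Y X" by (simp add: inverse_pair_def)
  note * = inverse_pairD[OF fg]
  have o: "X \<in> Obj C" "Y \<in> Obj C" using arrD[OF *(1)] by auto
  have conj: "iso_mor C X X (g \<cdot> (e \<cdot> f))" if ei: "iso_mor C Y Y e" for e
  proof -
    obtain e' where e: "inverse_pair e e' Y Y" using iffD1[OF iso_mor_iff[OF o(2,2)] ei] by blast
    show ?thesis using inverse_pair_iso_mor[OF inverse_pair_comp[OF inverse_pair_comp[OF fg e] gf]] .
  qed
  have conj2: "iso_mor C Y Y e" if e: "arr e Y Y" and ei: "iso_mor C X X (g \<cdot> (e \<cdot> f))" for e
  proof -
    obtain k where "inverse_pair (g \<cdot> (e \<cdot> f)) k X X" using iffD1[OF iso_mor_iff[OF o(1,1)] ei] by blast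
    from inverse_pair_comp[OF inverse_pair_comp[OF gf this] fg]
    have "iso_mor C Y Y (f \<cdot> (g \<cdot> (e \<cdot> f) \<cdot> g))" by (rule inverse_pair_iso_mor)
    also have "f \<cdot> (g \<cdot> (e \<cdot> f) \<cdot> g) = e"
      using assoc[OF *(2) arr_comp[OF arr_comp[OF *(1) e] *(2)] *(1)] assoc[OF arr_comp[OF *(1) e] *(2,1)]
        assoc[OF *(2,1) e] *(4) comp_id[OF e] comp_id(2)[OF arr_comp[OF *(1) e]] by simp
    finally show ?thesis .
  qed
  have "Idn Y \<noteq> 0"
  proof
    assume "Idn Y = 0"
    then have "f = 0" using comp_id(2)[OF *(1)] comp_zeroL[OF *(1)] by simp
    then show False using *(3) comp_zeroR[OF *(2)] local_EndD(2)[OF X] by simp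
  qed
  moreover have "iso_mor C Y Y a \<or> iso_mor C Y Y b" if a: "arr a Y Y" and b: "arr b Y Y" and ab: "iso_mor C Y Y (a + b)" for a b
  proof -
    have "g \<cdot> ((a + b) \<cdot> f) = g \<cdot> (a \<cdot> f) + g \<cdot> (b \<cdot> f)"
      using comp_addL[OF *(1) a b] comp_addR[OF arr_comp[OF *(1) a] arr_comp[OF *(1) b] *(2)] by simp
    then have "iso_mor C X X (g \<cdot> (a \<cdot> f) + g \<cdot> (b \<cdot> f))" using conj[OF ab] by simp
    then have "iso_mor C X X (g \<cdot> (a \<cdot> f)) \<or> iso_mor C X X (g \<cdot> (b \<cdot> f))"
      using local_EndD(3)[OF X arr_comp[OF arr_comp[OF *(1) a] *(2)] arr_comp[OF arr_comp[OF *(1) b] *(2)]] by blast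
    then show ?thesis using conj2 a b by blast
  qed
  ultimately show ?thesis using o by (auto simp: local_End_def arr_def)
qed

end

section \<open>Indecomposable summands and basic objects\<close>

locale krull_schmidt_triangulated_category = triangulated_category C
  for C :: "('o, 'm::ab_group_add, 'k::field, 'z) tri_cat_scheme" (structure) +
  assumes krull_schmidt: "krull_schmidt C"
begin

text \<open>The support contains all isomorphic copies of the indecomposable summands and forgets
  multiplicities. It determines \<open>add C Z\<close>, and it determines a basic object up to
  isomorphism, so later comparisons of objects become set equations.\<close>

definition supp :: "'o \<Rightarrow> 'o set" where
  "supp Z = {J. local_End C J \<and> retract J Z}"

lemma suppD: "J \<in> supp Z \<Longrightarrow> local_End C J" "J \<in> supp Z \<Longrightarrow> retract J Z" "J \<in> supp Z \<Longrightarrow> J \<in> Obj C"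
  using retract_Obj by (auto simp: supp_def)

lemma unit_retract:
  assumes "arr s J X" "arr r X J" "iso_mor C J J (r \<cdot> s)" shows "retract J X"
proof -
  have "J \<in> Obj C" using arrD(1)[OF assms(1)] .
  then obtain w where "inverse_pair (r \<cdot> s) w J J" using iso_mor_iff assms(3) by blast
  note w = inverse_pairD[OF this]
  show ?thesis unfolding retract_def
    using assms(1) arr_comp[OF assms(2) w(2)] assoc[OF assms(1,2) w(2)] w(3) by metis
qed

text \<open>The identity of \<open>J\<close> is a sum of composites J -> X i -> J. Locality makes
  one of them a unit, and \<open>J\<close> is a retract of that \<open>X i\<close>.\<close>

lemma supp_covered:
  assumes c: "covered n X s r Z" and J: "J \<in> supp Z"
  obtains i where "i < n" "J \<in> supp (X i)"
proof -
  obtain t q where tq: "arr t J Z" "arr q Z J" "q \<cdot> t = Idn J" using suppD(2)[OF J] by (rule retractE)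
  have a: "arr (s i) (X i) Z" "arr (r i) Z (X i)" if "i < n" for i using c that by (auto simp: covered_def)
  have Jo: "J \<in> Obj C" using suppD(3)[OF J] .
  have "iso_mor C J J (\<Sum>i<n. (q \<cdot> s i) \<cdot> (r i \<cdot> t))"
    using covered_comp[OF c tq(1,2)] tq(3) iso_mor_Idn[OF Jo] by simp
  then obtain i where i: "i < n" "iso_mor C J J ((q \<cdot> s i) \<cdot> (r i \<cdot> t))"
    using local_sum_unit[OF suppD(1)[OF J], of "{..<n}" "\<lambda>i. (q \<cdot> s i) \<cdot> (r i \<cdot> t)"]
      arr_comp[OF arr_comp[OF tq(1) a(2)] arr_comp[OF a(1) tq(2)]] by auto
  have "retract J (X i)"
    by (rule unit_retract[OF arr_comp[OF tq(1) a(2)] arr_comp[OF a(1) tq(2)] i(2)]) (rule i(1))+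
  then show thesis using that i(1) suppD(1)[OF J] by (simp add: supp_def)
qed

lemma supp_retract: "retract X Z \<Longrightarrow> supp X \<subseteq> supp Z"
  using retract_trans by (auto simp: supp_def)

lemma supp_iso: "X \<simeq> Y \<Longrightarrow> supp X = supp Y"
  using supp_retract iso_retract iso_obj_sym by blast

lemma supp_direct_sum:
  assumes "direct_sum C Xs Z" shows "supp Z = (\<Union>X\<in>set Xs. supp X)"
proof -
  from assms obtain s r where "biproduct Xs Z s r" by (rule direct_sumE)
  note 1 = biproductD[OF this]
  have "retract (Xs ! i) Z" if "i < length Xs" for i
    using 1(4,5,6) that unfolding retract_def by metis
  then have "supp X \<subseteq> supp Z" if "X \<in> set Xs" for X
    using supp_retract that by (metis in_set_conv_nth)
  moreover have "J \<in> (\<Union>X\<in>set Xs. supp X)" if "J \<in> supp Z" for J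
    using supp_covered[OF 1(3) that] nth_mem by blast
  ultimately show ?thesis by blast
qed

lemma supp_direct_sum2: "direct_sum C [A, B] Z \<Longrightarrow> supp Z = supp A \<union> supp B"
  using supp_direct_sum by fastforce

lemma supp_dsum: "A \<in> Obj C \<Longrightarrow> B \<in> Obj C \<Longrightarrow> supp (A \<oplus> B) = supp A \<union> supp B"
  using supp_direct_sum2 direct_sum_dsum by blast

lemma local_retract_iso:
  assumes "local_End C J" "local_End C X" "retract J X" shows "J \<simeq> X"
proof -
  note J = local_EndD[OF assms(1)] and X = local_EndD(1)[OF assms(2)]
  obtain s r where sr: "arr s J X" "arr r X J" "r \<cdot> s = Idn J" using assms(3) by (rule retractE)
  have "iso_mor C J X s"
    by (rule local_factor_iso(1)[OF assms(2) J(1,2) sr(1,2)]) (use sr(3) iso_mor_Idn[OF J(1)] in simp)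
  then show ?thesis unfolding iso_obj_def using J(1) X by blast
qed

lemma supp_local: 
  assumes "local_End C X" shows "supp X = {J. J \<simeq> X}"
proof -
  have "J \<simeq> X" if "J \<in> supp X" for J using local_retract_iso[OF suppD(1)[OF that] assms suppD(2)[OF that]] .
  moreover have "J \<in> supp X" if "J \<simeq> X" for J
    using that iso_retract local_End_iso[OF assms iso_obj_sym] by (simp add: supp_def)
  ultimately show ?thesis by blast
qed

lemma supp_iso_closed: "J \<in> supp Z \<Longrightarrow> J' \<simeq> J \<Longrightarrow> J' \<in> supp Z"
  using supp_local[OF suppD(1)] supp_retract[OF suppD(2)] by blast

lemma supp_self: "local_End C X \<Longrightarrow> X \<in> supp X"
  using supp_local iso_obj_refl local_EndD(1) by blast

lemma local_decomposition:
  assumes "Z \<in> Obj C" obtains Xs where "direct_sum C Xs Z" "\<And>X. X \<in> set Xs \<Longrightarrow> local_End C X"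
  using krull_schmidt assms unfolding krull_schmidt_def by blast

text \<open>\<open>Z\<close> is a sum of members of \<open>supp Z\<close>, and each of these is a
  retract of \<open>Z\<close>. Membership can thus be tested one indecomposable at a time.\<close>

lemma mem_subcategory_iff:
  assumes S: "subcategory C S" and Z: "Z \<in> Obj C" shows "Z \<in> S \<longleftrightarrow> supp Z \<subseteq> S"
proof
  assume "Z \<in> S" then show "supp Z \<subseteq> S" using subcategory_retract[OF S] suppD(2) by blast
next
  assume s: "supp Z \<subseteq> S"
  obtain Xs where Xs: "direct_sum C Xs Z" "\<And>X. X \<in> set Xs \<Longrightarrow> local_End C X" using local_decomposition[OF Z] by blast
  then have "set Xs \<subseteq> S" using s supp_self supp_direct_sum[OF Xs(1)] by blast
  then show "Z \<in> S" by (rule subcategory_direct_sum[OF S Xs(1)])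
qed

lemma subcategory_supp: "subcategory C {Z \<in> Obj C. supp Z \<subseteq> K}"
proof (rule subcategoryI)
  fix n X s r Z assume c: "covered n X s r Z" and X: "\<And>i. i < n \<Longrightarrow> X i \<in> {Z \<in> Obj C. supp Z \<subseteq> K}"
  have "supp Z \<subseteq> K" using supp_covered[OF c] X by blast
  then show "Z \<in> {Z \<in> Obj C. supp Z \<subseteq> K}" using c by (simp add: covered_def)
qed auto

lemma add_iff:
  assumes "T \<in> Obj C" shows "Z \<in> add C T \<longleftrightarrow> Z \<in> Obj C \<and> supp Z \<subseteq> supp T"
proof
  assume "Z \<in> add C T"
  then show "Z \<in> Obj C \<and> supp Z \<subseteq> supp T"
    using add_least[OF subcategory_supp[of "supp T"], of T] assms by blast
next
  assume z: "Z \<in> Obj C \<and> supp Z \<subseteq> supp T"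
  have "supp T \<subseteq> add C T" using mem_subcategory_iff[OF add_subcategory assms] assms add_self by blast
  then show "Z \<in> add C T" using mem_subcategory_iff[OF add_subcategory[OF assms]] z by blast
qed

lemma add_mono: "T \<in> Obj C \<Longrightarrow> T' \<in> Obj C \<Longrightarrow> supp T \<subseteq> supp T' \<Longrightarrow> add C T \<subseteq> add C T'"
  using add_iff by blast

text \<open>Sort the entries of a decomposition by \<open>P\<close>. Invariance of \<open>P\<close>
  under isomorphism makes the sorting of the list agree with that of the support.\<close>

lemma supp_partition:
  assumes Z: "Z \<in> Obj C" and P: "\<And>J J'. J \<simeq> J' \<Longrightarrow> P J \<longleftrightarrow> P J'"
  obtains A B where "direct_sum C [A, B] Z" "supp A = {J \<in> supp Z. P J}" "supp B = {J \<in> supp Z. \<not> P J}"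
proof -
  obtain Xs where Xs: "direct_sum C Xs Z" "\<And>X. X \<in> set Xs \<Longrightarrow> local_End C X" using local_decomposition[OF Z] by blast
  have "mset (filter P Xs @ filter (\<lambda>x. \<not> P x) Xs) = mset Xs" by simp
  from direct_sum_mset[OF Xs(1) this] 
  obtain A B where AB: "direct_sum C (filter P Xs) A" "direct_sum C (filter (\<lambda>x. \<not> P x) Xs) B" "direct_sum C [A, B] Z"
    by (rule direct_sum_append_split)
  have "J \<in> supp X \<Longrightarrow> P J = P X" if "X \<in> set Xs" for X J
    using supp_local[OF Xs(2)[OF that]] P by blast
  then have "supp A = {J \<in> supp Z. P J}" "supp B = {J \<in> supp Z. \<not> P J}"
    unfolding supp_direct_sum[OF AB(1)] supp_direct_sum[OF AB(2)] supp_direct_sum[OF Xs(1)] by auto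
  then show thesis using that AB(3) by blast
qed

lemma local_indecomposable:
  assumes X: "local_End C X" shows "indecomposable C X"
  unfolding indecomposable_def
proof (intro conjI allI impI)
  note Xo = local_EndD[OF X]
  show "X \<in> Obj C" using Xo(1) .
  show "\<not> zero_obj C X" using zero_objD(1) Xo(2) by blast
  fix A B assume "direct_sum C [A, B] X"
  then obtain i j p q where "biproduct2 A B X i j p q" by (rule direct_sum2E)
  note b = biproduct2D[OF this]
  have o: "A \<in> Obj C" "B \<in> Obj C" using arrD(1) b by auto
  note ip = arr_comp[OF b(3,1)] and jq = arr_comp[OF b(4,2)]
  have "iso_mor C X X (i \<cdot> p + j \<cdot> q)" using b(9) iso_mor_Idn[OF Xo(1)] by simp
  then consider "iso_mor C X X (i \<cdot> p)" | "iso_mor C X X (j \<cdot> q)" using Xo(3)[OF ip jq] by blast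
  then show "zero_obj C A \<or> zero_obj C B"
  proof cases
    case 1
    then have "i \<cdot> p = Idn X" using unit_idempotent[OF Xo(1)] comp4_cancel[OF b(3,1,3,1,5)] by blast
    then have "q = 0" using assoc[OF b(3,1,4)] b(7) comp_zeroL[OF b(3)] comp_id(1)[OF b(4)] by simp
    then have "Idn B = 0" using b(6) comp_zeroL[OF b(2)] by simp
    then show ?thesis using zero_objI[OF o(2)] by blast
  next
    case 2
    then have "j \<cdot> q = Idn X" using unit_idempotent[OF Xo(1)] comp4_cancel[OF b(4,2,4,2,6)] by blast
    then have "p = 0" using assoc[OF b(4,2,3)] b(8) comp_zeroL[OF b(4)] comp_id(1)[OF b(3)] by simp
    then have "Idn A = 0" using b(5) comp_zeroL[OF b(1)] by simp
    then show ?thesis using zero_objI[OF o(1)] by blast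
  qed
qed

lemma supp_empty_zero:
  assumes "Z \<in> Obj C" "supp Z = {}" shows "zero_obj C Z"
proof -
  obtain Xs where Xs: "direct_sum C Xs Z" "\<And>X. X \<in> set Xs \<Longrightarrow> local_End C X" using local_decomposition[OF assms(1)] by blast
  have "Xs = []" using assms(2) supp_direct_sum[OF Xs(1)] supp_self[OF Xs(2)] by (cases Xs) auto
  then show ?thesis using Xs(1) direct_sum_Nil by simp
qed

text \<open>A nonzero object has a summand \<open>J\<close> with local endomorphism ring.
  Indecomposability makes its complement zero, so \<open>J\<close> is isomorphic to
  \<open>X\<close>.\<close>

lemma indecomposable_local:
  assumes X: "indecomposable C X" shows "local_End C X"
proof -
  have Xo: "X \<in> Obj C" and nz: "\<not> zero_obj C X" using X by (auto simp: indecomposable_def)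
  then obtain J where J: "J \<in> supp X" using supp_empty_zero by blast
  note Jl = local_EndD[OF suppD(1)[OF J]]
  obtain B where "direct_sum C [J, B] X" using suppD(2)[OF J] unfolding summand_iff_retract[symmetric] summand_def by blast
  then have "zero_obj C J \<or> zero_obj C B" using X unfolding indecomposable_def by blast
  then have B: "zero_obj C B" using zero_objD(1) Jl(2) by blast
  from \<open>direct_sum C [J, B] X\<close> obtain i j p q where "biproduct2 J B X i j p q" by (rule direct_sum2E)
  note b = biproduct2D[OF this]
  have "q = 0" using comp_id(2)[OF b(4)] zero_objD(1)[OF B] comp_zeroL[OF b(4)] by simp
  then have "i \<cdot> p = Idn X" using b(9) comp_zeroR[OF b(2)] by simp
  then have "J \<simeq> X" using iso_objI[OF b(1,3,5)] by blast
  then show ?thesis using local_End_iso[OF suppD(1)[OF J]] by blast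
qed

lemma indecomposable_iff_local: "indecomposable C X \<longleftrightarrow> local_End C X"
  using indecomposable_local local_indecomposable by blast

text \<open>This says that two copies of \<open>J\<close> split off from \<open>Z\<close> together.
  Unlike a condition on one list of summands, it is independent of the decomposition and passes from
  a retract to the whole object, so \<open>basic\<close> is inherited by summands.\<close>

definition repeated_in :: "'o \<Rightarrow> 'o \<Rightarrow> bool" where
  "repeated_in J Z \<longleftrightarrow> local_End C J \<and> (\<exists>s t q r. arr s J Z \<and> arr t J Z \<and> arr q Z J \<and> arr r Z J \<and>
     q \<cdot> s = Idn J \<and> r \<cdot> t = Idn J \<and> q \<cdot> t = 0 \<and> r \<cdot> s = 0)"

text \<open>By locality \<open>r1 \<cdot> s1\<close> and \<open>r2 \<cdot> s2\<close> each have a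
  unit component, and both components pass through the only entry isomorphic to \<open>J\<close>.
  Hence \<open>r2 \<cdot> s1\<close> has a unit component there too; as the total is zero, a second
  entry would also have to be isomorphic to \<open>J\<close>.\<close>

lemma noniso_not_repeated:
  assumes d: "direct_sum C Xs Z" and ni: "noniso_indecomposables C Xs"
  shows "\<not> repeated_in J Z"
proof
  assume "repeated_in J Z"
  then obtain s1 s2 r1 r2 where J: "local_End C J" and s: "arr s1 J Z" "arr s2 J Z" "arr r1 Z J" "arr r2 Z J"
    and e: "r1 \<cdot> s1 = Idn J" "r2 \<cdot> s2 = Idn J" "r2 \<cdot> s1 = 0"
    unfolding repeated_in_def by blast
  note Jl = local_EndD[OF J]
  let ?n = "length Xs"
  from d obtain \<iota> \<pi> where "biproduct Xs Z \<iota> \<pi>" by (rule direct_sumE)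
  note b = biproductD[OF this]
  have loc: "local_End C (Xs ! i)" if "i < ?n" for i
    using ni that indecomposable_iff_local unfolding noniso_indecomposables_def by simp
  have uv: "arr (\<pi> i \<cdot> x) J (Xs ! i)" if "i < ?n" "arr x J Z" for i x using arr_comp[OF that(2) b(5)] that(1) by blast
  have vv: "arr (y \<cdot> \<iota> i) (Xs ! i) J" if "i < ?n" "arr y Z J" for i y using arr_comp[OF b(4) that(2)] that(1) by blast
  define F where "F y x i = (y \<cdot> \<iota> i) \<cdot> (\<pi> i \<cdot> x)" for x y i
  have Fa: "arr (F y x i) J J" if "i < ?n" "arr x J Z" "arr y Z J" for i x y
    unfolding F_def using arr_comp[OF uv vv] that by blast
  have sumF: "y \<cdot> x = (\<Sum>i<?n. F y x i)" if "arr x J Z" "arr y Z J" for x y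
    unfolding F_def using covered_comp[OF b(3) that] .
  have isoX: "J \<simeq> Xs ! i" if "i < ?n" "arr x J Z" "arr y Z J" "iso_mor C J J (F y x i)" for i x y
    using local_retract_iso[OF J loc unit_retract[OF uv vv]] that unfolding F_def by blast
  have uniq: "i = j" if "i < ?n" "j < ?n" "J \<simeq> Xs ! i" "J \<simeq> Xs ! j" for i j
    using ni that iso_obj_trans[OF iso_obj_sym[OF that(3)] that(4)] unfolding noniso_indecomposables_def by blast
  have ex: "\<exists>i<?n. iso_mor C J J (F y x i)" if "arr x J Z" "arr y Z J" "y \<cdot> x = Idn J" for x y
    using local_sum_unit[OF J, of "{..<?n}" "F y x"] Fa sumF[OF that(1,2)] that iso_mor_Idn[OF Jl(1)] by auto
  obtain i where i: "i < ?n" "iso_mor C J J (F r1 s1 i)" using ex[OF s(1,3) e(1)] by blast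
  obtain j where j: "j < ?n" "iso_mor C J J (F r2 s2 j)" using ex[OF s(2,4) e(2)] by blast
  have "i = j" using uniq isoX i j s by blast
  then have j2: "iso_mor C J J (F r2 s2 i)" using j(2) by simp
  have Xi: "Xs ! i \<in> Obj C" using local_EndD(1)[OF loc[OF i(1)]] .
  have "iso_mor C J (Xs ! i) (\<pi> i \<cdot> s1)"
    using local_factor_iso(1)[OF loc[OF i(1)] Jl(1,2) uv[OF i(1) s(1)] vv[OF i(1) s(3)]] i(2) F_def by simp
  moreover have "iso_mor C (Xs ! i) J (r2 \<cdot> \<iota> i)"
    using local_factor_iso(2)[OF loc[OF i(1)] Jl(1,2) uv[OF i(1) s(2)] vv[OF i(1) s(4)]] j2 F_def by simp
  ultimately have "iso_mor C J J (F r2 s1 i)" unfolding F_def using iso_mor_comp Jl(1) Xi by blast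
  then obtain k where "inverse_pair (F r2 s1 i) k J J" using iso_mor_iff Jl(1) by blast
  note k = inverse_pairD[OF this]
  have inv: "iso_mor C J J (- F r2 s1 i)"
    by (rule iso_morI[OF arr_minus[OF k(1)] arr_minus[OF k(2)]])
      (use comp_minusL[OF arr_minus[OF k(1)] k(2)] comp_minusR[OF k(1,2)] k(3)
           comp_minusL[OF arr_minus[OF k(2)] k(1)] comp_minusR[OF k(2,1)] k(4) in simp_all)
  \<comment> \<open>The components other than \<open>i\<close> add up to minus a unit, so locality
    finds a unit among them.\<close>
  have "(\<Sum>i<?n. F r2 s1 i) = F r2 s1 i + (\<Sum>l\<in>{..<?n} - {i}. F r2 s1 l)"
    using i(1) by (simp add: sum.remove)
  then have "(\<Sum>l\<in>{..<?n} - {i}. F r2 s1 l) = - F r2 s1 i"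
    using sumF[OF s(1,4)] e(3) by (simp add: eq_neg_iff_add_eq_0 add.commute)
  then have "\<exists>l\<in>{..<?n} - {i}. iso_mor C J J (F r2 s1 l)"
    using inv local_sum_unit[OF J, of "{..<?n} - {i}" "F r2 s1"] Fa s by auto
  then show False using uniq isoX i s by blast
qed

lemma not_repeated_noniso:
  assumes d: "direct_sum C Xs Z" and loc: "\<And>X. X \<in> set Xs \<Longrightarrow> local_End C X"
    and nr: "\<And>J. \<not> repeated_in J Z"
  shows "noniso_indecomposables C Xs"
  unfolding noniso_indecomposables_def
proof (intro conjI ballI allI impI notI)
  fix X assume "X \<in> set Xs" then show "indecomposable C X" using loc local_indecomposable by blast
next
  fix i j assume ij: "i < length Xs" "j < length Xs" "i \<noteq> j" "Xs ! i \<simeq> Xs ! j"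
  from d obtain \<iota> \<pi> where "biproduct Xs Z \<iota> \<pi>" by (rule direct_sumE)
  note b = biproductD[OF this]
  from ij(4) obtain f g where "inverse_pair f g (Xs ! i) (Xs ! j)" by (rule iso_objE)
  note fg = inverse_pairD[OF this]
  note i = b(4,5)[OF ij(1)] and j = b(4,5)[OF ij(2)]
  have "repeated_in (Xs ! i) Z" unfolding repeated_in_def
  proof (intro conjI exI)
    show "local_End C (Xs ! i)" using loc ij(1) by simp
    show "arr (\<iota> i) (Xs ! i) Z" "arr (\<pi> i) Z (Xs ! i)" using i .
    show "arr (\<iota> j \<cdot> f) (Xs ! i) Z" "arr (g \<cdot> \<pi> j) Z (Xs ! i)" using arr_comp[OF fg(1) j(1)] arr_comp[OF j(2) fg(2)] .
    show "\<pi> i \<cdot> \<iota> i = Idn (Xs ! i)" using b(6)[OF ij(1,1)] by simp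
    show "g \<cdot> \<pi> j \<cdot> (\<iota> j \<cdot> f) = Idn (Xs ! i)"
      using comp4_cancel[OF fg(1) j fg(2)] b(6)[OF ij(2,2)] fg(3) by simp
    show "\<pi> i \<cdot> (\<iota> j \<cdot> f) = 0"
      using assoc[OF fg(1) j(1) i(2)] b(6)[OF ij(2,1)] ij(3) comp_zeroL[OF fg(1)] by simp
    show "g \<cdot> \<pi> j \<cdot> \<iota> i = 0"
      using assoc[OF i(1) j(2) fg(2)] b(6)[OF ij(1,2)] ij(3) comp_zeroR[OF fg(2)] by simp
  qed
  then show False using nr by blast
qed

lemma basic_iff_not_repeated:
  assumes "Z \<in> Obj C" shows "basic C Z \<longleftrightarrow> (\<forall>J. \<not> repeated_in J Z)"
proof
  assume "basic C Z" then show "\<forall>J. \<not> repeated_in J Z"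
    unfolding basic_def using noniso_not_repeated by blast
next
  assume r: "\<forall>J. \<not> repeated_in J Z"
  obtain Xs where "direct_sum C Xs Z" "\<And>X. X \<in> set Xs \<Longrightarrow> local_End C X" using local_decomposition[OF assms] by blast
  then show "basic C Z" unfolding basic_def using not_repeated_noniso r by blast
qed

lemma basic_Obj: "basic C Z \<Longrightarrow> Z \<in> Obj C"
  unfolding basic_def using direct_sum_Obj by blast

lemma repeated_retract:
  assumes "repeated_in J A" "retract A Z" shows "repeated_in J Z"
proof -
  from assms(1) obtain s t q r where *: "local_End C J" "arr s J A" "arr t J A" "arr q A J" "arr r A J"
     "q \<cdot> s = Idn J" "r \<cdot> t = Idn J" "q \<cdot> t = 0" "r \<cdot> s = 0" unfolding repeated_in_def by blast
  from assms(2) obtain x y where xy: "arr x A Z" "arr y Z A" "y \<cdot> x = Idn A" by (rule retractE)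
  show ?thesis unfolding repeated_in_def
    using *(1) arr_comp[OF *(2) xy(1)] arr_comp[OF *(3) xy(1)] arr_comp[OF xy(2) *(4)] arr_comp[OF xy(2) *(5)]
      comp4_cancel[OF *(2) xy(1,2) *(4) xy(3)] comp4_cancel[OF *(3) xy(1,2) *(5) xy(3)]
      comp4_cancel[OF *(3) xy(1,2) *(4) xy(3)] comp4_cancel[OF *(2) xy(1,2) *(5) xy(3)] *(6-9) by metis
qed

lemma basic_retract: "basic C Z \<Longrightarrow> retract A Z \<Longrightarrow> basic C A"
  using basic_iff_not_repeated basic_Obj retract_Obj repeated_retract by blast

lemma basic_iso: "basic C Z \<Longrightarrow> Z \<simeq> Z' \<Longrightarrow> basic C Z'"
  using basic_retract iso_retract iso_obj_sym by blast

text \<open>A common indecomposable summand would occur twice in \<open>Z\<close>, once through each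
  injection. Conversely, disjoint supports exclude isomorphisms between entries of the two lists, so
  these can be concatenated.\<close>

lemma basic_direct_sum_iff:
  assumes d: "direct_sum C [A, B] Z"
  shows "basic C Z \<longleftrightarrow> basic C A \<and> basic C B \<and> supp A \<inter> supp B = {}"
proof -
  from d obtain i j p q where "biproduct2 A B Z i j p q" by (rule direct_sum2E)
  note b = biproduct2D[OF this]
  have ret: "retract A Z" "retract B Z" using b unfolding retract_def by blast+
  show ?thesis
  proof
    assume Z: "basic C Z"
    have "J \<notin> supp B" if JA: "J \<in> supp A" for J
    proof
      assume JB: "J \<in> supp B"
      obtain s r where 1: "arr s J A" "arr r A J" "r \<cdot> s = Idn J" using suppD(2)[OF JA] by (rule retractE)
      obtain t v where 2: "arr t J B" "arr v B J" "v \<cdot> t = Idn J" using suppD(2)[OF JB] by (rule retractE)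
      have "repeated_in J Z" unfolding repeated_in_def
        using suppD(1)[OF JA] arr_comp[OF 1(1) b(1)] arr_comp[OF 2(1) b(2)] arr_comp[OF b(3) 1(2)] arr_comp[OF b(4) 2(2)]
          comp4_cancel[OF 1(1) b(1,3) 1(2) b(5)] comp4_cancel[OF 2(1) b(2,4) 2(2) b(6)] 1(3) 2(3)
          comp4_zero[OF 2(1) b(2,3) 1(2) b(8)] comp4_zero[OF 1(1) b(1,4) 2(2) b(7)] by metis
      then show False using Z basic_iff_not_repeated basic_Obj by blast
    qed
    then show "basic C A \<and> basic C B \<and> supp A \<inter> supp B = {}" using basic_retract[OF Z] ret by blast
  next
    assume h: "basic C A \<and> basic C B \<and> supp A \<inter> supp B = {}"
    then obtain As Bs where As: "direct_sum C As A" "noniso_indecomposables C As"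
      and Bs: "direct_sum C Bs B" "noniso_indecomposables C Bs" unfolding basic_def by blast
    have supA: "X \<in> supp A" if "X \<in> set As" for X
      using that As supp_direct_sum[OF As(1)] supp_self indecomposable_local unfolding noniso_indecomposables_def by blast
    have supB: "X \<in> supp B" if "X \<in> set Bs" for X
      using that Bs supp_direct_sum[OF Bs(1)] supp_self indecomposable_local unfolding noniso_indecomposables_def by blast
    have cross: "\<not> X \<simeq> Y" "\<not> Y \<simeq> X" if "X \<in> set As" "Y \<in> set Bs" for X Y
      using supA[OF that(1)] supB[OF that(2)] h supp_iso_closed iso_obj_sym by blast+
    have "noniso_indecomposables C (As @ Bs)"
      unfolding noniso_indecomposables_def
    proof (intro conjI ballI allI impI)
      fix X assume "X \<in> set (As @ Bs)"
      then show "indecomposable C X" using As(2) Bs(2) by (auto simp: noniso_indecomposables_def)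
    next
      fix k l assume kl: "k < length (As @ Bs)" "l < length (As @ Bs)" "k \<noteq> l"
      let ?m = "length As"
      show "\<not> (As @ Bs) ! k \<simeq> (As @ Bs) ! l"
      proof (cases "k < ?m"; cases "l < ?m")
        assume c: "k < ?m" "l < ?m"
        then show ?thesis using As(2) kl by (simp add: noniso_indecomposables_def nth_append)
      next
        assume c: "k < ?m" "\<not> l < ?m"
        then show ?thesis using cross(1)[of "As ! k" "Bs ! (l - ?m)"] kl by (simp add: nth_append)
      next
        assume c: "\<not> k < ?m" "l < ?m"
        then show ?thesis using cross(2)[of "As ! l" "Bs ! (k - ?m)"] kl by (simp add: nth_append)
      next
        assume c: "\<not> k < ?m" "\<not> l < ?m"
        then have "k - ?m < length Bs" "l - ?m < length Bs" "k - ?m \<noteq> l - ?m" using kl by auto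
        then show ?thesis using Bs(2) c by (simp add: noniso_indecomposables_def nth_append)
      qed
    qed
    then show "basic C Z" unfolding basic_def using direct_sum_append[OF As(1) Bs(1) d] by blast
  qed
qed

lemma noniso_distinct: "noniso_indecomposables C Xs \<Longrightarrow> distinct Xs"
  unfolding noniso_indecomposables_def distinct_conv_nth
  using iso_obj_refl by (metis indecomposable_def nth_mem)

text \<open>Equal supports mean that the two lists represent the same isomorphism classes, each
  once. Matching partners by \<open>h\<close> turns one list into a permutation of the
  other.\<close>

lemma basic_supp_iso:
  assumes "basic C Z" "basic C Z'" and supp: "supp Z = supp Z'" shows "Z \<simeq> Z'"
proof -
  obtain Xs where Xs: "direct_sum C Xs Z" "noniso_indecomposables C Xs" using assms(1) unfolding basic_def by blast
  obtain Ys where Ys: "direct_sum C Ys Z'" "noniso_indecomposables C Ys" using assms(2) unfolding basic_def by blast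
  have locX: "local_End C X" if "X \<in> set Xs" for X using that Xs(2) indecomposable_local unfolding noniso_indecomposables_def by blast
  have locY: "local_End C X" if "X \<in> set Ys" for X using that Ys(2) indecomposable_local unfolding noniso_indecomposables_def by blast
  have XY: "\<exists>Y\<in>set Ys. X \<simeq> Y" if "X \<in> set Xs" for X
  proof -
    have "X \<in> supp Z'" using supp_self[OF locX[OF that]] supp_direct_sum[OF Xs(1)] that supp by blast
    then show ?thesis using supp_direct_sum[OF Ys(1)] supp_local[OF locY] by blast
  qed
  have YX: "\<exists>X\<in>set Xs. X \<simeq> Y" if "Y \<in> set Ys" for Y
  proof -
    have "Y \<in> supp Z" using supp_self[OF locY[OF that]] supp_direct_sum[OF Ys(1)] that supp by blast
    then show ?thesis using supp_direct_sum[OF Xs(1)] supp_local[OF locX] iso_obj_sym by blast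
  qed
  obtain h where h: "\<And>X. X \<in> set Xs \<Longrightarrow> h X \<in> set Ys \<and> X \<simeq> h X" using XY by metis
  have uniqX: "X = X'" if "X \<in> set Xs" "X' \<in> set Xs" "X \<simeq> X'" for X X'
    using that Xs(2) unfolding noniso_indecomposables_def by (metis in_set_conv_nth)
  have uniqY: "X = X'" if "X \<in> set Ys" "X' \<in> set Ys" "X \<simeq> X'" for X X'
    using that Ys(2) unfolding noniso_indecomposables_def by (metis in_set_conv_nth)
  have inj: "inj_on h (set Xs)"
  proof (rule inj_onI)
    fix X X' assume X: "X \<in> set Xs" "X' \<in> set Xs" "h X = h X'"
    have "X \<simeq> h X'" using h[OF X(1)] X(3) by simp
    then have "X \<simeq> X'" using h[OF X(2)] iso_obj_trans iso_obj_sym by blast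
    then show "X = X'" using uniqX X by blast
  qed
  have img: "h ` set Xs = set Ys"
  proof
    show "h ` set Xs \<subseteq> set Ys" using h by blast
    show "set Ys \<subseteq> h ` set Xs"
    proof
      fix Y assume Y: "Y \<in> set Ys"
      then obtain X where X: "X \<in> set Xs" "X \<simeq> Y" using YX by blast
      then have "h X \<simeq> Y" using h[OF X(1)] iso_obj_trans iso_obj_sym by blast
      then have "h X = Y" using uniqY h[OF X(1)] Y by blast
      then show "Y \<in> h ` set Xs" using X by blast
    qed
  qed
  have "distinct (map h Xs)" using inj noniso_distinct[OF Xs(2)] by (simp add: distinct_map)
  moreover have "set (map h Xs) = set Ys" using img by simp
  ultimately have m: "mset Ys = mset (map h Xs)"
    using noniso_distinct[OF Ys(2)] set_eq_iff_mset_eq_distinct by metis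
  have "direct_sum C (map h Xs) Z"
    by (rule direct_sum_iso_list[OF Xs(1)]) (use h in auto)
  then have "direct_sum C Ys Z" using direct_sum_mset m by blast
  then show ?thesis using direct_sum_iso Ys(1) by blast
qed

end

section \<open>Approximations and rigid objects\<close>

locale calabi_yau_category = krull_schmidt_triangulated_category C
  for C :: "('o, 'm::ab_group_add, 'k::field, 'z) tri_cat_scheme" (structure) +
  assumes hom_finite: "hom_finite C" and calabi_yau: "two_calabi_yau C"
begin

section \<open>Vanishing of Ext^1 and its symmetry\<close>

definition ext0 :: "'o \<Rightarrow> 'o \<Rightarrow> bool" where
  "ext0 X Y \<longleftrightarrow> X \<in> Obj C \<and> Y \<in> Obj C \<and> Hom X (sh Y) = {0}"

lemma ext0D: "ext0 X Y \<Longrightarrow> arr f X (sh Y) \<Longrightarrow> f = 0"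
  unfolding ext0_def using zero_arr by blast

lemma ext0I: "X \<in> Obj C \<Longrightarrow> Y \<in> Obj C \<Longrightarrow> (\<And>f. arr f X (sh Y) \<Longrightarrow> f = 0) \<Longrightarrow> ext0 X Y"
  unfolding ext0_def using Hom_trivialI sh_Obj by blast

lemma ext0_Obj: "ext0 X Y \<Longrightarrow> X \<in> Obj C" "ext0 X Y \<Longrightarrow> Y \<in> Obj C"
  by (auto simp: ext0_def)

lemma ext0_shD: 
  assumes "ext0 X Y" "arr f (sh X) (sh (sh Y))" shows "f = 0"
  using zero_arr[OF _ assms(2)] assms(1) Hom_shift_zero[of X "sh Y"] sh_Obj unfolding ext0_def by simp

text \<open>The Serre functor identifies \<open>Hom(Y, X[1])\<close> with the dual of \<open>Hom(X[1], Y[2])\<close>, which is zero.\<close>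

lemma ext0_sym:
  assumes e: "ext0 X Y" shows "ext0 Y X"
proof -
  have o: "X \<in> Obj C" "Y \<in> Obj C" using e ext0_Obj by auto
  let ?H = "Hom (sh X) (sh (sh Y))"
  obtain \<phi> where bij: "bij_betw \<phi> (Hom Y (sh X)) (dual_on (scal C) ?H)"
    using calabi_yau unfolding two_calabi_yau_def
    by (elim exE conjE) (drule bspec[OF _ o(2)], drule bspec[OF _ sh_Obj[OF o(1)]], elim conjE, rule that)
  have H: "?H = {0}" using e Hom_shift_zero[of X "sh Y"] sh_Obj o unfolding ext0_def by simp
  \<comment> \<open>Functionals on the zero space vanish at \<open>0\<close> and are
    \<open>undefined\<close> elsewhere, so the dual is a single point.\<close>
  have uniq: "\<xi> = \<zeta>" if d: "\<xi> \<in> dual_on (scal C) ?H" "\<zeta> \<in> dual_on (scal C) ?H" for \<xi> \<zeta>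
  proof (rule extensionalityI[of _ "{0}"])
    have z: "\<rho> 0 = 0" if "\<rho> \<in> dual_on (scal C) ?H" for \<rho>
    proof -
      have "\<rho> (0 + 0) = \<rho> 0 + \<rho> 0" using that unfolding dual_on_def H by blast
      then have "\<rho> 0 = \<rho> 0 + \<rho> 0" unfolding add_0_left .
      then show ?thesis unfolding add_cancel_right_right .
    qed
    show "\<xi> \<in> extensional {0}" "\<zeta> \<in> extensional {0}" using that unfolding dual_on_def H by blast+
    show "\<xi> x = \<zeta> x" if "x \<in> {0}" for x using z[OF d(1)] z[OF d(2)] that by simp
  qed
  show ?thesis
  proof (rule ext0I[OF o(2,1)])
    fix f assume "arr f Y (sh X)"
    then have m: "f \<in> Hom Y (sh X)" "0 \<in> Hom Y (sh X)" using arrD(3) arr_zero[OF o(2) sh_Obj[OF o(1)]] by auto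
    show "f = 0"
      by (rule inj_onD[OF bij_betw_imp_inj_on[OF bij] _ m])
        (rule uniq[OF bij_betw_apply[OF bij m(1)] bij_betw_apply[OF bij m(2)]])
  qed
qed

lemma subcategory_ext0_left: "V \<in> Obj C \<Longrightarrow> subcategory C {Z \<in> Obj C. ext0 Z V}"
proof -
  assume "V \<in> Obj C"
  then have "{Z \<in> Obj C. ext0 Z V} = {Z \<in> Obj C. Hom Z (sh V) = {0}}" by (auto simp: ext0_def)
  then show ?thesis using subcategory_Hom_zero_left sh_Obj \<open>V \<in> Obj C\<close> by simp
qed

lemma ext0_add_left: "ext0 R V \<Longrightarrow> R' \<in> add C R \<Longrightarrow> ext0 R' V"
  using add_least[OF subcategory_ext0_left, of V R] ext0_Obj by blast

lemma ext0_add_right: "ext0 V R \<Longrightarrow> R' \<in> add C R \<Longrightarrow> ext0 V R'"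
  using ext0_sym ext0_add_left by blast

lemma ext0_direct_sum_left:
  assumes "direct_sum C [A, B] Z" "ext0 A V" "ext0 B V" shows "ext0 Z V"
  using subcategory_direct_sum[OF subcategory_ext0_left[OF ext0_Obj(2)[OF assms(2)]] assms(1)] assms(2,3) ext0_Obj by auto

lemma ext0_direct_sum_right:
  "direct_sum C [A, B] Z \<Longrightarrow> ext0 V A \<Longrightarrow> ext0 V B \<Longrightarrow> ext0 V Z"
  using ext0_direct_sum_left ext0_sym by blast

lemma ext0_direct_sum_self:
  assumes "direct_sum C [A, B] Z" "ext0 A A" "ext0 A B" "ext0 B B" shows "ext0 Z Z"
  using assms ext0_direct_sum_left ext0_direct_sum_right ext0_sym by blast

lemma ext0_middle:
  assumes t: "tri A Z B u v w" and "ext0 A V" "ext0 B V" shows "ext0 Z V"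
proof (rule ext0I)
  show "Z \<in> Obj C" "V \<in> Obj C" using tri_arr(2)[OF t] ext0_Obj assms by auto
  fix f assume f: "arr f Z (sh V)"
  have "f \<cdot> u = 0" using ext0D[OF assms(2)] arr_comp[OF tri_arr(4)[OF t] f] by blast
  then obtain g where g: "arr g B (sh V)" "f = g \<cdot> v" using tri_ext1[OF t f] by blast
  then show "f = 0" using ext0D[OF assms(3) g(1)] comp_zeroL[OF tri_arr(5)[OF t]] by simp
qed

lemma ext0_sh: "ext0 X Y \<Longrightarrow> ext0 (sh X) (sh Y)"
  using Hom_shift_zero[of X "sh Y"] sh_Obj unfolding ext0_def by simp

text \<open>Take one copy of \<open>R\<close> for each member of a finite spanning list of
  \<open>Hom R M\<close>, and let the list be the components of \<open>u\<close>. Maps from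
  \<open>R\<close> that factor through \<open>u\<close> form a subspace containing the span; objects
  all of whose maps to \<open>M\<close> factor form a subcategory, so it contains
  \<open>add C R\<close>.\<close>

lemma right_approximation:
  assumes R: "R \<in> Obj C" and M: "M \<in> Obj C"
  obtains r u where "r \<in> add C R" "arr u r M"
    "\<And>r' g. r' \<in> add C R \<Longrightarrow> arr g r' M \<Longrightarrow> \<exists>h. arr h r' r \<and> g = u \<cdot> h"
proof -
  interpret vs: vector_space "scal C" by (rule vector_space_scal)
  obtain B where B: "finite B" "vs.span B = Hom R M" using hom_finite R M unfolding hom_finite_def by blast
  obtain bs where bs: "set bs = B" using finite_list[OF B(1)] by blast
  have ba: "arr b R M" if "b \<in> B" for b
    using vs.span_superset[of B] that B(2) R M arrI by blast
  let ?n = "length bs"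
  let ?Rs = "replicate ?n R"
  have "set ?Rs \<subseteq> Obj C" using R by auto
  then obtain D where D: "direct_sum C ?Rs D" using direct_sums_exist by blast
  then obtain \<iota> \<pi> where "biproduct ?Rs D \<iota> \<pi>" by (rule direct_sumE)
  note b = biproductD[OF this]
  have \<iota>: "arr (\<iota> i) R D" and \<pi>: "arr (\<pi> i) D R" if "i < ?n" for i using b(4,5)[of i] that by simp_all
  have DR: "D \<in> add C R" by (rule subcategory_direct_sum[OF add_subcategory[OF R] D]) (use add_self in auto)
  define u where "u = (\<Sum>i<?n. bs ! i \<cdot> \<pi> i)"
  have bp: "arr (bs ! i \<cdot> \<pi> i) D M" if "i < ?n" for i using arr_comp[OF \<pi> ba] bs that nth_mem by blast
  have u: "arr u D M" unfolding u_def by (rule arr_sum[OF b(1) M]) (use bp in simp)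
  have u\<iota>: "u \<cdot> \<iota> i = bs ! i" if i: "i < ?n" for i
  proof -
    have bi: "arr (bs ! i) R M" using ba bs i nth_mem by blast
    have "u \<cdot> \<iota> i = (\<Sum>j<?n. (bs ! j \<cdot> \<pi> j) \<cdot> \<iota> i)"
      unfolding u_def by (rule comp_sumL[OF \<iota>[OF i] M]) (use bp in simp)
    also have "\<dots> = (\<Sum>j<?n. if j = i then bs ! i else 0)"
    proof (rule sum.cong)
      fix j assume "j \<in> {..<?n}" then have j: "j < ?n" by simp
      have bj: "arr (bs ! j) R M" using ba bs j nth_mem by blast
      show "(bs ! j \<cdot> \<pi> j) \<cdot> \<iota> i = (if j = i then bs ! i else 0)"
        using assoc[OF \<iota>[OF i] \<pi>[OF j] bj] b(6)[of i j] i j comp_id(1)[OF bi] comp_zeroR[OF bj] by auto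
    qed simp
    finally show ?thesis using i by simp
  qed
  let ?F = "{g. \<exists>h. arr h R D \<and> g = u \<cdot> h}"
  have "vs.subspace ?F"
  proof (rule vs.subspaceI)
    show "0 \<in> ?F" using arr_zero[OF R b(1)] comp_zeroR[OF u] by force
    fix x y c assume x: "x \<in> ?F"
    then obtain h where h: "arr h R D" "x = u \<cdot> h" by blast
    have "scal C c x = u \<cdot> scal C c h" using comp_scal_right[of R D M h u c] h u unfolding arr_def by simp
    then show "scal C c x \<in> ?F" using arr_scal[OF h(1)] by blast
    assume "y \<in> ?F"
    then obtain k where k: "arr k R D" "y = u \<cdot> k" by blast
    then have "x + y = u \<cdot> (h + k)" using h comp_addR[OF h(1) k(1) u] by simp
    then show "x + y \<in> ?F" using arr_add[OF h(1) k(1)] by blast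
  qed
  moreover have "B \<subseteq> ?F"
  proof
    fix x assume "x \<in> B"
    then obtain i where "i < ?n" "x = bs ! i" using bs by (metis in_set_conv_nth)
    then show "x \<in> ?F" using u\<iota> \<iota> by force
  qed
  ultimately have F: "Hom R M \<subseteq> ?F" using vs.span_minimal B(2) by blast
  let ?S = "{r' \<in> Obj C. \<forall>g. arr g r' M \<longrightarrow> (\<exists>h. arr h r' D \<and> g = u \<cdot> h)}"
  have "subcategory C ?S"
  proof (rule subcategoryI)
    fix n X s r Z assume c: "covered n X s r Z" and X: "\<And>i. i < n \<Longrightarrow> X i \<in> ?S"
    have Z: "Z \<in> Obj C" using c by (simp add: covered_def)
    have a: "arr (s i) (X i) Z" "arr (r i) Z (X i)" if "i < n" for i using c that by (auto simp: covered_def)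
    have "\<exists>h. arr h Z D \<and> g = u \<cdot> h" if g: "arr g Z M" for g
    proof -
      have "\<forall>i<n. \<exists>h. arr h (X i) D \<and> g \<cdot> s i = u \<cdot> h" using X arr_comp[OF a(1) g] by blast
      then obtain h where h: "\<And>i. i < n \<Longrightarrow> arr (h i) (X i) D" "\<And>i. i < n \<Longrightarrow> g \<cdot> s i = u \<cdot> h i" by metis
      have hr: "arr (h i \<cdot> r i) Z D" if "i < n" for i using arr_comp[OF a(2) h(1)] that by blast
      have gs: "(g \<cdot> s i) \<cdot> (r i \<cdot> Idn Z) = u \<cdot> (h i \<cdot> r i)" if "i < n" for i
        using h(2)[OF that] assoc[OF a(2)[OF that] h(1)[OF that] u] comp_id(1)[OF a(2)[OF that]] by simp
      have "g = (\<Sum>i<n. (g \<cdot> s i) \<cdot> (r i \<cdot> Idn Z))"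
        using covered_comp[OF c arr_Idn[OF Z] g] comp_id(1)[OF g] by simp
      also have "\<dots> = (\<Sum>i<n. u \<cdot> (h i \<cdot> r i))" using gs by simp
      also have "\<dots> = u \<cdot> (\<Sum>i<n. h i \<cdot> r i)"
        using comp_sumR[OF u Z, of "{..<n}" "\<lambda>i. h i \<cdot> r i"] hr by simp
      finally show ?thesis using arr_sum[OF Z b(1), of "{..<n}" "\<lambda>i. h i \<cdot> r i"] hr by auto
    qed
    then show "Z \<in> ?S" using Z by blast
  qed auto
  moreover have "R \<in> ?S" using R F arrD(3) by blast
  ultimately have S: "add C R \<subseteq> ?S" by (rule add_least)
  show thesis by (rule that[OF DR u]) (use S in blast)
qed

text \<open>The dual construction: a spanning list of \<open>Hom M R\<close> gives the components of
  one map from \<open>M\<close> into a sum of copies of \<open>R\<close>.\<close>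

lemma left_approximation:
  assumes R: "R \<in> Obj C" and M: "M \<in> Obj C"
  obtains r u where "r \<in> add C R" "arr u M r"
    "\<And>r' g. r' \<in> add C R \<Longrightarrow> arr g M r' \<Longrightarrow> \<exists>h. arr h r r' \<and> g = h \<cdot> u"
proof -
  interpret vs: vector_space "scal C" by (rule vector_space_scal)
  obtain B where B: "finite B" "vs.span B = Hom M R" using hom_finite R M unfolding hom_finite_def by blast
  obtain bs where bs: "set bs = B" using finite_list[OF B(1)] by blast
  have ba: "arr b M R" if "b \<in> B" for b
    using vs.span_superset[of B] that B(2) R M arrI by blast
  let ?n = "length bs"
  let ?Rs = "replicate ?n R"
  have "set ?Rs \<subseteq> Obj C" using R by auto
  then obtain D where D: "direct_sum C ?Rs D" using direct_sums_exist by blast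
  then obtain \<iota> \<pi> where "biproduct ?Rs D \<iota> \<pi>" by (rule direct_sumE)
  note b = biproductD[OF this]
  have \<iota>: "arr (\<iota> i) R D" and \<pi>: "arr (\<pi> i) D R" if "i < ?n" for i using b(4,5)[of i] that by simp_all
  have DR: "D \<in> add C R" by (rule subcategory_direct_sum[OF add_subcategory[OF R] D]) (use add_self in auto)
  define u where "u = (\<Sum>i<?n. \<iota> i \<cdot> bs ! i)"
  have bp: "arr (\<iota> i \<cdot> bs ! i) M D" if "i < ?n" for i using arr_comp[OF ba \<iota>] bs that nth_mem by blast
  have u: "arr u M D" unfolding u_def by (rule arr_sum[OF M b(1)]) (use bp in simp)
  have u\<pi>: "\<pi> i \<cdot> u = bs ! i" if i: "i < ?n" for i
  proof -
    have bi: "arr (bs ! i) M R" using ba bs i nth_mem by blast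
    have "\<pi> i \<cdot> u = (\<Sum>j<?n. \<pi> i \<cdot> (\<iota> j \<cdot> bs ! j))"
      unfolding u_def by (rule comp_sumR[OF \<pi>[OF i] M]) (use bp in simp)
    also have "\<dots> = (\<Sum>j<?n. if j = i then bs ! i else 0)"
    proof (rule sum.cong)
      fix j assume "j \<in> {..<?n}" then have j: "j < ?n" by simp
      have bj: "arr (bs ! j) M R" using ba bs j nth_mem by blast
      show "\<pi> i \<cdot> (\<iota> j \<cdot> bs ! j) = (if j = i then bs ! i else 0)"
        using assoc[OF bj \<iota>[OF j] \<pi>[OF i]] b(6)[of j i] i j comp_id(2)[OF bi] comp_zeroL[OF bj] by auto
    qed simp
    finally show ?thesis using i by simp
  qed
  let ?F = "{g. \<exists>h. arr h D R \<and> g = h \<cdot> u}"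
  have "vs.subspace ?F"
  proof (rule vs.subspaceI)
    show "0 \<in> ?F" using arr_zero[OF b(1) R] comp_zeroL[OF u] by force
    fix x y c assume x: "x \<in> ?F"
    then obtain h where h: "arr h D R" "x = h \<cdot> u" by blast
    have "scal C c x = scal C c h \<cdot> u" using comp_scal_left[of M D R u h c] h u unfolding arr_def by simp
    then show "scal C c x \<in> ?F" using arr_scal[OF h(1)] by blast
    assume "y \<in> ?F"
    then obtain k where k: "arr k D R" "y = k \<cdot> u" by blast
    then have "x + y = (h + k) \<cdot> u" using h comp_addL[OF u h(1) k(1)] by simp
    then show "x + y \<in> ?F" using arr_add[OF h(1) k(1)] by blast
  qed
  moreover have "B \<subseteq> ?F"
  proof
    fix x assume "x \<in> B"
    then obtain i where "i < ?n" "x = bs ! i" using bs by (metis in_set_conv_nth)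
    then show "x \<in> ?F" using u\<pi> \<pi> by force
  qed
  ultimately have F: "Hom M R \<subseteq> ?F" using vs.span_minimal B(2) by blast
  let ?S = "{r' \<in> Obj C. \<forall>g. arr g M r' \<longrightarrow> (\<exists>h. arr h D r' \<and> g = h \<cdot> u)}"
  have "subcategory C ?S"
  proof (rule subcategoryI)
    fix n X s r Z assume c: "covered n X s r Z" and X: "\<And>i. i < n \<Longrightarrow> X i \<in> ?S"
    have Z: "Z \<in> Obj C" using c by (simp add: covered_def)
    have a: "arr (s i) (X i) Z" "arr (r i) Z (X i)" if "i < n" for i using c that by (auto simp: covered_def)
    have "\<exists>h. arr h D Z \<and> g = h \<cdot> u" if g: "arr g M Z" for g
    proof -
      have "\<forall>i<n. \<exists>h. arr h D (X i) \<and> r i \<cdot> g = h \<cdot> u" using X arr_comp[OF g a(2)] by blast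
      then obtain h where h: "\<And>i. i < n \<Longrightarrow> arr (h i) D (X i)" "\<And>i. i < n \<Longrightarrow> r i \<cdot> g = h i \<cdot> u" by metis
      have sh': "arr (s i \<cdot> h i) D Z" if "i < n" for i using arr_comp[OF h(1) a(1)] that by blast
      have gs: "(Idn Z \<cdot> s i) \<cdot> (r i \<cdot> g) = (s i \<cdot> h i) \<cdot> u" if "i < n" for i
        using h(2)[OF that] assoc[OF u h(1)[OF that] a(1)[OF that]] comp_id(2)[OF a(1)[OF that]] by simp
      have "g = (\<Sum>i<n. (Idn Z \<cdot> s i) \<cdot> (r i \<cdot> g))"
        using covered_comp[OF c g arr_Idn[OF Z]] comp_id(2)[OF g] by simp
      also have "\<dots> = (\<Sum>i<n. (s i \<cdot> h i) \<cdot> u)" using gs by simp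
      also have "\<dots> = (\<Sum>i<n. s i \<cdot> h i) \<cdot> u"
        using comp_sumL[OF u Z, of "{..<n}" "\<lambda>i. s i \<cdot> h i"] sh' by simp
      finally show ?thesis using arr_sum[OF b(1) Z, of "{..<n}" "\<lambda>i. s i \<cdot> h i"] sh' by auto
    qed
    then show "Z \<in> ?S" using Z by blast
  qed auto
  moreover have "R \<in> ?S" using R F arrD(3) by blast
  ultimately have S: "add C R \<subseteq> ?S" by (rule add_least)
  show thesis by (rule that[OF DR u]) (use S in blast)
qed

lemma functorially_finite_add:
  assumes R: "R \<in> Obj C" and "\<X> \<subseteq> Obj C" shows "functorially_finite_in C \<X> (add C R)"
  unfolding functorially_finite_in_def contravariantly_finite_in_def covariantly_finite_in_def
proof (intro conjI ballI)
  fix M assume "M \<in> \<X>"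
  then have M: "M \<in> Obj C" using assms by blast
  have o: "r \<in> Obj C" if "r \<in> add C R" for r using add_iff[OF R] that by blast
  obtain r u where 1: "r \<in> add C R" "arr u r M"
    "\<And>r' g. r' \<in> add C R \<Longrightarrow> arr g r' M \<Longrightarrow> \<exists>h. arr h r' r \<and> g = u \<cdot> h" using right_approximation[OF R M] by blast
  show "\<exists>D\<in>add C R. \<exists>f\<in>Hom D M. \<forall>D'\<in>add C R. \<forall>g\<in>Hom D' M. \<exists>h\<in>Hom D' D. g = f \<cdot> h"
  proof (rule bexI[of _ r], rule bexI[of _ u], intro ballI)
    fix D' g assume "D' \<in> add C R" "g \<in> Hom D' M"
    then show "\<exists>h\<in>Hom D' r. g = u \<cdot> h" using 1(3)[of D' g] o M unfolding arr_def by blast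
  qed (use 1 arrD(3) in auto)
  obtain r u where 2: "r \<in> add C R" "arr u M r"
    "\<And>r' g. r' \<in> add C R \<Longrightarrow> arr g M r' \<Longrightarrow> \<exists>h. arr h r r' \<and> g = h \<cdot> u" using left_approximation[OF R M] by blast
  show "\<exists>D\<in>add C R. \<exists>f\<in>Hom M D. \<forall>D'\<in>add C R. \<forall>g\<in>Hom M D'. \<exists>h\<in>Hom D D'. g = h \<cdot> f"
  proof (rule bexI[of _ r], rule bexI[of _ u], intro ballI)
    fix D' g assume "D' \<in> add C R" "g \<in> Hom M D'"
    then show "\<exists>h\<in>Hom r D'. g = h \<cdot> u" using 2(3)[of D' g] o M unfolding arr_def by blast
  qed (use 2 arrD(3) in auto)
qed

text \<open>A map from \<open>add C R\<close> to \<open>W\<close> becomes zero in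
  \<open>sh r\<close> by rigidity, so it lifts to \<open>M\<close>; there it factors through the
  approximation \<open>u\<close>, and \<open>v \<cdot> u = 0\<close>.\<close>

lemma approximation_triangle:
  assumes R: "ext0 R R" and M: "M \<in> Obj C"
  obtains r W u v w where "r \<in> add C R" "tri r M W u v w"
    "\<And>r' f. r' \<in> add C R \<Longrightarrow> arr f r' W \<Longrightarrow> f = 0"
proof -
  obtain r u where 1: "r \<in> add C R" "arr u r M"
    "\<And>r' g. r' \<in> add C R \<Longrightarrow> arr g r' M \<Longrightarrow> \<exists>h. arr h r' r \<and> g = u \<cdot> h"
    using right_approximation[OF ext0_Obj(1)[OF R] M] by blast
  obtain W v w where t: "tri r M W u v w" using tri_cone[OF arrD[OF 1(2)]] by blast
  note a = tri_arr[OF t]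
  have "f = 0" if r': "r' \<in> add C R" and f: "arr f r' W" for r' f
  proof -
    have "ext0 r' r" using ext0_add_left[OF ext0_add_right[OF R 1(1)] r'] .
    then have "w \<cdot> f = 0" using ext0D arr_comp[OF f a(6)] by blast
    then obtain g where g: "arr g r' M" "f = v \<cdot> g" using tri_lift2[OF t f] by blast
    then obtain h where h: "arr h r' r" "g = u \<cdot> h" using 1(3)[OF r'] by blast
    show "f = 0" using g(2) h(2) assoc[OF h(1) a(4,5)] tri_comp_zero[OF t] comp_zeroL[OF h(1)] by simp
  qed
  then show thesis using that[OF 1(1) t] by blast
qed

text \<open>Cluster tilting without the demand of being basic, since the direct sums constructed
  below may repeat summands; see \<open>cluster_tilting_iff\<close>.\<close>

definition tilts :: "'o \<Rightarrow> bool" where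
  "tilts R \<longleftrightarrow> ext0 R R \<and> (\<forall>M. ext0 R M \<longrightarrow> M \<in> add C R)"

lemma tilts_Obj: "tilts R \<Longrightarrow> R \<in> Obj C"
  unfolding tilts_def using ext0_Obj by blast

lemma shift_subcat_sh: "b \<in> S \<Longrightarrow> b \<in> Obj C \<Longrightarrow> sh b \<in> shift_subcat C S"
  unfolding shift_subcat_def using iso_obj_refl sh_Obj by blast

lemma star_shiftE:
  assumes "Z \<in> star C \<X> (shift_subcat C \<Y>)"
  obtains a b u v w where "a \<in> \<X>" "b \<in> \<Y>" "tri a Z (sh b) u v w"
proof -
  obtain a B u v w where 1: "a \<in> \<X>" "B \<in> shift_subcat C \<Y>" "tri a Z B u v w" using assms unfolding star_def by blast
  obtain b where 2: "b \<in> \<Y>" "B \<simeq> sh b" using 1(2) unfolding shift_subcat_def by blast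
  show thesis using tri_replace3[OF 1(3) 2(2)] that[OF 1(1) 2(1)] by blast
qed

lemma star_shiftI:
  "a \<in> \<X> \<Longrightarrow> b \<in> \<Y> \<Longrightarrow> b \<in> Obj C \<Longrightarrow> tri a Z (sh b) u v w \<Longrightarrow> Z \<in> star C \<X> (shift_subcat C \<Y>)"
  unfolding star_def using shift_subcat_sh by blast

lemma Hom_zero_iso_right:
  assumes "Hom X Y = {0}" "Y \<simeq> Z" "X \<in> Obj C" shows "Hom X Z = {0}"
proof -
  have o: "Y \<in> Obj C" "Z \<in> Obj C" using assms(2) by (auto simp: iso_obj_def)
  then show ?thesis using assms subcategory_iso[OF subcategory_Hom_zero_right[OF assms(3)] iso_obj_sym[OF assms(2)]] by simp
qed

text \<open>The cone of an approximation is isomorphic to some \<open>sh V\<close>. Having no maps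
  from \<open>R\<close> means \<open>ext0 R V\<close>, and maximality puts \<open>V\<close> into
  \<open>add C R\<close>.\<close>

lemma tilts_cotorsion_pair:
  assumes R: "tilts R" shows "cotorsion_pair C (add C R) (add C R)"
  unfolding cotorsion_pair_def
proof (intro conjI)
  note Ro = tilts_Obj[OF R]
  have rig: "ext0 R R" using R by (simp add: tilts_def)
  show sub: "subcategory C (add C R)" "subcategory C (add C R)" using add_subcategory[OF Ro] by blast+
  show "Ext1_zero C (add C R) (add C R)" unfolding Ext1_zero_def
    using ext0_add_left[OF ext0_add_right[OF rig]] unfolding ext0_def by blast
  have "Z \<in> star C (add C R) (shift_subcat C (add C R))" if Z: "Z \<in> Obj C" for Z
  proof -
    obtain r W u v w where t: "r \<in> add C R" "tri r Z W u v w" "\<And>r' f. r' \<in> add C R \<Longrightarrow> arr f r' W \<Longrightarrow> f = 0"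
      using approximation_triangle[OF rig Z] by blast
    have W: "W \<in> Obj C" using tri_arr(3)[OF t(2)] .
    obtain V where V: "V \<in> Obj C" "W \<simeq> sh V" using sh_ess_surj[OF W] by blast
    have "Hom R W = {0}" using Hom_trivialI[OF Ro W] t(3)[OF add_self] by blast
    then have "ext0 R V" using Hom_zero_iso_right[OF _ V(2) Ro] V(1) Ro by (simp add: ext0_def)
    then have "V \<in> add C R" using R by (simp add: tilts_def)
    then show ?thesis using t(1,2) V(2) unfolding star_def shift_subcat_def by blast
  qed
  moreover have "star C (add C R) (shift_subcat C (add C R)) \<subseteq> Obj C"
    using tri_Obj unfolding star_def by blast
  ultimately show "Obj C = star C (add C R) (shift_subcat C (add C R))" by blast
qed

end

section \<open>The two halves of a cotorsion pair\<close>

locale cotorsion_pair_in_category = calabi_yau_category C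
  for C :: "('o, 'm::ab_group_add, 'k::field, 'z) tri_cat_scheme" (structure) +
  fixes \<X> \<Y> :: "'o set"
  assumes cotorsion: "cotorsion_pair C \<X> \<Y>"
begin

lemma subcategory_left: "subcategory C \<X>" and subcategory_right: "subcategory C \<Y>"
  using cotorsion by (simp_all add: cotorsion_pair_def)

lemma left_Obj: "x \<in> \<X> \<Longrightarrow> x \<in> Obj C" and right_Obj: "y \<in> \<Y> \<Longrightarrow> y \<in> Obj C"
  using subcategory_left subcategory_right subcategory_Obj by blast+

lemma ext0_left_right: "x \<in> \<X> \<Longrightarrow> y \<in> \<Y> \<Longrightarrow> ext0 x y"
  using cotorsion left_Obj right_Obj unfolding cotorsion_pair_def Ext1_zero_def ext0_def by blast

lemma ext0_right_left: "x \<in> \<X> \<Longrightarrow> y \<in> \<Y> \<Longrightarrow> ext0 y x"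
  using ext0_left_right ext0_sym by blast

lemma cotorsion_triangle:
  assumes "Z \<in> Obj C" obtains a b u v w where "a \<in> \<X>" "b \<in> \<Y>" "tri a Z (sh b) u v w"
proof -
  have "Z \<in> star C \<X> (shift_subcat C \<Y>)" using cotorsion assms unfolding cotorsion_pair_def by blast
  then show thesis using star_shiftE that by blast
qed

text \<open>Orthogonality kills the map from \<open>Z\<close> to \<open>sh b\<close>, so the
  identity of \<open>Z\<close> lifts to \<open>a\<close>.\<close>

lemma mem_left:
  assumes Z: "Z \<in> Obj C" and e: "\<And>y. y \<in> \<Y> \<Longrightarrow> ext0 Z y" shows "Z \<in> \<X>"
proof -
  obtain a b u v w where t: "a \<in> \<X>" "b \<in> \<Y>" "tri a Z (sh b) u v w" using cotorsion_triangle[OF Z] .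
  note r = tri_arr[OF t(3)]
  have "v \<cdot> Idn Z = 0" using ext0D[OF e[OF t(2)] r(5)] comp_id(1)[OF r(5)] by simp
  then obtain g where "arr g Z a" "Idn Z = u \<cdot> g" using tri_lift1[OF t(3) arr_Idn[OF Z]] by blast
  then have "retract Z a" using r(4) unfolding retract_def by metis
  then show ?thesis using subcategory_retract[OF subcategory_left] t(1) by blast
qed

text \<open>Decompose \<open>sh Z\<close> instead of \<open>Z\<close>: orthogonality kills the map
  from \<open>a\<close>, so \<open>sh Z\<close> is a retract of \<open>sh b\<close>, and this is
  unshifted.\<close>

lemma mem_right:
  assumes Z: "Z \<in> Obj C" and e: "\<And>x. x \<in> \<X> \<Longrightarrow> ext0 x Z" shows "Z \<in> \<Y>"
proof -
  obtain a b u v w where t: "a \<in> \<X>" "b \<in> \<Y>" "tri a (sh Z) (sh b) u v w" using cotorsion_triangle[OF sh_Obj[OF Z]] .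
  note r = tri_arr[OF t(3)]
  have bo: "b \<in> Obj C" using right_Obj t(2) .
  obtain v' where v': "arr v' Z b" "v = shm v'" using shm_lift[OF r(5) Z bo] .
  have "u = 0" using ext0D[OF e[OF t(1)] r(4)] .
  then have "Idn (sh Z) \<cdot> u = 0" using comp_zeroR[OF arr_Idn[OF r(2)]] by simp
  then obtain g where g: "arr g (sh b) (sh Z)" "Idn (sh Z) = g \<cdot> v" using tri_ext1[OF t(3) arr_Idn[OF r(2)]] by blast
  obtain g' where g': "arr g' b Z" "g = shm g'" using shm_lift[OF g(1) bo Z] .
  have "shm (g' \<cdot> v') = shm (Idn Z)" using shm_o[OF v'(1) g'(1)] g(2) g'(2) v'(2) shm_Idn[OF Z] by simp
  then have "g' \<cdot> v' = Idn Z" using shm_inject[OF arr_comp[OF v'(1) g'(1)] arr_Idn[OF Z]] by blast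
  then have "retract Z b" using v'(1) g'(1) unfolding retract_def by blast
  then show ?thesis using subcategory_retract[OF subcategory_right] t(2) by blast
qed

text \<open>A self-extension of \<open>a\<close> extends to \<open>T\<close>, because the
  obstruction lies in a shift of Ext^1(b, a) = 0. Rigidity of \<open>T\<close> then sends the
  extension through \<open>sh b\<close>, and its restriction to \<open>a\<close> dies in Ext^1(a, b)
  = 0. The argument for \<open>b\<close> is dual.\<close>

lemma rigid_parts:
  assumes T: "ext0 T T" and ab: "a \<in> \<X>" "b \<in> \<Y>" and t: "tri a T (sh b) i p d"
  shows "ext0 a a" "ext0 b b"
proof -
  note r = tri_arr[OF t]
  have o: "a \<in> Obj C" "b \<in> Obj C" using left_Obj[OF ab(1)] right_Obj[OF ab(2)] .
  show "ext0 a a"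
  proof (rule ext0I[OF o(1) o(1)])
    fix f assume f: "arr f a (sh a)"
    have "shm f \<cdot> d = 0"
      by (rule ext0_shD[OF ext0_right_left[OF ab]]) (rule arr_comp[OF r(6) arr_shm[OF f]])
    then obtain g where g: "arr g (sh T) (sh (sh a))" "shm f = g \<cdot> shm i" using tri_ext3[OF t arr_shm[OF f]] by blast
    obtain f' where f': "arr f' T (sh a)" "g = shm f'" using shm_lift[OF g(1) r(2) sh_Obj[OF o(1)]] .
    have "f = f' \<cdot> i" using shm_inject[OF f arr_comp[OF r(4) f'(1)]] shm_o[OF r(4) f'(1)] g(2) f'(2) by simp
    moreover have "shm i \<cdot> f' = 0" using ext0D[OF T] arr_comp[OF f'(1) arr_shm[OF r(4)]] by blast
    then obtain h where h: "arr h T (sh b)" "f' = d \<cdot> h" using tri_lift3[OF t f'(1)] by blast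
    moreover have "h \<cdot> i = 0" using ext0D[OF ext0_left_right[OF ab]] arr_comp[OF r(4) h(1)] by blast
    ultimately show "f = 0" using assoc[OF r(4) h(1) r(6)] comp_zeroR[OF r(6)] by simp
  qed
  show "ext0 b b"
  proof (rule ext0I[OF o(2) o(2)])
    fix f assume f: "arr f b (sh b)"
    note sf = arr_shm[OF f] and sp = arr_minus[OF arr_shm[OF r(5)]] and sd = arr_shm[OF r(6)]
    have "shm d \<cdot> shm f = 0"
      by (rule ext0_shD[OF ext0_right_left[OF ab]]) (rule arr_comp[OF sf sd])
    then have "(- shm d) \<cdot> shm f = 0" using comp_minusL[OF sf sd] by simp
    then obtain f' where f': "arr f' (sh b) (sh T)" "shm f = (- shm p) \<cdot> f'"
      using tri_lift2[OF tri_shift[OF t] sf] by blast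
    have "f' \<cdot> p = 0" using ext0D[OF T] arr_comp[OF r(5) f'(1)] by blast
    then obtain g where g: "arr g (sh a) (sh T)" "f' = g \<cdot> d" using tri_ext2[OF t f'(1)] by blast
    have "(- shm p) \<cdot> g = 0"
      by (rule ext0_shD[OF ext0_left_right[OF ab]]) (rule arr_comp[OF g(1) sp])
    then have "shm f = 0" using f'(2) g(2) assoc[OF r(6) g(1) sp] comp_zeroL[OF r(6)] by simp
    then show "f = 0" using shm_eq_0[OF f] by blast
  qed
qed

end

section \<open>Objects orthogonal to the core\<close>

context calabi_yau_category
begin

section \<open>Recognising and transferring the tilting property\<close>

lemma cotorsion_pair_tilts:
  assumes T: "T \<in> Obj C" and c: "cotorsion_pair C (add C T) (add C T)" shows "tilts T"
proof -
  interpret p: cotorsion_pair_in_category C "add C T" "add C T"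
    by unfold_locales (rule c)
  have "ext0 T T" using p.ext0_left_right[OF add_self add_self] .
  moreover have "M \<in> add C T" if "ext0 T M" for M
    using p.mem_right[OF ext0_Obj(2)[OF that]] ext0_add_left[OF that] by blast
  ultimately show ?thesis unfolding tilts_def by blast
qed

lemma cluster_tilting_iff: "cluster_tilting C T \<longleftrightarrow> basic C T \<and> tilts T"
  unfolding cluster_tilting_def using cotorsion_pair_tilts tilts_cotorsion_pair tilts_Obj by blast

text \<open>If a cluster tilting subcategory lies in the closure of \<open>add R * add R[1]\<close> under direct sums
  and summands, for a rigid object \<open>R\<close>, then \<open>R\<close> is cluster tilting as well. Let
  \<open>r \<rightarrow> M \<rightarrow> W\<close> be an approximation triangle and \<open>M \<rightarrow> t0 \<rightarrow> t1 \<rightarrow> M[1]\<close> a coresolution. The map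
  \<open>v: M \<rightarrow> W\<close> vanishes on the image of \<open>t1[-1]\<close>, hence factors through \<open>t0\<close>, and every composite
  \<open>M \<rightarrow> t0 \<rightarrow> W\<close> is zero.\<close>

lemma tilts_transfer:
  assumes T: "cotorsion_pair C \<T> \<T>" and R: "ext0 R R"
    and gen: "\<And>S. subcategory C S \<Longrightarrow> star C (add C R) (shift_subcat C (add C R)) \<subseteq> S \<Longrightarrow> \<T> \<subseteq> S"
  shows "tilts R"
proof -
  note Ro = ext0_Obj(1)[OF R]
  have Robj: "r \<in> Obj C" if "r \<in> add C R" for r using add_iff[OF Ro] that by blast
  have "M \<in> add C R" if M: "ext0 R M" for M
  proof -
    note Mo = ext0_Obj(2)[OF M]
    obtain r W u v w where r: "r \<in> add C R" and t: "tri r M W u v w"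
      and W0: "\<And>r' f. r' \<in> add C R \<Longrightarrow> arr f r' W \<Longrightarrow> f = 0"
      using approximation_triangle[OF R Mo] by blast
    note a = tri_arr[OF t]
    let ?Q = "{t0 \<in> Obj C. \<forall>m g. arr m M t0 \<longrightarrow> arr g t0 W \<longrightarrow> g \<cdot> m = 0}"
    have "subcategory C ?Q"
    proof (rule subcategoryI)
      fix n X s q Z assume c: "covered n X s q Z" and X: "\<And>i. i < n \<Longrightarrow> X i \<in> ?Q"
      have ca: "arr (s i) (X i) Z" "arr (q i) Z (X i)" if "i < n" for i using c that by (auto simp: covered_def)
      have "g \<cdot> m = 0" if m: "arr m M Z" and g: "arr g Z W" for m g
      proof -
        have "(g \<cdot> s i) \<cdot> (q i \<cdot> m) = 0" if "i < n" for i
          using X[OF that] arr_comp[OF m ca(2)[OF that]] arr_comp[OF ca(1)[OF that] g] by blast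
        then show ?thesis using covered_comp[OF c m g] by simp
      qed
      then show "Z \<in> ?Q" using c by (simp add: covered_def)
    qed auto
    moreover have "star C (add C R) (shift_subcat C (add C R)) \<subseteq> ?Q"
    proof
      fix t0 assume "t0 \<in> star C (add C R) (shift_subcat C (add C R))"
      then obtain r1 r2 i j k where r12: "r1 \<in> add C R" "r2 \<in> add C R" and t0: "tri r1 t0 (sh r2) i j k"
        by (rule star_shiftE)
      note b = tri_arr[OF t0]
      have "g \<cdot> m = 0" if m: "arr m M t0" and g: "arr g t0 W" for m g
      proof -
        \<comment> \<open>\<open>W\<close> receives no nonzero maps from \<open>add C R\<close>, so
          \<open>g\<close> factors through \<open>sh r2\<close>; there \<open>j \<cdot> m\<close>
          lies in Ext^1(M, r2) = 0.\<close>
        have "g \<cdot> i = 0" using W0[OF r12(1) arr_comp[OF b(4) g]] .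
        then obtain h where h: "arr h (sh r2) W" "g = h \<cdot> j" using tri_ext1[OF t0 g] by blast
        have "j \<cdot> m = 0" using ext0D[OF ext0_add_right[OF ext0_sym[OF M] r12(2)] arr_comp[OF m b(5)]] .
        then show ?thesis using h(2) assoc[OF m b(5) h(1)] comp_zeroR[OF h(1)] by simp
      qed
      then show "t0 \<in> ?Q" using b(2) by blast
    qed
    ultimately have Q: "\<T> \<subseteq> ?Q" by (rule gen)
    \<comment> \<open>Maps from the inverse shift of \<open>t1\<close> to \<open>M\<close> appear as
      maps from \<open>t1\<close> to \<open>sh M\<close>, since the shift has no chosen
      inverse.\<close>
    let ?P = "{t1 \<in> Obj C. \<forall>p. arr p t1 (sh M) \<longrightarrow> shm v \<cdot> p = 0}"
    note sv = arr_shm[OF a(5)]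
    have "subcategory C ?P"
    proof (rule subcategoryI)
      fix n X s q Z assume c: "covered n X s q Z" and X: "\<And>i. i < n \<Longrightarrow> X i \<in> ?P"
      have ca: "arr (s i) (X i) Z" "arr (q i) Z (X i)" if "i < n" for i using c that by (auto simp: covered_def)
      have "shm v \<cdot> p = 0" if p: "arr p Z (sh M)" for p
      proof (rule covered_zeroL[OF c arr_comp[OF p sv]])
        fix i assume i: "i < n"
        show "shm v \<cdot> p \<cdot> s i = 0"
          using X[OF i] arr_comp[OF ca(1)[OF i] p] assoc[OF ca(1)[OF i] p sv] by simp
      qed
      then show "Z \<in> ?P" using c by (simp add: covered_def)
    qed auto
    moreover have "star C (add C R) (shift_subcat C (add C R)) \<subseteq> ?P"
    proof
      fix t1 assume "t1 \<in> star C (add C R) (shift_subcat C (add C R))"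
      then obtain r1 r2 i j k where r12: "r1 \<in> add C R" "r2 \<in> add C R" and t1: "tri r1 t1 (sh r2) i j k"
        by (rule star_shiftE)
      note b = tri_arr[OF t1]
      have "shm v \<cdot> p = 0" if p: "arr p t1 (sh M)" for p
      proof -
        \<comment> \<open>Ext^1(r1, M) = 0 lets \<open>p\<close> factor through
          \<open>sh r2\<close>. Unshifted, the second factor followed by \<open>v\<close> maps
          \<open>r2\<close> to \<open>W\<close>, so it is zero.\<close>
        have "p \<cdot> i = 0" using ext0D[OF ext0_add_left[OF M r12(1)] arr_comp[OF b(4) p]] .
        then obtain h where h: "arr h (sh r2) (sh M)" "p = h \<cdot> j" using tri_ext1[OF t1 p] by blast
        obtain h' where h': "arr h' r2 M" "h = shm h'" using shm_lift[OF h(1) Robj[OF r12(2)] Mo] .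
        have "shm v \<cdot> h = 0"
          using W0[OF r12(2) arr_comp[OF h'(1) a(5)]] shm_o[OF h'(1) a(5)] h'(2) shm_zero[OF Mo] by simp
        then show ?thesis using h(2) assoc[OF b(5) h(1) sv] comp_zeroL[OF b(5)] by simp
      qed
      then show "t1 \<in> ?P" using b(2) by blast
    qed
    ultimately have P: "\<T> \<subseteq> ?P" by (rule gen)
    interpret p: cotorsion_pair_in_category C \<T> \<T> by unfold_locales (rule T)
    \<comment> \<open>The cotorsion triangle of \<open>sh M\<close> is the coresolution M -> t0 ->
      t1 in shifted form.\<close>
    obtain t1 t0 p q d where t01: "t1 \<in> \<T>" "t0 \<in> \<T>" and tt: "tri t1 (sh M) (sh t0) p q d"
      using p.cotorsion_triangle[OF sh_Obj[OF Mo]] .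
    note b = tri_arr[OF tt]
    have t0o: "t0 \<in> Obj C" using p.left_Obj[OF t01(2)] .
    have "shm v \<cdot> p = 0" using P t01(1) b(4) by blast
    then obtain g' where g': "arr g' (sh t0) (sh W)" "shm v = g' \<cdot> q" using tri_ext1[OF tt sv] by blast
    obtain g where g: "arr g t0 W" "g' = shm g" using shm_lift[OF g'(1) t0o a(3)] .
    obtain m where m: "arr m M t0" "q = shm m" using shm_lift[OF b(5) Mo t0o] .
    have "v = g \<cdot> m" using shm_inject[OF a(5) arr_comp[OF m(1) g(1)]] shm_o[OF m(1) g(1)] g'(2) g(2) m(2) by simp
    then have "v = 0" using Q t01(2) m(1) g(1) by blast
    then have "v \<cdot> Idn M = 0" using comp_zeroL[OF arr_Idn[OF Mo]] by simp
    then obtain h where "arr h M r" "Idn M = u \<cdot> h" using tri_lift1[OF t arr_Idn[OF Mo]] by blast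
    then have "retract M r" using a(4) unfolding retract_def by metis
    then show ?thesis using subcategory_retract[OF add_subcategory[OF Ro]] r by blast
  qed
  then show ?thesis using R unfolding tilts_def by blast
qed

lemma Hom_zero_iso_right_sh:
  assumes "X \<in> Obj C" "Hom X Y = {0}" "Y \<simeq> sh Z" "Z \<in> Obj C" shows "ext0 X Z"
  using Hom_zero_iso_right[OF assms(2,3,1)] assms by (simp add: ext0_def)

text \<open>Ext^1(R[1], M) is Hom(R, M) because the shift is fully faithful; writing
  \<open>M\<close> as a shift \<open>sh N\<close> turns it into Ext^1(R, N).\<close>

lemma tilts_sh:
  assumes R: "tilts R" shows "tilts (sh R)"
proof -
  note Ro = tilts_Obj[OF R]
  have "M \<in> add C (sh R)" if M: "ext0 (sh R) M" for M
  proof -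
    note Mo = ext0_Obj(2)[OF M]
    obtain N where N: "N \<in> Obj C" "M \<simeq> sh N" using sh_ess_surj[OF Mo] by blast
    have "Hom R M = {0}" using M Hom_shift_zero[OF Ro Mo] by (simp add: ext0_def)
    then have "ext0 R N" using Hom_zero_iso_right_sh[OF Ro _ N(2,1)] by blast
    then have "N \<in> add C R" using R by (simp add: tilts_def)
    moreover have "add C R \<subseteq> {Z \<in> Obj C. sh Z \<in> add C (sh R)}"
      by (rule add_least[OF subcategory_sh_vimage[OF add_subcategory[OF sh_Obj[OF Ro]]]]) (use Ro add_self in auto)
    ultimately show ?thesis using subcategory_iso[OF add_subcategory[OF sh_Obj[OF Ro]] N(2)] by blast
  qed
  moreover have "ext0 (sh R) (sh R)" using R ext0_sh by (simp add: tilts_def)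
  ultimately show ?thesis unfolding tilts_def by blast
qed

lemma direct_sum_parts_add:
  assumes "direct_sum C [A, B] Z" shows "A \<in> add C Z" "B \<in> add C Z"
  using add_iff[of Z] supp_direct_sum2[OF assms] direct_sum_Obj[OF assms] by auto

lemma direct_sum_sh_mem:
  assumes "direct_sum C [A, B] Z" "subcategory C S" "sh A \<in> S" "sh B \<in> S" shows "sh Z \<in> S"
proof -
  from assms(1) obtain s r where b: "biproduct [A, B] Z s r" by (rule direct_sumE)
  show ?thesis
    by (rule subcategory_covered[OF assms(2) covered_sh[OF biproductD(3)[OF b]]])
      (use assms(3,4) in \<open>auto simp: less_Suc_eq\<close>)
qed

lemma star_right:
  assumes R: "R \<in> Obj C" and "b \<in> add C R" shows "sh b \<in> star C (add C R) (shift_subcat C (add C R))"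
proof -
  have bo: "b \<in> Obj C" using add_iff[OF R] assms(2) by blast
  obtain Z0 where "zero_obj C Z0" using zero_obj_exists by blast
  then show ?thesis
    using star_shiftI[OF subcategory_zero[OF add_subcategory[OF R]] assms(2) bo tri_zero_first[OF sh_Obj[OF bo]]] by blast
qed

end

context cotorsion_pair_in_category
begin

section \<open>Morphisms from the right half to the left half\<close>

lemma tilts_split_triangle:
  assumes T: "tilts T" obtains a b where "a \<in> \<X>" "b \<in> \<Y>" "ext0 a a" "ext0 b b" "tilts (a \<oplus> b)"
proof -
  have Te: "ext0 T T" using T by (simp add: tilts_def)
  obtain a b i p d where ab: "a \<in> \<X>" "b \<in> \<Y>" and t: "tri a T (sh b) i p d"
    using cotorsion_triangle[OF tilts_Obj[OF T]] .
  note rig = rigid_parts[OF Te ab t]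
  have o: "a \<in> Obj C" "b \<in> Obj C" using ab left_Obj right_Obj by auto
  let ?R = "a \<oplus> b"
  have d: "direct_sum C [a, b] ?R" using direct_sum_dsum o by blast
  have R: "ext0 ?R ?R" using ext0_direct_sum_self[OF d rig(1) ext0_left_right[OF ab] rig(2)] .
  have "T \<in> star C (add C ?R) (shift_subcat C (add C ?R))"
    using star_shiftI[OF direct_sum_parts_add[OF d] o(2) t] .
  then have "add C T \<subseteq> S" if "subcategory C S" "star C (add C ?R) (shift_subcat C (add C ?R)) \<subseteq> S" for S
    using add_least[OF that(1)] that(2) by blast
  from tilts_transfer[OF tilts_cotorsion_pair[OF T] R this] have "tilts ?R" by blast
  then show thesis using that ab rig by blast
qed

text \<open>The ideal of morphisms that become zero in the quotient by the core.\<close>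

definition factors :: "'m \<Rightarrow> 'o \<Rightarrow> 'o \<Rightarrow> bool" where
  "factors f y x \<longleftrightarrow> (\<exists>J \<in> \<X> \<inter> \<Y>. \<exists>h k. arr h y J \<and> arr k J x \<and> f = k \<cdot> h)"

lemma core_subcategory: "subcategory C (\<X> \<inter> \<Y>)"
  using subcategory_Int subcategory_left subcategory_right by blast

lemma factors_zero:
  assumes "y \<in> Obj C" "x \<in> Obj C" shows "factors 0 y x"
proof -
  obtain Z0 where z: "zero_obj C Z0" using zero_obj_exists by blast
  have "Z0 \<in> \<X> \<inter> \<Y>" using subcategory_zero[OF core_subcategory z] .
  moreover have "Z0 \<in> Obj C" using zero_objD(2)[OF z] .
  ultimately show ?thesis unfolding factors_def
    using arr_zero[OF assms(1)] arr_zero[OF _ assms(2)] comp_zeroR[OF arr_zero[OF _ assms(2)]] by metis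
qed

lemma factors_add:
  assumes "factors f y x" "factors g y x" shows "factors (f + g) y x"
proof -
  obtain J h k where J: "J \<in> \<X> \<inter> \<Y>" "arr h y J" "arr k J x" "f = k \<cdot> h" using assms(1) unfolding factors_def by blast
  obtain J' h' k' where J': "J' \<in> \<X> \<inter> \<Y>" "arr h' y J'" "arr k' J' x" "g = k' \<cdot> h'" using assms(2) unfolding factors_def by blast
  have o: "J \<in> Obj C" "J' \<in> Obj C" using J J' arrD by auto
  let ?D = "J \<oplus> J'"
  have d: "direct_sum C [J, J'] ?D" using direct_sum_dsum o by blast
  have D: "?D \<in> \<X> \<inter> \<Y>" by (rule subcategory_direct_sum[OF core_subcategory d]) (use J J' in auto)
  from d obtain i j p q where "biproduct2 J J' ?D i j p q" by (rule direct_sum2E)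
  note b = biproduct2D[OF this]
  note ih = arr_comp[OF J(2) b(1)] and jh = arr_comp[OF J'(2) b(2)]
  note kp = arr_comp[OF b(3) J(3)] and kq = arr_comp[OF b(4) J'(3)]
  have "(k \<cdot> p + k' \<cdot> q) \<cdot> (i \<cdot> h + j \<cdot> h') = f + g"
    using comp_addL[OF arr_add[OF ih jh] kp kq] comp_addR[OF ih jh kp] comp_addR[OF ih jh kq]
      comp4_cancel[OF J(2) b(1,3) J(3) b(5)] comp4_zero[OF J'(2) b(2,3) J(3) b(8)]
      comp4_cancel[OF J'(2) b(2,4) J'(3) b(6)] comp4_zero[OF J(2) b(1,4) J'(3) b(7)] J(4) J'(4) by simp
  then show ?thesis unfolding factors_def using D arr_add[OF ih jh] arr_add[OF kp kq] by metis
qed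

lemma factors_comp_left:
  assumes "factors f y x" "arr g x z" shows "factors (g \<cdot> f) y z"
proof -
  obtain J h k where J: "J \<in> \<X> \<inter> \<Y>" "arr h y J" "arr k J x" "f = k \<cdot> h" using assms(1) unfolding factors_def by blast
  then have "g \<cdot> f = (g \<cdot> k) \<cdot> h" using assoc[OF J(2,3) assms(2)] by simp
  then show ?thesis unfolding factors_def using J arr_comp[OF J(3) assms(2)] by blast
qed

lemma factors_sum:
  assumes "y \<in> Obj C" "x \<in> Obj C" "\<And>i::nat. i < n \<Longrightarrow> factors (f i) y x" shows "factors (\<Sum>i<n. f i) y x"
  using assms(3)
proof (induction n)
  case 0
  then show ?case using factors_zero[OF assms(1,2)] by simp
next
  case (Suc n)
  then show ?case using factors_add[of "\<Sum>i<n. f i" y x "f n"] by simp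
qed

text \<open>A map into a covered object is a sum of maps through the covering objects, and sums stay
  in the ideal because core objects can be added. The property can therefore be tested on
  indecomposables.\<close>

lemma subcategory_factors:
  "subcategory C {x \<in> Obj C. \<forall>y\<in>\<Y>. \<forall>f. arr f y x \<longrightarrow> factors f y x}" (is "subcategory C ?S")
proof (rule subcategoryI)
  fix n X s r Z assume c: "covered n X s r Z" and X: "\<And>i. i < n \<Longrightarrow> X i \<in> ?S"
  have a: "arr (s i) (X i) Z" "arr (r i) Z (X i)" if "i < n" for i using c that by (auto simp: covered_def)
  have Z: "Z \<in> Obj C" using c by (simp add: covered_def)
  have "factors f y Z" if y: "y \<in> \<Y>" and f: "arr f y Z" for y f
  proof -
    have fs: "factors (s i \<cdot> (r i \<cdot> f)) y Z" if i: "i < n" for i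
      using factors_comp_left[OF _ a(1)[OF i]] X[OF i] arr_comp[OF f a(2)[OF i]] y by blast
    have "factors (\<Sum>i<n. s i \<cdot> (r i \<cdot> f)) y Z" by (rule factors_sum[OF right_Obj[OF y] Z fs])
    moreover have "(\<Sum>i<n. s i \<cdot> (r i \<cdot> f)) = f"
      using covered_comp[OF c f arr_Idn[OF Z]] comp_id(2)[OF f] comp_id(2)[OF a(1)] by (simp cong: sum.cong_simp)
    ultimately show ?thesis by simp
  qed
  then show "Z \<in> ?S" using Z by blast
qed auto

text \<open>The triangle \<open>a' \<rightarrow> a[1] \<rightarrow> i[1]\<close> realises the shift of \<open>a\<close> in the subfactor category of the core.\<close>

lemma shift_triangle:
  assumes a: "a \<in> \<X>" and t: "tri a' (sh a) (sh i) u p w" and "a' \<in> \<X>" "i \<in> \<Y>"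
  shows "i \<in> \<X>" "\<And>y f. y \<in> \<Y> \<Longrightarrow> arr f y a' \<Longrightarrow> factors f y a'"
proof -
  note r = tri_arr[OF t]
  have io: "i \<in> Obj C" and a'o: "a' \<in> Obj C" and ao: "a \<in> Obj C" using assms left_Obj right_Obj by auto
  show iX: "i \<in> \<X>"
  proof (rule mem_left[OF io])
    fix y assume y: "y \<in> \<Y>"
    show "ext0 i y"
    proof (rule ext0I[OF io right_Obj[OF y]])
      fix f assume f: "arr f i (sh y)"
      note sf = arr_shm[OF f]
      \<comment> \<open>By Ext^1(a, y) = 0 the shifted extension factors through
        \<open>sh a'\<close>, where Ext^1(a', y) = 0 kills it.\<close>
      have "shm f \<cdot> p = 0"
        by (rule ext0_shD[OF ext0_left_right[OF a y]]) (rule arr_comp[OF r(5) sf])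
      then obtain g where g: "arr g (sh a') (sh (sh y))" "shm f = g \<cdot> w" using tri_ext2[OF t sf] by blast
      have "g = 0" using ext0_shD[OF ext0_left_right[OF \<open>a' \<in> \<X>\<close> y] g(1)] .
      then show "f = 0" using shm_eq_0[OF f] g(2) comp_zeroL[OF r(6)] by simp
    qed
  qed
  fix y f assume y: "y \<in> \<Y>" and f: "arr f y a'"
  \<comment> \<open>Since Ext^1(y, a) = 0, the map \<open>shm f\<close> lifts along \<open>w\<close>
    to \<open>sh i\<close>; unshifting yields the factorisation through \<open>i\<close>.\<close>
  have "u \<cdot> f = 0" using ext0D[OF ext0_right_left[OF a y] arr_comp[OF f r(4)]] .
  then have "shm u \<cdot> shm f = 0" using shm_o[OF f r(4)] shm_zero[OF ao] by simp
  then obtain g where g: "arr g (sh y) (sh i)" "shm f = w \<cdot> g" using tri_lift3[OF t arr_shm[OF f]] by blast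
  obtain g' where g': "arr g' y i" "g = shm g'" using shm_lift[OF g(1) right_Obj[OF y] io] .
  obtain w' where w': "arr w' i a'" "w = shm w'" using shm_lift[OF r(6) io a'o] .
  have "f = w' \<cdot> g'" using shm_inject[OF f arr_comp[OF g'(1) w'(1)]] shm_o[OF g'(1) w'(1)] g(2) g'(2) w'(2) by simp
  then show "factors f y a'" unfolding factors_def using iX \<open>i \<in> \<Y>\<close> g'(1) w'(1) by blast
qed

text \<open>For \<open>a'\<close> the factorisation is supplied by \<open>shift_triangle\<close>. It
  reaches \<open>x\<close> through a map from an object \<open>s0\<close> whose summands lie in
  \<open>\<X>\<close> and in the support of \<open>?R\<close>: maps from \<open>\<Y>\<close> to
  \<open>x\<close> lift to \<open>s0\<close>, since the obstruction lies in an Ext^1 between the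
  halves.\<close>

lemma factors_through_core:
  assumes T: "\<exists>T. tilts T" and xX: "x \<in> \<X>" and yY: "y \<in> \<Y>" and f: "arr f y x"
  shows "factors f y x"
proof -
  obtain a b where ab: "a \<in> \<X>" "b \<in> \<Y>" and rig: "ext0 a a" "ext0 b b" and R: "tilts (a \<oplus> b)"
    using T tilts_split_triangle by blast
  have o: "a \<in> Obj C" "b \<in> Obj C" using ab left_Obj right_Obj by auto
  obtain a' i u p w where a'i: "a' \<in> \<X>" "i \<in> \<Y>" and t: "tri a' (sh a) (sh i) u p w"
    using cotorsion_triangle[OF sh_Obj[OF o(1)]] .
  note st = shift_triangle[OF ab(1) t a'i]
  have o': "a' \<in> Obj C" "i \<in> Obj C" using a'i left_Obj right_Obj by auto
  have a'a': "ext0 a' a'" using rigid_parts(1)[OF ext0_sh[OF rig(1)] a'i t] .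
  let ?N = "a' \<oplus> i"
  let ?R = "?N \<oplus> b"
  have d0: "direct_sum C [a', i] ?N" by (rule direct_sum_dsum[OF o'])
  have R0: "?N \<in> Obj C" using direct_sum_Obj(2)[OF d0] .
  have d: "direct_sum C [?N, b] ?R" by (rule direct_sum_dsum[OF R0 o(2)])
  have Ro: "?R \<in> Obj C" using direct_sum_Obj(2)[OF d] .
  have R0b: "ext0 ?N b"
    using ext0_direct_sum_left[OF d0 ext0_left_right[OF a'i(1) ab(2)] ext0_left_right[OF st(1) ab(2)]] .
  have R0R0: "ext0 ?N ?N"
    using ext0_direct_sum_self[OF d0 a'a' ext0_left_right[OF a'i] ext0_left_right[OF st(1) a'i(2)]] .
  have RR: "ext0 ?R ?R" using ext0_direct_sum_self[OF d R0R0 R0b rig(2)] .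
  have suppR: "supp ?R = supp a' \<union> supp i \<union> supp b" using supp_direct_sum2[OF d] supp_direct_sum2[OF d0] by simp
  have parts: "a' \<in> add C ?R" "i \<in> add C ?R" "b \<in> add C ?R" using add_iff[OF Ro] suppR o' o by auto
  \<comment> \<open>\<open>sh a\<close> is generated through the triangle \<open>t\<close>, and
    \<open>sh b\<close> through the trivial triangle, so \<open>?R\<close> generates a tilting
    object.\<close>
  have "add C (sh (a \<oplus> b)) \<subseteq> S"
    if S: "subcategory C S" "star C (add C ?R) (shift_subcat C (add C ?R)) \<subseteq> S" for S
  proof (rule add_least[OF S(1)])
    have "sh a \<in> S" using S(2) star_shiftI[OF parts(1,2) o'(2) t] by blast
    moreover have "sh b \<in> S" using S(2) star_right[OF Ro parts(3)] by blast
    ultimately show "sh (a \<oplus> b) \<in> S" using direct_sum_sh_mem[OF direct_sum_dsum[OF o] S(1)] by blast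
  qed
  from tilts_transfer[OF tilts_cotorsion_pair[OF tilts_sh[OF R]] RR this] have R': "tilts ?R" by blast
  interpret q: cotorsion_pair_in_category C "add C ?R" "add C ?R"
    by unfold_locales (rule tilts_cotorsion_pair[OF R'])
  have xo: "x \<in> Obj C" using left_Obj[OF xX] .
  obtain r0 r1 m v n where r01: "r0 \<in> add C ?R" "r1 \<in> add C ?R" and tx: "tri r0 x (sh r1) m v n"
    using q.cotorsion_triangle[OF xo] .
  note tr = tri_arr[OF tx]
  have r1o: "r1 \<in> Obj C" and r1s: "supp r1 \<subseteq> supp ?R" using r01(2) add_iff[OF Ro] by auto
  have "supp a' \<subseteq> \<X>" "supp i \<subseteq> \<X>" "supp b \<subseteq> \<Y>"
    using mem_subcategory_iff[OF subcategory_left] mem_subcategory_iff[OF subcategory_right] o o' a'i ab st(1) by auto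
  then have Rs: "J \<in> \<X> \<or> J \<in> \<Y>" if "J \<in> supp ?R" for J using suppR that by blast
  have iso_left: "J \<in> \<X> \<longleftrightarrow> J' \<in> \<X>" if "J \<simeq> J'" for J J'
    using subcategory_iso[OF subcategory_left] that iso_obj_sym[OF that] by blast
  obtain c e where ce: "direct_sum C [c, e] r1" "supp c = {J \<in> supp r1. J \<in> \<X>}" "supp e = {J \<in> supp r1. J \<notin> \<X>}"
    by (rule supp_partition[OF r1o, of "\<lambda>J. J \<in> \<X>", OF iso_left])
  have co: "c \<in> Obj C" "e \<in> Obj C" using direct_sum_Obj(1)[OF ce(1)] by auto
  have cX: "c \<in> \<X>" using mem_subcategory_iff[OF subcategory_left co(1)] ce(2) by blast
  have eY: "e \<in> \<Y>" using mem_subcategory_iff[OF subcategory_right co(2)] ce(3) Rs r1s by blast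
  have cR: "c \<in> add C ?R" using add_iff[OF Ro] co(1) ce(2) r1s by blast
  from ce(1) obtain ic ie pc pe where "biproduct2 c e r1 ic ie pc pe" by (rule direct_sum2E)
  note bp = biproduct2D[OF this]
  define \<phi> where "\<phi> = shm pc \<cdot> v"
  have \<phi>: "arr \<phi> x (sh c)" unfolding \<phi>_def using arr_comp[OF tr(5) arr_shm[OF bp(3)]] .
  have pe0: "shm pe \<cdot> v = 0" using ext0D[OF ext0_left_right[OF xX eY] arr_comp[OF tr(5) arr_shm[OF bp(4)]]] .
  have v\<phi>: "v = shm ic \<cdot> \<phi>"
  proof -
    note ip = arr_comp[OF bp(3) bp(1)] and jq = arr_comp[OF bp(4) bp(2)]
    have "Idn (sh r1) = shm ic \<cdot> shm pc + shm ie \<cdot> shm pe"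
      using shm_Idn[OF r1o] bp(9) shm_plus[OF ip jq] shm_o[OF bp(3,1)] shm_o[OF bp(4,2)] by simp
    then have "v = (shm ic \<cdot> shm pc + shm ie \<cdot> shm pe) \<cdot> v" using comp_id(2)[OF tr(5)] by simp
    also have "\<dots> = shm ic \<cdot> \<phi> + shm ie \<cdot> (shm pe \<cdot> v)"
      unfolding \<phi>_def using comp_addL[OF tr(5) arr_comp[OF arr_shm[OF bp(3)] arr_shm[OF bp(1)]] arr_comp[OF arr_shm[OF bp(4)] arr_shm[OF bp(2)]]]
        assoc[OF tr(5) arr_shm[OF bp(3)] arr_shm[OF bp(1)]] assoc[OF tr(5) arr_shm[OF bp(4)] arr_shm[OF bp(2)]] by simp
    finally show ?thesis using pe0 comp_zeroR[OF arr_shm[OF bp(2)]] by simp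
  qed
  \<comment> \<open>The fibre of \<open>\<phi>\<close> is an extension of \<open>x\<close> by
    \<open>c\<close>, hence lies in \<open>\<X>\<close>; this is not known of
    \<open>r0\<close>.\<close>
  obtain s0 u' v' where ts: "tri c s0 x u' v' \<phi>" using tri_fiber[OF \<phi> co(1)] by blast
  note sr = tri_arr[OF ts]
  have s0X: "s0 \<in> \<X>"
    using mem_left[OF sr(2)] ext0_middle[OF ts ext0_left_right[OF cX] ext0_left_right[OF xX]] by blast
  have "ext0 s0 ?R"
  proof (rule ext0I[OF sr(2) Ro])
    fix f assume f: "arr f s0 (sh ?R)"
    \<comment> \<open>\<open>f\<close> dies on \<open>c\<close>, so it comes from a map
      \<open>g\<close> on \<open>x\<close>. As \<open>g\<close> dies on \<open>r0\<close>, it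
      factors through \<open>v\<close> and so through \<open>\<phi>\<close>, while
      \<open>\<phi> \<cdot> v' = 0\<close>.\<close>
    have "f \<cdot> u' = 0" using ext0D[OF ext0_add_left[OF RR cR] arr_comp[OF sr(4) f]] .
    then obtain g where g: "arr g x (sh ?R)" "f = g \<cdot> v'" using tri_ext1[OF ts f] by blast
    have "g \<cdot> m = 0" using ext0D[OF ext0_add_left[OF RR r01(1)] arr_comp[OF tr(4) g(1)]] .
    then obtain h where h: "arr h (sh r1) (sh ?R)" "g = h \<cdot> v" using tri_ext1[OF tx g(1)] by blast
    have "g \<cdot> v' = h \<cdot> (shm ic \<cdot> (\<phi> \<cdot> v'))"
      using h(2) v\<phi> assoc[OF sr(5) tr(5) h(1)] assoc[OF sr(5) \<phi> arr_shm[OF bp(1)]] by simp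
    then show "f = 0" using g(2) tri_comp_zero2[OF ts] comp_zeroR[OF arr_shm[OF bp(1)]] comp_zeroR[OF h(1)] by simp
  qed
  then have s0R: "s0 \<in> add C ?R" using R' ext0_sym unfolding tilts_def by blast
  let ?S = "{x \<in> Obj C. \<forall>y\<in>\<Y>. \<forall>f. arr f y x \<longrightarrow> factors f y x}"
  have core: "J \<in> ?S" if J: "J \<in> \<X> \<inter> \<Y>" for J
  proof -
    have Jo: "J \<in> Obj C" using J left_Obj by blast
    have "factors f y J" if "arr f y J" for y f
      unfolding factors_def using J that arr_Idn[OF Jo] comp_id(2)[OF that] by metis
    then show ?thesis using Jo by blast
  qed
  have "a' \<in> ?S" using st(2) o'(1) by blast
  then have sa': "supp a' \<subseteq> ?S" using mem_subcategory_iff[OF subcategory_factors o'(1)] by blast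
  have "supp i \<subseteq> \<X> \<inter> \<Y>" using mem_subcategory_iff[OF core_subcategory o'(2)] st(1) a'i(2) by blast
  then have si: "supp i \<subseteq> ?S" using core by blast
  \<comment> \<open>Summands shared with \<open>b\<close> lie in both halves, hence in the core;
    those shared with \<open>a'\<close> or \<open>i\<close> already have the property.\<close>
  have "J \<in> ?S" if J: "J \<in> supp s0" for J
  proof -
    have "J \<in> \<X>" using mem_subcategory_iff[OF subcategory_left sr(2)] s0X J by blast
    moreover have "J \<in> supp a' \<or> J \<in> supp i \<or> J \<in> supp b" using J s0R add_iff[OF Ro] suppR by blast
    ultimately show ?thesis using sa' si core \<open>supp b \<subseteq> \<Y>\<close> by blast
  qed
  then have "s0 \<in> ?S" using mem_subcategory_iff[OF subcategory_factors sr(2)] by blast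
  moreover have "\<phi> \<cdot> f = 0" using ext0D[OF ext0_right_left[OF cX yY] arr_comp[OF f \<phi>]] .
  then obtain g where g: "arr g y s0" "f = v' \<cdot> g" using tri_lift2[OF ts f] by blast
  ultimately have "factors g y s0" using yY by blast
  then show ?thesis using factors_comp_left[OF _ sr(5)] g(2) by blast
qed

text \<open>The connecting map of a -> Z -> b[1] is the shift of a map that passes through a core
  object \<open>J\<close>. With Ext^1(Z, J) = 0 this makes \<open>a\<close> a retract of the sum of
  \<open>J\<close> and \<open>Z\<close>. If \<open>Z\<close> is a summand of \<open>a\<close>, it
  lies in \<open>\<X>\<close>; otherwise \<open>a\<close> lies in the core, and \<open>Z\<close> is
  orthogonal to all of \<open>\<X>\<close>.\<close>

lemma local_left_or_right:
  assumes T: "\<exists>T. tilts T" and Z: "local_End C Z" and e: "\<And>J. J \<in> \<X> \<inter> \<Y> \<Longrightarrow> ext0 J Z"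
  shows "Z \<in> \<X> \<or> Z \<in> \<Y>"
proof -
  have Zo: "Z \<in> Obj C" using local_EndD(1)[OF Z] .
  obtain a b i p w where ab: "a \<in> \<X>" "b \<in> \<Y>" and t: "tri a Z (sh b) i p w" using cotorsion_triangle[OF Zo] .
  note r = tri_arr[OF t]
  have ao: "a \<in> Obj C" and bo: "b \<in> Obj C" using ab left_Obj right_Obj by auto
  obtain \<delta> where \<delta>: "arr \<delta> b a" "w = shm \<delta>" using shm_lift[OF r(6) bo ao] .
  obtain J f g where J: "J \<in> \<X> \<inter> \<Y>" and f: "arr f b J" and g: "arr g J a" and fg: "\<delta> = g \<cdot> f"
    using factors_through_core[OF T ab \<delta>(1)] unfolding factors_def by blast
  have Jo: "J \<in> Obj C" using arrD(2)[OF f] .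
  \<comment> \<open>This composite lies in Ext^1(Z, J) = 0, so \<open>f\<close> extends along
    \<open>\<delta>\<close> to a map \<open>h\<close> on \<open>a\<close>.\<close>
  have "shm f \<cdot> p = 0" using ext0D[OF ext0_sym[OF e[OF J]] arr_comp[OF r(5) arr_shm[OF f]]] .
  then obtain h' where h': "arr h' (sh a) (sh J)" "shm f = h' \<cdot> w" using tri_ext2[OF t arr_shm[OF f]] by blast
  obtain h where h: "arr h a J" "h' = shm h" using shm_lift[OF h'(1) ao Jo] .
  have fh: "f = h \<cdot> \<delta>" using shm_inject[OF f arr_comp[OF \<delta>(1) h(1)]] shm_o[OF \<delta>(1) h(1)] h'(2) h(2) \<delta>(2) by simp
  \<comment> \<open>\<open>g \<cdot> h\<close> fixes \<open>\<delta>\<close>, so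
    \<open>\<epsilon>\<close> kills it and factors through \<open>i\<close>: the identity of
    \<open>a\<close> is a map through \<open>J\<close> plus a map through \<open>Z\<close>.\<close>
  define \<epsilon> where "\<epsilon> = Idn a - g \<cdot> h"
  note gh = arr_comp[OF h(1) g]
  have \<epsilon>: "arr \<epsilon> a a" unfolding \<epsilon>_def using arr_diff[OF arr_Idn[OF ao] gh] .
  have "\<epsilon> \<cdot> \<delta> = \<delta> - g \<cdot> (h \<cdot> \<delta>)" unfolding \<epsilon>_def
    using comp_diffL[OF \<delta>(1) arr_Idn[OF ao] gh] comp_id(2)[OF \<delta>(1)] assoc[OF \<delta>(1) h(1) g] by simp
  then have "\<epsilon> \<cdot> \<delta> = 0" unfolding fh[symmetric] fg[symmetric] by simp
  then have "shm \<epsilon> \<cdot> w = 0" using shm_o[OF \<delta>(1) \<epsilon>] \<delta>(2) shm_zero[OF ao] by simp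
  then obtain k' where k': "arr k' (sh Z) (sh a)" "shm \<epsilon> = k' \<cdot> shm i" using tri_ext3[OF t arr_shm[OF \<epsilon>]] by blast
  obtain k where k: "arr k Z a" "k' = shm k" using shm_lift[OF k'(1) Zo ao] .
  have "\<epsilon> = k \<cdot> i" using shm_inject[OF \<epsilon> arr_comp[OF r(4) k(1)]] shm_o[OF r(4) k(1)] k'(2) k(2) by simp
  then have id: "g \<cdot> h + k \<cdot> i = Idn a" unfolding \<epsilon>_def by (simp add: algebra_simps)
  have "covered 2 (\<lambda>n. if n = 0 then J else Z) (\<lambda>n. if n = 0 then g else k) (\<lambda>n. if n = 0 then h else i) a"
    unfolding covered_def using ao g h(1) k(1) r(4) id by (auto simp: numeral_2_eq_2 lessThan_Suc add.commute)
  from supp_covered[OF this] have sa: "J' \<in> supp J \<or> J' \<in> supp Z" if "J' \<in> supp a" for J' using that by metis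
  show ?thesis
  proof (cases "Z \<in> supp a")
    case True
    then show ?thesis using mem_subcategory_iff[OF subcategory_left ao] ab(1) by blast
  next
    case False
    have "J' \<in> supp J" if J': "J' \<in> supp a" for J'
    proof (rule ccontr)
      assume "J' \<notin> supp J"
      then have "Z \<simeq> J'" using sa[OF J'] supp_local[OF Z] iso_obj_sym by blast
      then show False using False supp_iso_closed[OF J'] by blast
    qed
    then have "a \<in> \<X> \<inter> \<Y>"
      using mem_subcategory_iff[OF core_subcategory ao] mem_subcategory_iff[OF core_subcategory Jo] J by blast
    then have aY: "a \<in> \<Y>" by blast
    have "ext0 Z x" if x: "x \<in> \<X>" for x
    proof (rule ext0I[OF Zo left_Obj[OF x]])
      fix q assume q: "arr q Z (sh x)"
      \<comment> \<open>As \<open>q\<close> vanishes on \<open>a\<close>, it comes from the shift of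
        a map \<open>s'\<close> from \<open>b\<close> to \<open>x\<close>. That map passes through a
        core object \<open>L\<close>, and Ext^1(Z, L) = 0 kills the composite.\<close>
      have "q \<cdot> i = 0" using ext0D[OF ext0_right_left[OF x aY] arr_comp[OF r(4) q]] .
      then obtain s where s: "arr s (sh b) (sh x)" "q = s \<cdot> p" using tri_ext1[OF t q] by blast
      obtain s' where s': "arr s' b x" "s = shm s'" using shm_lift[OF s(1) bo left_Obj[OF x]] .
      obtain L l m where L: "L \<in> \<X> \<inter> \<Y>" "arr l b L" "arr m L x" "s' = m \<cdot> l"
        using factors_through_core[OF T x ab(2) s'(1)] unfolding factors_def by blast
      have "shm l \<cdot> p = 0" using ext0D[OF ext0_sym[OF e[OF L(1)]] arr_comp[OF r(5) arr_shm[OF L(2)]]] .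
      then show "q = 0"
        using s(2) s'(2) L(4) shm_o[OF L(2,3)] assoc[OF r(5) arr_shm[OF L(2)] arr_shm[OF L(3)]]
          comp_zeroR[OF arr_shm[OF L(3)]] by simp
    qed
    then have "Z \<in> \<Y>" using mem_right[OF Zo] ext0_sym by blast
    then show ?thesis ..
  qed
qed

end

section \<open>Relative cluster tilting objects\<close>

context calabi_yau_category
begin

lemma Ext1_zero_add_left:
  assumes "M \<in> Obj C" "N \<in> Obj C" shows "Ext1_zero C (add C M) {N} \<longleftrightarrow> ext0 M N"
proof
  assume "Ext1_zero C (add C M) {N}"
  then show "ext0 M N" using add_self assms unfolding Ext1_zero_def ext0_def by blast
next
  assume "ext0 M N"
  then show "Ext1_zero C (add C M) {N}" using ext0_add_left unfolding Ext1_zero_def ext0_def by blast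
qed

lemma Ext1_zero_add_right:
  assumes "M \<in> Obj C" "N \<in> Obj C" shows "Ext1_zero C {N} (add C M) \<longleftrightarrow> ext0 M N"
proof
  assume "Ext1_zero C {N} (add C M)"
  then have "ext0 N M" using add_self assms unfolding Ext1_zero_def ext0_def by blast
  then show "ext0 M N" by (rule ext0_sym)
next
  assume "ext0 M N"
  then have "ext0 N D" if "D \<in> add C M" for D using ext0_add_right[OF ext0_sym] that by blast
  then show "Ext1_zero C {N} (add C M)" unfolding Ext1_zero_def ext0_def by blast
qed

text \<open>Hom-finiteness supplies the approximations by \<open>add C M\<close>, and symmetry of
  \<open>ext0\<close> merges the two orthogonality conditions, which leaves rigidity and maximality
  inside \<open>S\<close>.\<close>

lemma rel_cluster_tilting_iff:
  assumes S: "subcategory C S"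
  shows "rel_cluster_tilting C S M \<longleftrightarrow>
    M \<in> S \<and> basic C M \<and> ext0 M M \<and> (\<forall>N\<in>S. ext0 M N \<longrightarrow> N \<in> add C M)"
proof
  assume r: "rel_cluster_tilting C S M"
  then have M: "M \<in> S" "basic C M" and
    *: "\<And>N. N \<in> S \<Longrightarrow> N \<in> add C M \<longleftrightarrow> Ext1_zero C (add C M) {N}"
    unfolding rel_cluster_tilting_def rel_cluster_tilting_subcat_def by blast+
  have "N \<in> add C M \<longleftrightarrow> ext0 M N" if "N \<in> S" for N
    using *[OF that] Ext1_zero_add_left subcategory_Obj[OF S] M(1) that by blast
  then show "M \<in> S \<and> basic C M \<and> ext0 M M \<and> (\<forall>N\<in>S. ext0 M N \<longrightarrow> N \<in> add C M)"
    using M add_self by blast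
next
  assume r: "M \<in> S \<and> basic C M \<and> ext0 M M \<and> (\<forall>N\<in>S. ext0 M N \<longrightarrow> N \<in> add C M)"
  then have M: "M \<in> S" "basic C M" "ext0 M M" and max: "\<And>N. N \<in> S \<Longrightarrow> ext0 M N \<Longrightarrow> N \<in> add C M" by auto
  have Mo: "M \<in> Obj C" and So: "S \<subseteq> Obj C" using subcategory_Obj[OF S] M by auto
  have iff: "N \<in> add C M \<longleftrightarrow> ext0 M N" if "N \<in> S" for N
    using max[OF that] ext0_add_right[OF M(3)] by blast
  show "rel_cluster_tilting C S M"
    unfolding rel_cluster_tilting_def rel_cluster_tilting_subcat_def
  proof (intro conjI ballI)
    show "M \<in> S" "basic C M" using M by auto
    show "subcategory C (add C M)" using add_subcategory[OF Mo] .
    show "add C M \<subseteq> S" using add_least[OF S M(1)] .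
    show "functorially_finite_in C S (add C M)" using functorially_finite_add[OF Mo So] .
    fix N assume N: "N \<in> S"
    then have No: "N \<in> Obj C" using So by blast
    show "N \<in> add C M \<longleftrightarrow> Ext1_zero C (add C M) {N}" "N \<in> add C M \<longleftrightarrow> Ext1_zero C {N} (add C M)"
      using iff[OF N] Ext1_zero_add_left[OF Mo No] Ext1_zero_add_right[OF Mo No] by simp_all
  qed
qed

lemma rel_cluster_tilting_iso:
  assumes S: "subcategory C S" and r: "rel_cluster_tilting C S M" and i: "M \<simeq> M'"
  shows "rel_cluster_tilting C S M'"
proof -
  have M: "M \<in> S" "basic C M" "ext0 M M" "\<And>N. N \<in> S \<Longrightarrow> ext0 M N \<Longrightarrow> N \<in> add C M"
    using r rel_cluster_tilting_iff[OF S] by auto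
  have o: "M \<in> Obj C" "M' \<in> Obj C" using i by (auto simp: iso_obj_def)
  have eq: "add C M' = add C M" using add_iff[OF o(1)] add_iff[OF o(2)] supp_iso[OF i] by auto
  have 1: "M' \<in> add C M" "M \<in> add C M'" using add_self eq by blast+
  have "M' \<in> S" using subcategory_iso[OF S iso_obj_sym[OF i] M(1)] .
  moreover have "basic C M'" using basic_iso[OF M(2) i] .
  moreover have "ext0 M' M'" using ext0_add_left[OF ext0_add_right[OF M(3) 1(1)] 1(1)] .
  moreover have "N \<in> add C M'" if "N \<in> S" "ext0 M' N" for N
    using M(4)[OF that(1) ext0_add_left[OF that(2) 1(2)]] eq by simp
  ultimately show ?thesis using rel_cluster_tilting_iff[OF S] by blast
qed

text \<open>Cut \<open>M\<close> along \<open>supp I\<close>. The part inside is basic with the same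
  support as \<open>I\<close>, so it may be exchanged for \<open>I\<close>.\<close>

lemma basic_complement:
  assumes M: "basic C M" and I: "basic C I" and sub: "supp I \<subseteq> supp M"
  obtains A where "direct_sum C [A, I] M" "supp A = supp M - supp I"
proof -
  have iso: "J \<notin> supp I \<longleftrightarrow> J' \<notin> supp I" if "J \<simeq> J'" for J J'
    using supp_iso_closed that iso_obj_sym by blast
  obtain A B where AB: "direct_sum C [A, B] M" "supp A = {J \<in> supp M. J \<notin> supp I}" "supp B = {J \<in> supp M. \<not> J \<notin> supp I}"
    by (rule supp_partition[OF basic_Obj[OF M], of "\<lambda>J. J \<notin> supp I", OF iso])
  have "basic C B" using basic_direct_sum_iff[OF AB(1)] M by blast
  moreover have "supp B = supp I" using AB(3) sub by blast
  ultimately have "B \<simeq> I" using basic_supp_iso I by blast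
  have "direct_sum C [A, I] M"
  proof (rule direct_sum_iso_list[OF AB(1)])
    fix i assume "i < length [A, B]"
    then show "[A, B] ! i \<simeq> [A, I] ! i"
      using \<open>B \<simeq> I\<close> iso_obj_refl[of A] direct_sum_Obj(1)[OF AB(1)] by (auto simp: less_Suc_eq)
  qed simp
  then show thesis using that AB(2) by blast
qed

lemma direct_sum_retract: "direct_sum C [A, B] Z \<Longrightarrow> retract A Z" "direct_sum C [A, B] Z \<Longrightarrow> retract B Z"
proof -
  assume "direct_sum C [A, B] Z"
  then obtain i j p q where "biproduct2 A B Z i j p q" by (rule direct_sum2E)
  note b = biproduct2D[OF this]
  show "retract A Z" "retract B Z" unfolding retract_def using b by blast+
qed

lemma direct_sum_iso_dsum: "direct_sum C [A, B] Z \<Longrightarrow> Z \<simeq> A \<oplus> B"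
  using direct_sum_iso direct_sum_dsum direct_sum_Obj(1) by (metis insert_subset list.set(2))

end

section \<open>Comparison of absolute and relative cluster tilting objects\<close>

locale cotorsion_pair_with_core = cotorsion_pair_in_category C \<X> \<Y>
  for C :: "('o, 'm::ab_group_add, 'k::field, 'z) tri_cat_scheme" (structure) and \<X> \<Y> +
  fixes I :: 'o
  assumes core: "core_object C \<X> \<Y> I" and cluster_tilting_exists: "\<exists>T. cluster_tilting C T"
begin

lemma tilts_exists: "\<exists>T. tilts T"
  using cluster_tilting_exists cluster_tilting_iff by blast

lemma core_basic: "basic C I"
  using core unfolding core_object_def basic_def by blast

lemma core_Obj: "I \<in> Obj C"
  using basic_Obj[OF core_basic] .

lemma core_mem: "I \<in> \<X>" "I \<in> \<Y>"
proof -
  obtain Is where "direct_sum C Is I" "set Is \<subseteq> \<X> \<inter> \<Y>" using core unfolding core_object_def by blast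
  then have "I \<in> \<X> \<inter> \<Y>" using subcategory_direct_sum[OF core_subcategory] by blast
  then show "I \<in> \<X>" "I \<in> \<Y>" by auto
qed

lemma supp_core: "J \<in> supp I \<longleftrightarrow> local_End C J \<and> J \<in> \<X> \<inter> \<Y>"
proof
  assume J: "J \<in> supp I"
  have "supp I \<subseteq> \<X> \<inter> \<Y>" using mem_subcategory_iff[OF core_subcategory core_Obj] core_mem by blast
  then show "local_End C J \<and> J \<in> \<X> \<inter> \<Y>" using J suppD(1) by blast
next
  assume J: "local_End C J \<and> J \<in> \<X> \<inter> \<Y>"
  obtain Is where Is: "direct_sum C Is I" "\<forall>J \<in> \<X> \<inter> \<Y>. indecomposable C J \<longrightarrow> (\<exists>J' \<in> set Is. J \<simeq> J')"
    using core unfolding core_object_def by blast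
  then obtain J' where J': "J' \<in> set Is" "J \<simeq> J'" using J local_indecomposable by blast
  have "J \<in> supp J'" using J J'(2) iso_retract by (simp add: supp_def)
  then show "J \<in> supp I" using supp_direct_sum[OF Is(1)] J'(1) by blast
qed

lemma core_add: "L \<in> \<X> \<inter> \<Y> \<Longrightarrow> L \<in> add C I"
  using add_iff[OF core_Obj] mem_subcategory_iff[OF core_subcategory] supp_core suppD(1) subcategory_Obj[OF core_subcategory]
  by blast

text \<open>Since \<open>ext0\<close> is symmetric, the two halves play interchangeable roles; this
  predicate lets an argument serve both.\<close>

definition half :: "'o set \<Rightarrow> bool" where
  "half S \<longleftrightarrow> S = \<X> \<or> S = \<Y>"

lemma half_simps: "half \<X>" "half \<Y>" by (simp_all add: half_def)

lemma half_subcategory: "half S \<Longrightarrow> subcategory C S"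
  using subcategory_left subcategory_right by (auto simp: half_def)

lemma half_core: "half S \<Longrightarrow> I \<in> S"
  using core_mem by (auto simp: half_def)

lemma half_ext0_core: "half S \<Longrightarrow> M \<in> S \<Longrightarrow> ext0 M I"
  using ext0_left_right ext0_right_left core_mem by (auto simp: half_def)

text \<open>\<open>I\<close> is orthogonal to everything in either half, in particular to
  \<open>M\<close>, so maximality puts it into \<open>add C M\<close>.\<close>

lemma rel_cluster_tilting_core:
  assumes S: "half S" and M: "rel_cluster_tilting C S M"
  shows "supp I \<subseteq> supp M"
proof -
  have m: "M \<in> S" "\<And>N. N \<in> S \<Longrightarrow> ext0 M N \<Longrightarrow> N \<in> add C M"
    using M rel_cluster_tilting_iff[OF half_subcategory[OF S]] by auto
  have "I \<in> add C M" using m(2)[OF half_core[OF S] half_ext0_core[OF S m(1)]] .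
  then show ?thesis using add_iff[OF subcategory_Obj[OF half_subcategory[OF S] m(1)]] by blast
qed

lemma rel_cluster_tilting_split:
  assumes S: "half S" and M: "rel_cluster_tilting C S M"
  obtains A where "A \<in> Obj C" "M \<simeq> A \<oplus> I" "summand C I M"
proof -
  have "basic C M" using M by (simp add: rel_cluster_tilting_def)
  then obtain A where A: "direct_sum C [A, I] M"
    using basic_complement core_basic rel_cluster_tilting_core[OF S M] by blast
  show thesis using that[of A] direct_sum_iso_dsum[OF A] direct_sum_retract(2)[OF A] direct_sum_Obj(1)[OF A]
    by (simp add: summand_iff_retract)
qed

text \<open>Every core object lies in \<open>add C T\<close>, hence is orthogonal to
  \<open>N\<close> and to each of its indecomposable summands.\<close>

lemma rigid_supp_left_or_right:
  assumes T: "ext0 T T" and I: "supp I \<subseteq> supp T" and TN: "ext0 T N" and J: "J \<in> supp N"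
  shows "J \<in> \<X> \<or> J \<in> \<Y>"
proof (rule local_left_or_right[OF tilts_exists suppD(1)[OF J]])
  have o: "T \<in> Obj C" "N \<in> Obj C" using TN ext0_Obj by auto
  fix L assume "L \<in> \<X> \<inter> \<Y>"
  then have "L \<in> add C I" by (rule core_add)
  then have L: "L \<in> add C T" using add_mono[OF core_Obj o(1) I] by blast
  have "J \<in> add C N" using add_iff[OF o(2)] suppD(3)[OF J] supp_retract[OF suppD(2)[OF J]] by blast
  then show "ext0 L J" using ext0_add_left[OF ext0_add_right[OF TN] L] by blast
qed

text \<open>A summand common to \<open>MX \<oplus> I\<close> and \<open>MY\<close> would lie in the
  core, hence in \<open>supp I\<close>, against \<open>MY \<oplus> I\<close> being basic. For
  maximality, each indecomposable summand of an orthogonal object lies in one half, where relative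
  maximality applies.\<close>

lemma cluster_tilting_union:
  assumes o: "MX \<in> Obj C" "MY \<in> Obj C" and X: "rel_cluster_tilting C \<X> (MX \<oplus> I)" and Y: "rel_cluster_tilting C \<Y> (MY \<oplus> I)"
  shows "cluster_tilting C (MX \<oplus> I \<oplus> MY)"
proof -
  let ?M = "MX \<oplus> I" and ?N = "MY \<oplus> I"
  let ?T = "?M \<oplus> MY"
  have M: "?M \<in> \<X>" "basic C ?M" "ext0 ?M ?M" "\<And>L. L \<in> \<X> \<Longrightarrow> ext0 ?M L \<Longrightarrow> L \<in> add C ?M"
    using X rel_cluster_tilting_iff[OF subcategory_left] by auto
  have N: "?N \<in> \<Y>" "basic C ?N" "ext0 ?N ?N" "\<And>L. L \<in> \<Y> \<Longrightarrow> ext0 ?N L \<Longrightarrow> L \<in> add C ?N"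
    using Y rel_cluster_tilting_iff[OF subcategory_right] by auto
  have dM: "direct_sum C [MX, I] ?M" and dN: "direct_sum C [MY, I] ?N" using direct_sum_dsum o core_Obj by auto
  have oo: "?M \<in> Obj C" "?N \<in> Obj C" using direct_sum_Obj(2) dM dN by auto
  have dT: "direct_sum C [?M, MY] ?T" by (rule direct_sum_dsum[OF oo(1) o(2)])
  have To: "?T \<in> Obj C" using direct_sum_Obj(2)[OF dT] .
  have supps: "supp ?T = supp MX \<union> supp I \<union> supp MY" "supp ?M = supp MX \<union> supp I" "supp ?N = supp MY \<union> supp I"
    using supp_direct_sum2[OF dT] supp_direct_sum2[OF dM] supp_direct_sum2[OF dN] by auto
  have MY: "MY \<in> \<Y>" using subcategory_retract[OF subcategory_right direct_sum_retract(1)[OF dN] N(1)] .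
  have sM: "supp ?M \<subseteq> \<X>" and sMY: "supp MY \<subseteq> \<Y>"
    using mem_subcategory_iff[OF subcategory_left oo(1)] M(1) mem_subcategory_iff[OF subcategory_right o(2)] MY by auto
  have bN: "basic C MY" "supp MY \<inter> supp I = {}" using basic_direct_sum_iff[OF dN] N(2) by auto
  have "supp ?M \<inter> supp MY = {}"
    using sM sMY bN(2) supp_core suppD(1) by blast
  then have basic: "basic C ?T" using basic_direct_sum_iff[OF dT] M(2) bN(1) by blast
  have MYa: "MY \<in> add C ?N" using add_iff[OF oo(2)] o(2) supps(3) by blast
  have "ext0 MY MY" using ext0_add_left[OF ext0_add_right[OF N(3) MYa] MYa] .
  then have rig: "ext0 ?T ?T"
    using ext0_direct_sum_self[OF dT M(3) ext0_left_right[OF M(1) MY]] by blast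
  have IT: "supp I \<subseteq> supp ?T" using supps by blast
  have MT: "?M \<in> add C ?T" "?N \<in> add C ?T" using add_iff[OF To] oo supps by auto
  have "L \<in> add C ?T" if L: "ext0 ?T L" for L
  proof -
    have Lo: "L \<in> Obj C" using ext0_Obj(2)[OF L] .
    have "J \<in> supp ?T" if J: "J \<in> supp L" for J
    proof -
      have Jo: "J \<in> Obj C" using suppD(3)[OF J] .
      have JL: "J \<in> add C L" using add_iff[OF Lo] Jo supp_retract[OF suppD(2)[OF J]] by blast
      have J1: "J \<in> supp J" using supp_self[OF suppD(1)[OF J]] .
      have e: "ext0 ?M J" "ext0 ?N J" using ext0_add_left[OF ext0_add_right[OF L JL]] MT by auto
      consider "J \<in> \<X>" | "J \<in> \<Y>" using rigid_supp_left_or_right[OF rig IT L J] by blast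
      then show ?thesis
      proof cases
        case 1
        then have "J \<in> add C ?M" using M(4) e(1) by blast
        then show ?thesis using add_iff[OF oo(1)] supps J1 by blast
      next
        case 2
        then have "J \<in> add C ?N" using N(4) e(2) by blast
        then show ?thesis using add_iff[OF oo(2)] supps J1 by blast
      qed
    qed
    then show ?thesis using add_iff[OF To] Lo by blast
  qed
  then show ?thesis using basic rig cluster_tilting_iff unfolding tilts_def by blast
qed

text \<open>Summands of \<open>T\<close> outside \<open>S\<close> lie in the other half, where
  extensions with an object of \<open>S\<close> vanish anyway. Orthogonality to \<open>M\<close>
  therefore implies orthogonality to \<open>T\<close>, and maximality of \<open>T\<close>
  applies.\<close>

lemma rel_cluster_tilting_part:
  assumes S: "half S" and T: "tilts T" and I: "supp I \<subseteq> supp T"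
    and M: "basic C M" "supp M = {J \<in> supp T. J \<in> S}"
  shows "rel_cluster_tilting C S M"
proof -
  note sub = half_subcategory[OF S] and To = tilts_Obj[OF T] and Mo = basic_Obj[OF M(1)]
  have rig: "ext0 T T" and max: "\<And>N. ext0 T N \<Longrightarrow> N \<in> add C T" using T by (auto simp: tilts_def)
  have MS: "M \<in> S" using mem_subcategory_iff[OF sub Mo] M(2) by blast
  have MT: "M \<in> add C T" using add_iff[OF To] Mo M(2) by blast
  have "N \<in> add C M" if N: "N \<in> S" "ext0 M N" for N
  proof -
    have No: "N \<in> Obj C" using ext0_Obj(2)[OF N(2)] .
    have "ext0 J N" if J: "J \<in> supp T" for J
    proof (cases "J \<in> S")
      case True
      then have "J \<in> supp M" using J M(2) by blast
      then have "J \<in> add C M" using add_iff[OF Mo] suppD(3)[OF J] supp_retract[OF suppD(2)] by blast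
      then show ?thesis using ext0_add_left[OF N(2)] by blast
    next
      case False
      then show ?thesis
        using rigid_supp_left_or_right[OF rig I rig J] S N(1) ext0_left_right ext0_right_left by (auto simp: half_def)
    qed
    then have "supp T \<subseteq> {Z \<in> Obj C. ext0 Z N}" using suppD(3) by blast
    then have "ext0 T N" using mem_subcategory_iff[OF subcategory_ext0_left[OF No] To] by blast
    then have "supp N \<subseteq> supp T" using max add_iff[OF To] by blast
    moreover have "supp N \<subseteq> S" using mem_subcategory_iff[OF sub No] N(1) by blast
    ultimately show ?thesis using add_iff[OF Mo] No M(2) by blast
  qed
  then show ?thesis
    using rel_cluster_tilting_iff[OF sub] MS M(1) ext0_add_left[OF ext0_add_right[OF rig MT] MT] by blast
qed

lemma summand_core_supp: "summand C I T \<Longrightarrow> supp I \<subseteq> supp T"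
  using supp_retract summand_iff_retract by blast

lemma cluster_decomposition_exists:
  assumes T: "cluster_tilting C T" and I: "summand C I T"
  obtains TX TY where "cluster_decomposition C \<X> \<Y> I T TX TY"
proof -
  have bT: "basic C T" and tT: "tilts T" using T cluster_tilting_iff by auto
  have rig: "ext0 T T" using tT by (simp add: tilts_def)
  note IT = summand_core_supp[OF I]
  have lr: "J \<in> \<X> \<or> J \<in> \<Y>" if "J \<in> supp T" for J using rigid_supp_left_or_right[OF rig IT rig that] .
  have iso: "J \<in> S \<longleftrightarrow> J' \<in> S" if "half S" "J \<simeq> J'" for J J' S
    using subcategory_iso[OF half_subcategory[OF that(1)]] that(2) iso_obj_sym[OF that(2)] by blast
  \<comment> \<open>Used to collect the summands of \<open>T\<close> lying in exactly one half;
    those lying in both are the summands of \<open>I\<close>.\<close>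
  have part: "\<exists>A. basic C A \<and> supp A = {J \<in> supp T. J \<in> S \<and> J \<notin> S'}" if S: "half S" "half S'" for S S'
  proof -
    have i: "(J \<in> S \<and> J \<notin> S') \<longleftrightarrow> (J' \<in> S \<and> J' \<notin> S')" if "J \<simeq> J'" for J J' using iso S that by blast
    obtain A B where AB: "direct_sum C [A, B] T" "supp A = {J \<in> supp T. J \<in> S \<and> J \<notin> S'}"
       "supp B = {J \<in> supp T. \<not> (J \<in> S \<and> J \<notin> S')}"
      by (rule supp_partition[OF basic_Obj[OF bT], of "\<lambda>J. J \<in> S \<and> J \<notin> S'", OF i])
    show ?thesis using AB(2) basic_direct_sum_iff[OF AB(1)] bT by blast
  qed
  obtain TX where TX: "basic C TX" "supp TX = {J \<in> supp T. J \<in> \<X> \<and> J \<notin> \<Y>}" using part[OF half_simps] by blast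
  obtain TY where TY: "basic C TY" "supp TY = {J \<in> supp T. J \<in> \<Y> \<and> J \<notin> \<X>}" using part[OF half_simps(2,1)] by blast
  have o: "TX \<in> Obj C" "TY \<in> Obj C" using basic_Obj TX TY by auto
  have dX: "direct_sum C [TX, I] (TX \<oplus> I)" and dY: "direct_sum C [TY, I] (TY \<oplus> I)" using direct_sum_dsum o core_Obj by auto
  have XI: "TX \<oplus> I \<in> Obj C" using direct_sum_Obj(2)[OF dX] .
  have sI: "J \<in> supp I \<longleftrightarrow> J \<in> \<X> \<and> J \<in> \<Y>" if "J \<in> supp T" for J using supp_core suppD(1)[OF that] by blast
  have sX: "supp (TX \<oplus> I) = {J \<in> supp T. J \<in> \<X>}"
    unfolding supp_direct_sum2[OF dX] TX(2) using IT sI by blast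
  have sY: "supp (TY \<oplus> I) = {J \<in> supp T. J \<in> \<Y>}"
    unfolding supp_direct_sum2[OF dY] TY(2) using IT sI by blast
  have bX: "basic C (TX \<oplus> I)" using basic_direct_sum_iff[OF dX] TX core_basic supp_core by blast
  have bY: "basic C (TY \<oplus> I)" using basic_direct_sum_iff[OF dY] TY core_basic supp_core by blast
  have dT: "direct_sum C [TX \<oplus> I, TY] (TX \<oplus> I \<oplus> TY)" using direct_sum_dsum[OF XI o(2)] .
  have "supp (TX \<oplus> I \<oplus> TY) = supp T"
    unfolding supp_direct_sum2[OF dT] sX TY(2) using lr by blast
  moreover have "basic C (TX \<oplus> I \<oplus> TY)"
    using basic_direct_sum_iff[OF dT] bX TY sX by blast
  ultimately have "T \<simeq> TX \<oplus> I \<oplus> TY" using basic_supp_iso bT by metis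
  moreover have "rel_cluster_tilting C \<X> (TX \<oplus> I)" "rel_cluster_tilting C \<Y> (TY \<oplus> I)"
    using rel_cluster_tilting_part[OF half_simps(1) tT IT bX sX] rel_cluster_tilting_part[OF half_simps(2) tT IT bY sY] by auto
  ultimately show thesis using that o unfolding cluster_decomposition_def by blast
qed

text \<open>A summand of \<open>T\<close> in both halves belongs to \<open>I\<close>, so
  intersecting \<open>supp T\<close> with the halves recovers the parts. As these are basic,
  \<open>T\<close> determines them up to isomorphism.\<close>

lemma cluster_decomposition_supp:
  assumes d: "cluster_decomposition C \<X> \<Y> I T TX TY"
  shows "supp (TX \<oplus> I) = supp T \<inter> \<X>" "supp (TY \<oplus> I) = supp T \<inter> \<Y>"
    "supp TX = supp T \<inter> \<X> - supp I" "supp TY = supp T \<inter> \<Y> - supp I"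
    "basic C (TX \<oplus> I)" "basic C (TY \<oplus> I)" "basic C TX" "basic C TY"
proof -
  have o: "TX \<in> Obj C" "TY \<in> Obj C" and iso: "T \<simeq> TX \<oplus> I \<oplus> TY" and
    r: "rel_cluster_tilting C \<X> (TX \<oplus> I)" "rel_cluster_tilting C \<Y> (TY \<oplus> I)"
    using d by (auto simp: cluster_decomposition_def)
  have dX: "direct_sum C [TX, I] (TX \<oplus> I)" and dY: "direct_sum C [TY, I] (TY \<oplus> I)" using direct_sum_dsum o core_Obj by auto
  have XI: "TX \<oplus> I \<in> Obj C" "TY \<oplus> I \<in> Obj C" using direct_sum_Obj(2) dX dY by auto
  have sT: "supp T = supp TX \<union> supp I \<union> supp TY"
    using supp_iso[OF iso] supp_direct_sum2[OF direct_sum_dsum[OF XI(1) o(2)]] supp_direct_sum2[OF dX] by simp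
  have m: "TX \<oplus> I \<in> \<X>" "TY \<oplus> I \<in> \<Y>" using r by (auto simp: rel_cluster_tilting_def)
  show b: "basic C (TX \<oplus> I)" "basic C (TY \<oplus> I)" using r by (auto simp: rel_cluster_tilting_def)
  then have b': "basic C TX" "basic C TY" "supp TX \<inter> supp I = {}" "supp TY \<inter> supp I = {}"
    using basic_direct_sum_iff[OF dX] basic_direct_sum_iff[OF dY] by auto
  show "basic C TX" "basic C TY" using b' by auto
  have sub: "supp TX \<union> supp I \<subseteq> \<X>" "supp TY \<union> supp I \<subseteq> \<Y>"
    using mem_subcategory_iff[OF subcategory_left XI(1)] mem_subcategory_iff[OF subcategory_right XI(2)] m
      supp_direct_sum2[OF dX] supp_direct_sum2[OF dY] by auto
  have "J \<in> supp I" if "J \<in> supp T" "J \<in> \<X>" "J \<in> \<Y>" for J using supp_core suppD(1)[OF that(1)] that by blast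
  then have "supp TX \<union> supp I = supp T \<inter> \<X>" "supp TY \<union> supp I = supp T \<inter> \<Y>"
    using sT sub by blast+
  then show "supp (TX \<oplus> I) = supp T \<inter> \<X>" "supp (TY \<oplus> I) = supp T \<inter> \<Y>"
    "supp TX = supp T \<inter> \<X> - supp I" "supp TY = supp T \<inter> \<Y> - supp I"
    using supp_direct_sum2[OF dX] supp_direct_sum2[OF dY] b'(3,4) by auto
qed

lemma cluster_decomposition_unique:
  assumes "cluster_decomposition C \<X> \<Y> I T TX TY" "cluster_decomposition C \<X> \<Y> I T TX' TY'"
  shows "TX \<simeq> TX'" "TY \<simeq> TY'"
  using basic_supp_iso cluster_decomposition_supp[OF assms(1)] cluster_decomposition_supp[OF assms(2)] by simp_all

text \<open>The support of a decomposed object is the union of its intersections with the two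
  halves, and these are the supports of the relative parts.\<close>

lemma cluster_decomposition_iso_iff:
  assumes T: "basic C T" "basic C T'" and d: "cluster_decomposition C \<X> \<Y> I T TX TY" and d': "cluster_decomposition C \<X> \<Y> I T' TX' TY'"
  shows "T \<simeq> T' \<longleftrightarrow> TX \<oplus> I \<simeq> TX' \<oplus> I \<and> TY \<oplus> I \<simeq> TY' \<oplus> I"
proof
  note s = cluster_decomposition_supp[OF d] and s' = cluster_decomposition_supp[OF d']
  {
    assume "T \<simeq> T'"
    then have "supp T = supp T'" by (rule supp_iso)
    then show "TX \<oplus> I \<simeq> TX' \<oplus> I \<and> TY \<oplus> I \<simeq> TY' \<oplus> I"
      using basic_supp_iso s s' by simp
  next
    assume i: "TX \<oplus> I \<simeq> TX' \<oplus> I \<and> TY \<oplus> I \<simeq> TY' \<oplus> I"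
    have lr: "supp S \<subseteq> \<X> \<union> \<Y>" if "cluster_decomposition C \<X> \<Y> I S SX SY" for S SX SY
    proof -
      have "supp S = supp SX \<union> supp I \<union> supp SY"
        using that supp_iso supp_dsum dsum_Obj core_Obj unfolding cluster_decomposition_def by metis
      then show ?thesis using cluster_decomposition_supp(3,4)[OF that] supp_core by blast
    qed
    have "supp T \<inter> \<X> = supp T' \<inter> \<X>" "supp T \<inter> \<Y> = supp T' \<inter> \<Y>"
      using i supp_iso s(1,2) s'(1,2) by metis+
    then have "supp T = supp T'" using lr[OF d] lr[OF d'] by blast
    then show "T \<simeq> T'" using basic_supp_iso T by blast
  }
qed

end

text \<open>Two maps with the same fibres have images in bijection; well-definedness and injectivity
  are the two directions of the one assumption.\<close>

lemma bij_betw_quotient_maps: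
  assumes "\<And>d d'. d \<in> D \<Longrightarrow> d' \<in> D \<Longrightarrow> f d = f d' \<longleftrightarrow> g d = g d'"
  obtains h where "bij_betw h (f ` D) (g ` D)" "\<And>d. d \<in> D \<Longrightarrow> h (f d) = g d"
proof -
  define h where "h = (\<lambda>c. g (inv_into D f c))"
  have h: "h (f d) = g d" if "d \<in> D" for d
    unfolding h_def using assms[of "inv_into D f (f d)" d] that inv_into_into[of "f d" f D] f_inv_into_f[of "f d" f D] by blast
  have "inj_on h (f ` D)" by (rule inj_onI) (use h assms in auto)
  moreover have "h ` (f ` D) = g ` D" using h by force
  ultimately show thesis using that h unfolding bij_betw_def by blast
qed

context cotorsion_pair_with_core
begin

lemma cluster_decomposition_classes:
  obtains \<Phi> where "bij_betw \<Phi>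
        (iso_class C ` {T. cluster_tilting C T \<and> summand C I T})
        ((iso_class C ` {M. rel_cluster_tilting C \<X> M}) \<times>
         (iso_class C ` {N. rel_cluster_tilting C \<Y> N}))"
    "\<And>T TX TY. cluster_tilting C T \<Longrightarrow> summand C I T \<Longrightarrow> cluster_decomposition C \<X> \<Y> I T TX TY \<Longrightarrow>
       \<Phi> (iso_class C T) = (iso_class C (TX \<oplus> I), iso_class C (TY \<oplus> I))"
proof -
  \<comment> \<open>\<open>D\<close> is the decomposition seen as a relation. The maps
    \<open>f\<close> and \<open>g\<close> read off the classes on its two sides, and their images
    are the sets to be matched.\<close>
  define D where "D = {(T, TX, TY). cluster_tilting C T \<and> summand C I T \<and> cluster_decomposition C \<X> \<Y> I T TX TY}"
  define f where "f = (\<lambda>(T, TX :: 'o, TY :: 'o). iso_class C T)"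
  define g where "g = (\<lambda>(T :: 'o, TX, TY). (iso_class C (TX \<oplus> I), iso_class C (TY \<oplus> I)))"
  have fg: "f d = f d' \<longleftrightarrow> g d = g d'" if "d \<in> D" "d' \<in> D" for d d'
  proof -
    obtain T TX TY where d: "d = (T, TX, TY)" by (cases d)
    obtain T' TX' TY' where d': "d' = (T', TX', TY')" by (cases d')
    have 1: "basic C T" "cluster_decomposition C \<X> \<Y> I T TX TY" "basic C T'" "cluster_decomposition C \<X> \<Y> I T' TX' TY'"
      using that cluster_tilting_iff unfolding D_def d d' by auto
    have "TX \<oplus> I \<in> Obj C" "TY \<oplus> I \<in> Obj C" using basic_Obj cluster_decomposition_supp[OF 1(2)] by auto
    then show ?thesis
      using cluster_decomposition_iso_iff[OF 1(1,3,2,4)] iso_class_eq_iff basic_Obj[OF 1(1)]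
      unfolding d d' f_def g_def by simp
  qed
  have fD: "f ` D = iso_class C ` {T. cluster_tilting C T \<and> summand C I T}" (is "_ = ?A")
  proof
    show "f ` D \<subseteq> ?A" unfolding D_def f_def by auto
    show "?A \<subseteq> f ` D"
    proof
      fix c assume "c \<in> ?A"
      then obtain T where T: "cluster_tilting C T" "summand C I T" "c = iso_class C T" by blast
      then obtain TX TY where "cluster_decomposition C \<X> \<Y> I T TX TY" using cluster_decomposition_exists by blast
      then have "(T, TX, TY) \<in> D" "f (T, TX, TY) = c" using T unfolding D_def f_def by auto
      then show "c \<in> f ` D" by blast
    qed
  qed
  have gD: "g ` D = (iso_class C ` {M. rel_cluster_tilting C \<X> M}) \<times> (iso_class C ` {N. rel_cluster_tilting C \<Y> N})" (is "_ = ?B")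
  proof
    show "g ` D \<subseteq> ?B" unfolding D_def g_def cluster_decomposition_def by auto
    show "?B \<subseteq> g ` D"
    proof
      fix c assume "c \<in> ?B"
      then obtain M N where MN: "rel_cluster_tilting C \<X> M" "rel_cluster_tilting C \<Y> N" "c = (iso_class C M, iso_class C N)"
        by blast
      obtain A where A: "A \<in> Obj C" "M \<simeq> A \<oplus> I" using rel_cluster_tilting_split[OF half_simps(1) MN(1)] by blast
      obtain B where B: "B \<in> Obj C" "N \<simeq> B \<oplus> I" using rel_cluster_tilting_split[OF half_simps(2) MN(2)] by blast
      have r: "rel_cluster_tilting C \<X> (A \<oplus> I)" "rel_cluster_tilting C \<Y> (B \<oplus> I)"
        using rel_cluster_tilting_iso[OF subcategory_left MN(1) A(2)] rel_cluster_tilting_iso[OF subcategory_right MN(2) B(2)] .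
      \<comment> \<open>The preimage of the given pair, with its tautological decomposition into
        \<open>A\<close>, \<open>I\<close> and \<open>B\<close>.\<close>
      let ?T = "A \<oplus> I \<oplus> B"
      have T: "cluster_tilting C ?T" using cluster_tilting_union[OF A(1) B(1) r] .
      have dA: "direct_sum C [A, I] (A \<oplus> I)" using direct_sum_dsum[OF A(1) core_Obj] .
      have dT: "direct_sum C [A \<oplus> I, B] ?T" using direct_sum_dsum[OF direct_sum_Obj(2)[OF dA] B(1)] .
      have "summand C I ?T" unfolding summand_iff_retract
        using retract_trans[OF direct_sum_retract(2)[OF dA] direct_sum_retract(1)[OF dT]] .
      moreover have "cluster_decomposition C \<X> \<Y> I ?T A B"
        unfolding cluster_decomposition_def using A(1) B(1) r iso_obj_refl[OF direct_sum_Obj(2)[OF dT]] by blast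
      ultimately have "(?T, A, B) \<in> D" using T unfolding D_def by blast
      moreover have "M \<in> Obj C" "N \<in> Obj C" using A(2) B(2) by (auto simp: iso_obj_def)
      then have "iso_class C M = iso_class C (A \<oplus> I)" "iso_class C N = iso_class C (B \<oplus> I)"
        using iso_class_eq_iff A(2) B(2) by simp_all
      then have "g (?T, A, B) = c" using MN(3) unfolding g_def by simp
      ultimately show "c \<in> g ` D" by (metis image_eqI)
    qed
  qed
  obtain h where h: "bij_betw h (f ` D) (g ` D)" "\<And>d. d \<in> D \<Longrightarrow> h (f d) = g d"
    using bij_betw_quotient_maps[of D f g, OF fg] by blast
  show thesis
  proof (rule that)
    show "bij_betw h ?A ?B" using h(1) unfolding fD gD .
    fix T TX TY assume "cluster_tilting C T" "summand C I T" "cluster_decomposition C \<X> \<Y> I T TX TY"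
    then show "h (iso_class C T) = (iso_class C (TX \<oplus> I), iso_class C (TY \<oplus> I))"
      using h(2)[of "(T, TX, TY)"] unfolding D_def f_def g_def by simp
  qed
qed

end

theorem proposition5p3:
  fixes C :: "('o, 'm::ab_group_add, 'k::field) tri_cat" and \<X> \<Y> :: "'o set" and I :: 'o
  assumes "triangulated_category C" and "hom_finite C" and "krull_schmidt C"
    and "two_calabi_yau C" and "\<exists>T. cluster_tilting C T"
    and "cotorsion_pair C \<X> \<Y>" and "core_object C \<X> \<Y> I"
  shows
    "(\<forall>T. cluster_tilting C T \<and> summand C I T \<longrightarrow>
        (\<exists>TX TY. cluster_decomposition C \<X> \<Y> I T TX TY) \<and>
        (\<forall>TX TY TX' TY'. cluster_decomposition C \<X> \<Y> I T TX TY \<and>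
           cluster_decomposition C \<X> \<Y> I T TX' TY' \<longrightarrow> TX \<simeq>\<^bsub>C\<^esub> TX' \<and> TY \<simeq>\<^bsub>C\<^esub> TY'))
     \<and>
     ((\<forall>M. rel_cluster_tilting C \<X> M \<longrightarrow>
         summand C I M \<and> (\<exists>MX \<in> Obj C. M \<simeq>\<^bsub>C\<^esub> MX \<oplus>\<^bsub>C\<^esub> I)) \<and>
      (\<forall>M. rel_cluster_tilting C \<Y> M \<longrightarrow>
         summand C I M \<and> (\<exists>MY \<in> Obj C. M \<simeq>\<^bsub>C\<^esub> MY \<oplus>\<^bsub>C\<^esub> I)) \<and>
      (\<forall>MX \<in> Obj C. \<forall>MY \<in> Obj C.
         rel_cluster_tilting C \<X> (MX \<oplus>\<^bsub>C\<^esub> I) \<and> rel_cluster_tilting C \<Y> (MY \<oplus>\<^bsub>C\<^esub> I) \<longrightarrow>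
         cluster_tilting C (MX \<oplus>\<^bsub>C\<^esub> I \<oplus>\<^bsub>C\<^esub> MY)))
     \<and>
     (\<exists>\<Phi>. bij_betw \<Phi>
        (iso_class C ` {T. cluster_tilting C T \<and> summand C I T})
        ((iso_class C ` {M. rel_cluster_tilting C \<X> M}) \<times>
         (iso_class C ` {N. rel_cluster_tilting C \<Y> N})) \<and>
        (\<forall>T TX TY. cluster_tilting C T \<and> summand C I T \<and>
           cluster_decomposition C \<X> \<Y> I T TX TY \<longrightarrow>
           \<Phi> (iso_class C T) = (iso_class C (TX \<oplus>\<^bsub>C\<^esub> I), iso_class C (TY \<oplus>\<^bsub>C\<^esub> I))))"
proof -
  interpret triangulated_category C by (rule assms(1))
  interpret cotorsion_pair_with_core C \<X> \<Y> I
    by unfold_locales (use assms in blast)+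
  obtain \<Phi> where \<Phi>: "bij_betw \<Phi>
        (iso_class C ` {T. cluster_tilting C T \<and> summand C I T})
        ((iso_class C ` {M. rel_cluster_tilting C \<X> M}) \<times>
         (iso_class C ` {N. rel_cluster_tilting C \<Y> N}))"
    "\<And>T TX TY. cluster_tilting C T \<Longrightarrow> summand C I T \<Longrightarrow> cluster_decomposition C \<X> \<Y> I T TX TY \<Longrightarrow>
       \<Phi> (iso_class C T) = (iso_class C (TX \<oplus>\<^bsub>C\<^esub> I), iso_class C (TY \<oplus>\<^bsub>C\<^esub> I))"
    using cluster_decomposition_classes by blast
  show ?thesis
  proof (intro conjI allI impI ballI)
    fix T assume T: "cluster_tilting C T \<and> summand C I T"
    show "\<exists>TX TY. cluster_decomposition C \<X> \<Y> I T TX TY"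
      using cluster_decomposition_exists T by blast
    fix TX TY TX' TY'
    assume "cluster_decomposition C \<X> \<Y> I T TX TY \<and> cluster_decomposition C \<X> \<Y> I T TX' TY'"
    then show "TX \<simeq>\<^bsub>C\<^esub> TX'" "TY \<simeq>\<^bsub>C\<^esub> TY'" using cluster_decomposition_unique by blast+
  next
    fix M assume "rel_cluster_tilting C \<X> M"
    then show "summand C I M" "\<exists>MX \<in> Obj C. M \<simeq>\<^bsub>C\<^esub> MX \<oplus>\<^bsub>C\<^esub> I"
      using rel_cluster_tilting_split[OF half_simps(1)] by blast+
  next
    fix M assume "rel_cluster_tilting C \<Y> M"
    then show "summand C I M" "\<exists>MY \<in> Obj C. M \<simeq>\<^bsub>C\<^esub> MY \<oplus>\<^bsub>C\<^esub> I"
      using rel_cluster_tilting_split[OF half_simps(2)] by blast+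
  next
    fix MX MY assume "MX \<in> Obj C" "MY \<in> Obj C"
      "rel_cluster_tilting C \<X> (MX \<oplus>\<^bsub>C\<^esub> I) \<and> rel_cluster_tilting C \<Y> (MY \<oplus>\<^bsub>C\<^esub> I)"
    then show "cluster_tilting C (MX \<oplus>\<^bsub>C\<^esub> I \<oplus>\<^bsub>C\<^esub> MY)" using cluster_tilting_union by blast
  next
    show "\<exists>\<Phi>. bij_betw \<Phi>
        (iso_class C ` {T. cluster_tilting C T \<and> summand C I T})
        ((iso_class C ` {M. rel_cluster_tilting C \<X> M}) \<times>
         (iso_class C ` {N. rel_cluster_tilting C \<Y> N})) \<and>
        (\<forall>T TX TY. cluster_tilting C T \<and> summand C I T \<and>
           cluster_decomposition C \<X> \<Y> I T TX TY \<longrightarrow>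
           \<Phi> (iso_class C T) = (iso_class C (TX \<oplus>\<^bsub>C\<^esub> I), iso_class C (TY \<oplus>\<^bsub>C\<^esub> I)))"
      using \<Phi> by blast
  qed
qed

end
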